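(* Let $\mathscr P$ be a holomorphic Fredholm family over $\mathcal Y\times\Sigma$ satisfying the standing assumptions in the context, and let $y\in\mathcal Y$. Let $\Omega\Subset\Sigma$ be open with smooth positively oriented boundary and $\operatorname{sing}_b(\mathscr P_y)\subset\Omega$. Then the sesquilinear pairing $$\mathscr K_y\times\mathscr K^*_y\to\mathbb C,\qquad [\phi,\psi]^\flat_y=\frac1{2\pi}\oint_{\partial\Omega}\big(\phi(\sigma),\mathscr P^*_y(\overline\sigma)\psi(\overline\sigma)\big)_{\mathscr H_{1,y}}\,d\sigma$$ is nondegenerate.
   Context: **Setting and standing assumptions.** $\mathcal Y$ is a smooth connected manifold; $\mathscr H_1\to\mathcal Y$ and $\mathscr H_2\to\mathcal Y$ are smooth Hilbert space bundles with model spaces $H_1,H_2$ (with smooth unitary local trivializations). $\mathscr D\to\mathcal Y$ is another smooth Hilbert space bundle, with model space $\mathcal D$, continuously embedded in $\mathscr H_1$ with fiberwise dense image and such that the (smooth, unitary) trivializations of $\mathscr H_1$ restrict to smooth trivializations of $\mathscr D$. $\Sigma\subset\mathbb C$ is open and connected. Let $\mathrm{pr}:\mathcal Y\times\Sigma\to\mathcal Y$ be the projection, and let $\mathscr P:\mathrm{pr}^*\mathscr D\subset \mathrm{pr}^*\mathscr H_1\to \mathrm{pr}^*\mathscr H_2$ be a smooth bundle homomorphism covering the identity, consisting of operators $\mathscr P_y(\sigma):\mathscr D_y\subset\mathscr H_{1,y}\to\mathscr H_{2,y}$, each closed (as an unbounded operator with domain $\mathscr D_y$) and Fredholm, depending holomorphically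 on $\sigma$. For each $y\in\mathcal Y$ there is $\sigma\in\Sigma$ such that $\mathscr P_y(\sigma)$ is invertible. Furthermore, the domains of the Hilbert space adjoints $\mathscr P_y(\sigma)^*$ join to give a smooth Hilbert space bundle $\mathscr D^*\to\mathcal Y$ (the domain of $\mathscr P_y(\sigma)^*$ being $\mathscr D^*_y$ for all $\sigma$), continuously embedded in $\mathscr H_2$ and such that the smooth unitary trivializations of $\mathscr H_2$ restrict to trivializations of $\mathscr D^*$; and with $$\mathscr P^*_y(\sigma)=\mathscr P_y(\overline\sigma)^*:\mathscr D^*_y\subset\mathscr H_{2,y}\to\mathscr H_{1,y},\qquad\sigma\in\overline\Sigma=\{\overline\sigma:\sigma\in\Sigma\},$$ one obtains a smooth homomorphism over $\mathcal Y\times\overline\Sigma$, holomorphic in $\sigma$, with the same Fredholm, analyticity and invertibility properties as $\mathscr P$. Let $\operatorname{sing}_b(\mathscr P_y)=\{\sigma\in\Sigma:\mathscr P_y(\sigma)\text{ is not invertible}\}$ and $\operatorname{sing}_e(\mathscr P)=\{(y,\sigma)\in\mathcal Y\times\Sigma:\sigma\in\operatorname{sing}_b(\mathscr P_y)\}$. It is assumed that $\operatorname{sing}_b(\mathscr P_y)$ is finite for each $y\in\mathcal Y$ and that $\operatorname{sing}_e(\mathscr P)$ is closed in $\mathcal Y\times\mathbb C$. **The spaces $\mathscr K_y$ and $\mathscr K_y^*$.** $\mathfrak M(V,K)$ and $\mathfrak H(V,K)$ are the meromorphic, respectively holomorphic, $K$-valued functions on the open set $V\subset\mathbb C$. For $f\in\mathfrak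 M(V,K)$ with finitely many poles in $V$, $\mathfrak s_V(f)\in\mathfrak M(\mathbb C,K)$ is the sum of the singular (principal) parts of $f$ at its poles in $V$. Define $$\mathscr K_y=\{\mathfrak s_\Sigma(\phi):\phi\in\mathfrak M(\Sigma,\mathscr D_y),\ \mathscr P_y\phi\in\mathfrak H(\Sigma,\mathscr H_{2,y})\},$$ $$\mathscr K^*_y=\{\mathfrak s_{\overline\Sigma}(\psi):\psi\in\mathfrak M(\overline\Sigma,\mathscr D^*_y),\ \mathscr P^*_y\psi\in\mathfrak H(\overline\Sigma,\mathscr H_{1,y})\}.$$ Elements of $\mathscr K_y$ have poles only in $\operatorname{sing}_b(\mathscr P_y)$, and elements of $\mathscr K^*_y$ only in the conjugate set $\overline{\operatorname{sing}_b(\mathscr P_y)}$. $\Omega\Subset\Sigma$ means that the closure of $\Omega$ is a compact subset of $\Sigma$. Inner products are linear in the first argument and antilinear in the second. *)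

theory Defs
  imports "HOL-Complex_Analysis.Complex_Analysis"
begin

section \<open>Complex vector spaces and Hilbert spaces\<close>

class complex_vector = real_vector +
  fixes scaleC :: "complex \<Rightarrow> 'a \<Rightarrow> 'a" (infixr "*\<^sub>C" 75)
  assumes scaleC_add_right: "a *\<^sub>C (x + y) = a *\<^sub>C x + a *\<^sub>C y"
    and scaleC_add_left: "(a + b) *\<^sub>C x = a *\<^sub>C x + b *\<^sub>C x"
    and scaleC_scaleC: "a *\<^sub>C (b *\<^sub>C x) = (a * b) *\<^sub>C x"
    and scaleC_one: "1 *\<^sub>C x = x"
    and scaleR_scaleC: "r *\<^sub>R x = complex_of_real r *\<^sub>C x"

global_interpretation complex_vector:
  vector_space "scaleC :: complex \<Rightarrow> 'a \<Rightarrow> 'a::complex_vector"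
  defines csubspace_raw_def: csubspace = complex_vector.subspace
    and cspan_raw_def: cspan = complex_vector.span
  by unfold_locales (rule scaleC_add_right scaleC_add_left scaleC_scaleC scaleC_one)+

text \<open>Inner products are linear in the first argument and antilinear in the second.\<close>

class complex_hilbert = complex_vector + banach +
  fixes cinner :: "'a \<Rightarrow> 'a \<Rightarrow> complex"
  assumes cinner_commute: "cinner x y = cnj (cinner y x)"
    and cinner_add_left: "cinner (x + y) z = cinner x z + cinner y z"
    and cinner_scaleC_left: "cinner (a *\<^sub>C x) y = a * cinner x y"
    and cinner_self: "cinner x x = complex_of_real ((norm x)\<^sup>2)"

instantiation complex :: complex_hilbert
begin
definition scaleC_complex :: "complex \<Rightarrow> complex \<Rightarrow> complex" where
  "scaleC_complex a x = a * x"
definition cinner_complex :: "complex \<Rightarrow> complex \<Rightarrow> complex" where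
  "cinner_complex x y = x * cnj y"
instance
  by standard (auto simp: scaleC_complex_def cinner_complex_def algebra_simps
      scaleR_conv_of_real complex_mult_cnj cmod_power2)
end

text \<open>
  Model spaces of bundles are types of class \<open>complex_hilbert\<close>. The fibres of a bundle vary with
  the base point, so a fibre is a linear subspace of an ambient complex vector space
  with its own inner product. The ambient space carries no topology: all the fibres of a bundle can
  be put into one, for instance their direct sum. This also makes the inclusion of a dense
  domain into a Hilbert space an inclusion of sets.
\<close>

record 'e hspace =
  carr :: "'e set"
  ip :: "'e \<Rightarrow> 'e \<Rightarrow> complex"

definition hnorm :: "'e hspace \<Rightarrow> 'e \<Rightarrow> real" where
  "hnorm X u = sqrt (Re (ip X u u))"

definition hilbert_space :: "'e::complex_vector hspace \<Rightarrow> bool" where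
  "hilbert_space X \<longleftrightarrow>
     csubspace (carr X) \<and>
     (\<forall>u\<in>carr X. \<forall>v\<in>carr X. ip X u v = cnj (ip X v u)) \<and>
     (\<forall>u\<in>carr X. \<forall>v\<in>carr X. \<forall>w\<in>carr X. ip X (u + v) w = ip X u w + ip X v w) \<and>
     (\<forall>u\<in>carr X. \<forall>v\<in>carr X. \<forall>a. ip X (a *\<^sub>C u) v = a * ip X u v) \<and>
     (\<forall>u\<in>carr X. u \<noteq> 0 \<longrightarrow> 0 < Re (ip X u u)) \<and>
     (\<forall>s. (\<forall>n. s n \<in> carr X) \<and>
          (\<forall>e>0. \<exists>N. \<forall>m\<ge>N. \<forall>n\<ge>N. hnorm X (s m - s n) < e) \<longrightarrow>
          (\<exists>l\<in>carr X. (\<lambda>n. hnorm X (s n - l)) \<longlonglongrightarrow> 0))"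

definition model_space :: "'h::complex_hilbert hspace" where
  "model_space = \<lparr>carr = UNIV, ip = cinner\<rparr>"

definition clinear_between ::
    "'e::complex_vector set \<Rightarrow> 'f::complex_vector set \<Rightarrow> ('e \<Rightarrow> 'f) \<Rightarrow> bool" where
  "clinear_between S T f \<longleftrightarrow>
     (\<forall>u\<in>S. f u \<in> T) \<and>
     (\<forall>u\<in>S. \<forall>v\<in>S. f (u + v) = f u + f v) \<and>
     (\<forall>a. \<forall>u\<in>S. f (a *\<^sub>C u) = a *\<^sub>C f u)"

definition bounded_op ::
    "'e::complex_vector hspace \<Rightarrow> 'f::complex_vector hspace \<Rightarrow> ('e \<Rightarrow> 'f) \<Rightarrow> bool" where
  "bounded_op X Y f \<longleftrightarrow>
     clinear_between (carr X) (carr Y) f \<and> (\<exists>C. \<forall>u\<in>carr X. hnorm Y (f u) \<le> C * hnorm X u)"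

definition invertible_op ::
    "'e::complex_vector hspace \<Rightarrow> 'f::complex_vector hspace \<Rightarrow> ('e \<Rightarrow> 'f) \<Rightarrow> bool" where
  "invertible_op X Y f \<longleftrightarrow>
     bounded_op X Y f \<and>
     (\<exists>g. bounded_op Y X g \<and> (\<forall>u\<in>carr X. g (f u) = u) \<and> (\<forall>v\<in>carr Y. f (g v) = v))"


section \<open>Unbounded operators\<close>

definition hlim :: "'e::complex_vector hspace \<Rightarrow> (nat \<Rightarrow> 'e) \<Rightarrow> 'e \<Rightarrow> bool" where
  "hlim X s l \<longleftrightarrow> (\<lambda>n. hnorm X (s n - l)) \<longlonglongrightarrow> 0"

text \<open>\<open>T\<close> with domain \<open>S\<close>, as an unbounded operator from \<open>H\<close> to \<open>K\<close>.\<close>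

definition closed_op ::
    "'e::complex_vector set \<Rightarrow> 'e hspace \<Rightarrow> 'f::complex_vector hspace \<Rightarrow> ('e \<Rightarrow> 'f) \<Rightarrow> bool" where
  "closed_op S H K T \<longleftrightarrow>
     (\<forall>s u v. (\<forall>n. s n \<in> S) \<and> u \<in> carr H \<and> v \<in> carr K \<and>
              hlim H s u \<and> hlim K (\<lambda>n. T (s n)) v \<longrightarrow> u \<in> S \<and> T u = v)"

definition fredholm_op ::
    "'e::complex_vector set \<Rightarrow> 'f::complex_vector hspace \<Rightarrow> ('e \<Rightarrow> 'f) \<Rightarrow> bool" where
  "fredholm_op S K T \<longleftrightarrow>
     (\<exists>B. finite B \<and> {u \<in> S. T u = 0} \<subseteq> cspan B) \<and>
     (\<exists>B. finite B \<and> B \<subseteq> carr K \<and> (\<forall>v\<in>carr K. \<exists>u\<in>S. v - T u \<in> cspan B)) \<and>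
     (\<forall>s v. (\<forall>n. s n \<in> T ` S) \<and> v \<in> carr K \<and> hlim K s v \<longrightarrow> v \<in> T ` S)"

definition adjoint_domain ::
    "'e set \<Rightarrow> 'e hspace \<Rightarrow> 'f hspace \<Rightarrow> ('e \<Rightarrow> 'f) \<Rightarrow> 'f set" where
  "adjoint_domain S H K T = {v \<in> carr K. \<exists>w\<in>carr H. \<forall>u\<in>S. ip K (T u) v = ip H u w}"

text \<open>Well defined on the adjoint domain when \<open>S\<close> is dense in \<open>H\<close>.\<close>

definition hilbert_adjoint ::
    "'e set \<Rightarrow> 'e hspace \<Rightarrow> 'f hspace \<Rightarrow> ('e \<Rightarrow> 'f) \<Rightarrow> 'f \<Rightarrow> 'e" where
  "hilbert_adjoint S H K T v = (THE w. w \<in> carr H \<and> (\<forall>u\<in>S. ip K (T u) v = ip H u w))"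


section \<open>Smooth manifolds\<close>

text \<open>
  Iterated directional derivatives characterise \<open>C\<^sup>k\<close> maps on open subsets of a
  finite-dimensional space (with values in any normed space); they are only used there.
\<close>

fun Ck_on :: "nat \<Rightarrow> 'a::real_normed_vector set \<Rightarrow> ('a \<Rightarrow> 'b::real_normed_vector) \<Rightarrow> bool" where
  "Ck_on 0 S f = continuous_on S f"
| "Ck_on (Suc k) S f =
     ((\<forall>x\<in>S. f differentiable (at x)) \<and> (\<forall>v. Ck_on k S (\<lambda>x. frechet_derivative f (at x) v)))"

definition smooth_on :: "'a::real_normed_vector set \<Rightarrow> ('a \<Rightarrow> 'b::real_normed_vector) \<Rightarrow> bool" where
  "smooth_on S f \<longleftrightarrow> (\<forall>k. Ck_on k S f)"

text \<open>
  The coordinate space \<open>'b\<close> is a finite-dimensional normed space rather than a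
  \<open>euclidean_space\<close>, because the latter class excludes dimension zero.
\<close>

definition smooth_atlas ::
    "('y::topological_space set \<times> ('y \<Rightarrow> 'b::real_normed_vector)) set \<Rightarrow> bool" where
  "smooth_atlas A \<longleftrightarrow>
     (\<exists>B::'b set. finite B \<and> span B = UNIV) \<and>
     (\<Union>(U, \<xi>)\<in>A. U) = UNIV \<and>
     (\<forall>(U, \<xi>)\<in>A. open U \<and> open (\<xi> ` U) \<and> homeomorphism U (\<xi> ` U) \<xi> (inv_into U \<xi>)) \<and>
     (\<forall>(U, \<xi>)\<in>A. \<forall>(V, \<kappa>)\<in>A. smooth_on (\<xi> ` (U \<inter> V)) (\<kappa> \<circ> inv_into U \<xi>))"

definition smooth_map_on ::
    "('y set \<times> ('y \<Rightarrow> 'b::real_normed_vector)) set \<Rightarrow> 'y set \<Rightarrow>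
      ('y \<Rightarrow> 'v::real_normed_vector) \<Rightarrow> bool" where
  "smooth_map_on A W f \<longleftrightarrow> (\<forall>(U, \<xi>)\<in>A. smooth_on (\<xi> ` (U \<inter> W)) (f \<circ> inv_into U \<xi>))"

definition smooth_map_on_prod ::
    "('y set \<times> ('y \<Rightarrow> 'b::real_normed_vector)) set \<Rightarrow> 'y set \<Rightarrow> complex set \<Rightarrow>
      ('y \<Rightarrow> complex \<Rightarrow> 'v::real_normed_vector) \<Rightarrow> bool" where
  "smooth_map_on_prod A W \<Sigma> f \<longleftrightarrow>
     (\<forall>(U, \<xi>)\<in>A. smooth_on (\<xi> ` (U \<inter> W) \<times> \<Sigma>) (\<lambda>(x, \<sigma>). f (inv_into U \<xi> x) \<sigma>))"


section \<open>Smooth Hilbert space bundles\<close>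

text \<open>
  A bundle is given by its fibres and a family of local trivializations \<open>(U, \<tau>)\<close>, where
  \<open>\<tau> y\<close> maps the fibre over \<open>y \<in> U\<close> to the model space \<open>'h\<close>.
\<close>

record ('y, 'e, 'h) hbundle =
  fibre :: "'y \<Rightarrow> 'e hspace"
  trivs :: "('y set \<times> ('y \<Rightarrow> 'e \<Rightarrow> 'h)) set"

definition smooth_hilbert_bundle ::
    "('y::topological_space set \<times> ('y \<Rightarrow> 'b::real_normed_vector)) set \<Rightarrow>
      ('y, 'e::complex_vector, 'h::complex_hilbert) hbundle \<Rightarrow> bool" where
  "smooth_hilbert_bundle A E \<longleftrightarrow>
     (\<forall>y. hilbert_space (fibre E y)) \<and>
     (\<Union>(U, \<tau>)\<in>trivs E. U) = UNIV \<and>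
     (\<forall>(U, \<tau>)\<in>trivs E. open U \<and> (\<forall>y\<in>U. invertible_op (fibre E y) model_space (\<tau> y))) \<and>
     (\<forall>(U, \<tau>)\<in>trivs E. \<forall>(V, \<upsilon>)\<in>trivs E.
        smooth_map_on A (U \<inter> V)
          (\<lambda>y. Blinfun (\<upsilon> y \<circ> inv_into (carr (fibre E y)) (\<tau> y))))"

definition unitary_trivs :: "('y, 'e, 'h::complex_hilbert) hbundle \<Rightarrow> bool" where
  "unitary_trivs E \<longleftrightarrow>
     (\<forall>(U, \<tau>)\<in>trivs E. \<forall>y\<in>U. \<forall>u\<in>carr (fibre E y). \<forall>v\<in>carr (fibre E y).
        cinner (\<tau> y u) (\<tau> y v) = ip (fibre E y) u v)"

text \<open>
  \<open>D\<close> is continuously embedded in \<open>E\<close> and every trivialization of \<open>E\<close> restricts to one of \<open>D\<close>,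
  the model space \<open>'d\<close> of \<open>D\<close> being identified with a subspace of \<open>'h\<close> through a bounded map
  \<open>\<iota>\<close> (necessarily injective).
\<close>

definition embedded_bundle ::
    "('y, 'e::complex_vector, 'd::complex_hilbert) hbundle \<Rightarrow>
      ('y, 'e, 'h::complex_hilbert) hbundle \<Rightarrow> bool" where
  "embedded_bundle D E \<longleftrightarrow>
     (\<forall>y. carr (fibre D y) \<subseteq> carr (fibre E y) \<and>
          (\<exists>C. \<forall>u\<in>carr (fibre D y). hnorm (fibre E y) u \<le> C * hnorm (fibre D y) u)) \<and>
     (\<forall>(U, \<tau>)\<in>trivs E. \<exists>\<tau>' (\<iota> :: 'd \<Rightarrow> 'h).
        (U, \<tau>') \<in> trivs D \<and> bounded_op model_space model_space \<iota> \<and>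
        (\<forall>y\<in>U. \<forall>u\<in>carr (fibre D y). \<tau> y u = \<iota> (\<tau>' y u)))"

definition fibrewise_dense ::
    "('y, 'e::complex_vector, 'd) hbundle \<Rightarrow> ('y, 'e, 'h) hbundle \<Rightarrow> bool" where
  "fibrewise_dense D E \<longleftrightarrow>
     (\<forall>y. \<forall>u\<in>carr (fibre E y). \<forall>e>0. \<exists>v\<in>carr (fibre D y). hnorm (fibre E y) (u - v) < e)"


section \<open>Holomorphic and meromorphic functions with values in a Hilbert space\<close>

definition holo_into ::
    "complex set \<Rightarrow> 'e::complex_vector hspace \<Rightarrow> (complex \<Rightarrow> 'e) \<Rightarrow> bool" where
  "holo_into V X f \<longleftrightarrow>
     (\<forall>z\<in>V. f z \<in> carr X) \<and>
     (\<forall>z\<in>V. \<exists>d\<in>carr X.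
        ((\<lambda>w. hnorm X (inverse (w - z) *\<^sub>C (f w - f z) - d)) \<longlongrightarrow> 0) (at z within V))"

text \<open>The coefficient of \<open>(\<sigma> - p)\<^sup>-\<^sup>k\<^sup>-\<^sup>1\<close> is \<open>a k\<close>; the value at \<open>p\<close> is \<open>0\<close>.\<close>

definition laurent_tail :: "complex \<Rightarrow> (nat \<Rightarrow> 'e::complex_vector) \<Rightarrow> complex \<Rightarrow> 'e" where
  "laurent_tail p a \<sigma> = (\<Sum>k | a k \<noteq> 0. (inverse (\<sigma> - p) ^ Suc k) *\<^sub>C a k)"

definition has_principal_part ::
    "'e::complex_vector hspace \<Rightarrow> (complex \<Rightarrow> 'e) \<Rightarrow> complex \<Rightarrow> (nat \<Rightarrow> 'e) \<Rightarrow> bool" where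
  "has_principal_part X f p a \<longleftrightarrow>
     (\<forall>k. a k \<in> carr X) \<and> finite {k. a k \<noteq> 0} \<and>
     (\<exists>r h. 0 < r \<and> holo_into (ball p r) X h \<and>
            (\<forall>\<sigma>\<in>ball p r - {p}. f \<sigma> = h \<sigma> + laurent_tail p a \<sigma>))"

definition principal_part ::
    "'e::complex_vector hspace \<Rightarrow> (complex \<Rightarrow> 'e) \<Rightarrow> complex \<Rightarrow> nat \<Rightarrow> 'e" where
  "principal_part X f p = (THE a. has_principal_part X f p a)"

text \<open>
  Meromorphic functions are total functions whose values on a discrete set are irrelevant,
  as for \<open>meromorphic_on\<close>.
\<close>

definition mero_into ::
    "complex set \<Rightarrow> 'e::complex_vector hspace \<Rightarrow> (complex \<Rightarrow> 'e) \<Rightarrow> bool" where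
  "mero_into V X f \<longleftrightarrow> (\<forall>p\<in>V. \<exists>a. has_principal_part X f p a)"

definition poles_in ::
    "complex set \<Rightarrow> 'e::complex_vector hspace \<Rightarrow> (complex \<Rightarrow> 'e) \<Rightarrow> complex set" where
  "poles_in V X f = {p \<in> V. \<exists>k. principal_part X f p k \<noteq> 0}"

text \<open>
  The sum of the principal parts at the poles in \<open>V\<close>, for \<open>f\<close> with finitely many poles there.
  By the convention on values of \<open>laurent_tail\<close> it represents a meromorphic function by exactly
  one total function, so that equality of such sums is equality of functions.
\<close>

definition singular_part ::
    "complex set \<Rightarrow> 'e::complex_vector hspace \<Rightarrow> (complex \<Rightarrow> 'e) \<Rightarrow> complex \<Rightarrow> 'e" where
  "singular_part V X f \<sigma> = (\<Sum>p\<in>poles_in V X f. laurent_tail p (principal_part X f p) \<sigma>)"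

text \<open>
  The space of singular parts of meromorphic \<open>X\<close>-valued \<open>\<phi>\<close> such that \<open>T \<phi>\<close> is a holomorphic
  \<open>Y\<close>-valued function \<open>g\<close>; near each \<open>p\<close>, they agree away from \<open>p\<close> itself.
\<close>

definition singular_kernel ::
    "complex set \<Rightarrow> 'e::complex_vector hspace \<Rightarrow> 'f::complex_vector hspace \<Rightarrow>
      (complex \<Rightarrow> 'e \<Rightarrow> 'f) \<Rightarrow> (complex \<Rightarrow> 'e) set" where
  "singular_kernel V X Y T =
     {singular_part V X \<phi> | \<phi>. mero_into V X \<phi> \<and>
        (\<exists>g. holo_into V Y g \<and> (\<forall>p\<in>V. \<forall>\<^sub>F \<sigma> in at p. T \<sigma> (\<phi> \<sigma>) = g \<sigma>))}"


section \<open>Holomorphic Fredholm families\<close>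

text \<open>Complex differentiability in the norm of bounded operators from \<open>X\<close> to \<open>Y\<close>.\<close>

definition holo_family ::
    "complex set \<Rightarrow> 'e::complex_vector hspace \<Rightarrow> 'f::complex_vector hspace \<Rightarrow>
      (complex \<Rightarrow> 'e \<Rightarrow> 'f) \<Rightarrow> bool" where
  "holo_family \<Sigma> X Y T \<longleftrightarrow>
     (\<forall>\<sigma>\<in>\<Sigma>. bounded_op X Y (T \<sigma>)) \<and>
     (\<forall>\<sigma>\<in>\<Sigma>. \<exists>Q. bounded_op X Y Q \<and>
        (\<forall>e>0. \<exists>d>0. \<forall>\<sigma>'\<in>\<Sigma>. cmod (\<sigma>' - \<sigma>) < d \<longrightarrow>
           (\<forall>u\<in>carr X. hnorm Y (T \<sigma>' u - T \<sigma> u - (\<sigma>' - \<sigma>) *\<^sub>C Q u)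
                          \<le> e * cmod (\<sigma>' - \<sigma>) * hnorm X u)))"

text \<open>
  A smooth homomorphism between the pullbacks of \<open>D\<close> and \<open>E\<close> to the product of the base with
  \<open>\<Sigma>\<close>: in local trivializations it is a smooth map into the bounded operators.
\<close>

definition smooth_hom ::
    "('y set \<times> ('y \<Rightarrow> 'b::real_normed_vector)) set \<Rightarrow> complex set \<Rightarrow>
      ('y, 'e::complex_vector, 'd::complex_hilbert) hbundle \<Rightarrow>
      ('y, 'f::complex_vector, 'h::complex_hilbert) hbundle \<Rightarrow>
      ('y \<Rightarrow> complex \<Rightarrow> 'e \<Rightarrow> 'f) \<Rightarrow> bool" where
  "smooth_hom A \<Sigma> D E P \<longleftrightarrow>
     (\<forall>y. \<forall>\<sigma>\<in>\<Sigma>. bounded_op (fibre D y) (fibre E y) (P y \<sigma>)) \<and>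
     (\<forall>(U, \<tau>)\<in>trivs D. \<forall>(V, \<upsilon>)\<in>trivs E.
        smooth_map_on_prod A (U \<inter> V) \<Sigma>
          (\<lambda>y \<sigma>. Blinfun (\<upsilon> y \<circ> P y \<sigma> \<circ> inv_into (carr (fibre D y)) (\<tau> y))))"

definition fredholm_family ::
    "('y set \<times> ('y \<Rightarrow> 'b::real_normed_vector)) set \<Rightarrow> complex set \<Rightarrow>
      ('y, 'e::complex_vector, 'd::complex_hilbert) hbundle \<Rightarrow>
      ('y, 'e, 'h::complex_hilbert) hbundle \<Rightarrow>
      ('y, 'f::complex_vector, 'k::complex_hilbert) hbundle \<Rightarrow>
      ('y \<Rightarrow> complex \<Rightarrow> 'e \<Rightarrow> 'f) \<Rightarrow> bool" where
  "fredholm_family A \<Sigma> D H K P \<longleftrightarrow>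
     smooth_hom A \<Sigma> D K P \<and>
     (\<forall>y. \<forall>\<sigma>\<in>\<Sigma>. closed_op (carr (fibre D y)) (fibre H y) (fibre K y) (P y \<sigma>)) \<and>
     (\<forall>y. \<forall>\<sigma>\<in>\<Sigma>. fredholm_op (carr (fibre D y)) (fibre K y) (P y \<sigma>)) \<and>
     (\<forall>y. holo_family \<Sigma> (fibre D y) (fibre K y) (P y)) \<and>
     (\<forall>y. \<exists>\<sigma>\<in>\<Sigma>. invertible_op (fibre D y) (fibre K y) (P y \<sigma>))"

definition adjoint_family ::
    "('y, 'e, 'd) hbundle \<Rightarrow> ('y, 'e, 'h) hbundle \<Rightarrow> ('y, 'f, 'k) hbundle \<Rightarrow>
      ('y \<Rightarrow> complex \<Rightarrow> 'e \<Rightarrow> 'f) \<Rightarrow> 'y \<Rightarrow> complex \<Rightarrow> 'f \<Rightarrow> 'e" where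
  "adjoint_family D H K P y \<sigma> =
     hilbert_adjoint (carr (fibre D y)) (fibre H y) (fibre K y) (P y (cnj \<sigma>))"

definition sing_b ::
    "complex set \<Rightarrow> 'e::complex_vector hspace \<Rightarrow> 'f::complex_vector hspace \<Rightarrow>
      (complex \<Rightarrow> 'e \<Rightarrow> 'f) \<Rightarrow> complex set" where
  "sing_b \<Sigma> X Y T = {\<sigma> \<in> \<Sigma>. \<not> invertible_op X Y (T \<sigma>)}"

definition sing_e ::
    "complex set \<Rightarrow> ('y, 'e::complex_vector, 'd) hbundle \<Rightarrow>
      ('y, 'f::complex_vector, 'k) hbundle \<Rightarrow>
      ('y \<Rightarrow> complex \<Rightarrow> 'e \<Rightarrow> 'f) \<Rightarrow> ('y \<times> complex) set" where
  "sing_e \<Sigma> D K P = {(y, \<sigma>). \<sigma> \<in> sing_b \<Sigma> (fibre D y) (fibre K y) (P y)}"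

text \<open>
  The standing assumptions: \<open>H1\<close>, \<open>H2\<close> are the ambient bundles, \<open>D\<close> and \<open>Ds\<close> the bundles of
  domains of the operators and of their adjoints.
\<close>

definition fredholm_setting ::
    "('y::{t2_space, second_countable_topology} set \<times> ('y \<Rightarrow> 'b::real_normed_vector)) set \<Rightarrow>
      complex set \<Rightarrow>
      ('y, 'e::complex_vector, 'h1::complex_hilbert) hbundle \<Rightarrow>
      ('y, 'f::complex_vector, 'h2::complex_hilbert) hbundle \<Rightarrow>
      ('y, 'e, 'd::complex_hilbert) hbundle \<Rightarrow>
      ('y, 'f, 'ds::complex_hilbert) hbundle \<Rightarrow>
      ('y \<Rightarrow> complex \<Rightarrow> 'e \<Rightarrow> 'f) \<Rightarrow> bool" where
  "fredholm_setting A \<Sigma> H1 H2 D Ds P \<longleftrightarrow>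
     smooth_atlas A \<and> connected (UNIV :: 'y set) \<and>
     open \<Sigma> \<and> connected \<Sigma> \<and>
     smooth_hilbert_bundle A H1 \<and> unitary_trivs H1 \<and>
     smooth_hilbert_bundle A H2 \<and> unitary_trivs H2 \<and>
     smooth_hilbert_bundle A D \<and> embedded_bundle D H1 \<and> fibrewise_dense D H1 \<and>
     fredholm_family A \<Sigma> D H1 H2 P \<and>
     smooth_hilbert_bundle A Ds \<and> embedded_bundle Ds H2 \<and>
     (\<forall>y. \<forall>\<sigma>\<in>\<Sigma>. adjoint_domain (carr (fibre D y)) (fibre H1 y) (fibre H2 y) (P y \<sigma>)
                    = carr (fibre Ds y)) \<and>
     fredholm_family A (cnj ` \<Sigma>) Ds H2 H1 (adjoint_family D H1 H2 P) \<and>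
     (\<forall>y. finite (sing_b \<Sigma> (fibre D y) (fibre H2 y) (P y))) \<and>
     closed (sing_e \<Sigma> D H2 P)"


section \<open>Domains with smooth boundary\<close>

text \<open>
  \<open>\<Gamma>\<close> parametrises the boundary of \<open>\<Omega>\<close> by finitely many disjoint, regular, simple closed smooth
  curves with \<open>\<Omega>\<close> on the left and the exterior on the right. Each curve is a function of
  period 1, so that it is also smooth as a closed curve.
\<close>

definition smooth_oriented_boundary :: "complex set \<Rightarrow> (real \<Rightarrow> complex) set \<Rightarrow> bool" where
  "smooth_oriented_boundary \<Omega> \<Gamma> \<longleftrightarrow>
     finite \<Gamma> \<and> frontier \<Omega> = (\<Union>\<gamma>\<in>\<Gamma>. path_image \<gamma>) \<and>
     (\<forall>\<gamma>\<in>\<Gamma>. \<forall>\<delta>\<in>\<Gamma>. \<gamma> \<noteq> \<delta> \<longrightarrow> path_image \<gamma> \<inter> path_image \<delta> = {}) \<and>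
     (\<forall>\<gamma>\<in>\<Gamma>. smooth_on UNIV \<gamma> \<and> (\<forall>t. \<gamma> (t + 1) = \<gamma> t) \<and> inj_on \<gamma> {0..<1} \<and>
        (\<forall>t. vector_derivative \<gamma> (at t) \<noteq> 0) \<and>
        (\<forall>t. \<forall>\<^sub>F s in at_right 0.
           \<gamma> t + complex_of_real s * \<i> * vector_derivative \<gamma> (at t) \<in> \<Omega> \<and>
           \<gamma> t - complex_of_real s * \<i> * vector_derivative \<gamma> (at t) \<notin> closure \<Omega>))"

definition boundary_integral :: "(real \<Rightarrow> complex) set \<Rightarrow> (complex \<Rightarrow> complex) \<Rightarrow> complex" where
  "boundary_integral \<Gamma> f = (\<Sum>\<gamma>\<in>\<Gamma>. contour_integral \<gamma> f)"


section \<open>The pairing\<close>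

definition flat_pairing ::
    "(real \<Rightarrow> complex) set \<Rightarrow> 'e hspace \<Rightarrow> (complex \<Rightarrow> 'f \<Rightarrow> 'e) \<Rightarrow>
      (complex \<Rightarrow> 'e) \<Rightarrow> (complex \<Rightarrow> 'f) \<Rightarrow> complex" where
  "flat_pairing \<Gamma> X Ps \<phi> \<psi> =
     1 / (2 * complex_of_real pi) *
       boundary_integral \<Gamma> (\<lambda>\<sigma>. ip X (\<phi> \<sigma>) (Ps (cnj \<sigma>) (\<psi> (cnj \<sigma>))))"

definition sesquilinear_pairing ::
    "(complex \<Rightarrow> 'e::complex_vector) set \<Rightarrow> (complex \<Rightarrow> 'f::complex_vector) set \<Rightarrow>
      ((complex \<Rightarrow> 'e) \<Rightarrow> (complex \<Rightarrow> 'f) \<Rightarrow> complex) \<Rightarrow> bool" where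
  "sesquilinear_pairing K L b \<longleftrightarrow>
     (\<forall>\<phi>\<in>K. \<forall>\<phi>'\<in>K. \<forall>\<psi>\<in>L. b (\<lambda>\<sigma>. \<phi> \<sigma> + \<phi>' \<sigma>) \<psi> = b \<phi> \<psi> + b \<phi>' \<psi>) \<and>
     (\<forall>\<phi>\<in>K. \<forall>\<psi>\<in>L. \<forall>c. b (\<lambda>\<sigma>. c *\<^sub>C \<phi> \<sigma>) \<psi> = c * b \<phi> \<psi>) \<and>
     (\<forall>\<phi>\<in>K. \<forall>\<psi>\<in>L. \<forall>\<psi>'\<in>L. b \<phi> (\<lambda>\<sigma>. \<psi> \<sigma> + \<psi>' \<sigma>) = b \<phi> \<psi> + b \<phi> \<psi>') \<and>
     (\<forall>\<phi>\<in>K. \<forall>\<psi>\<in>L. \<forall>c. b \<phi> (\<lambda>\<sigma>. c *\<^sub>C \<psi> \<sigma>) = cnj c * b \<phi> \<psi>)"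

definition nondegenerate_pairing ::
    "(complex \<Rightarrow> 'e::complex_vector) set \<Rightarrow> (complex \<Rightarrow> 'f::complex_vector) set \<Rightarrow>
      ((complex \<Rightarrow> 'e) \<Rightarrow> (complex \<Rightarrow> 'f) \<Rightarrow> complex) \<Rightarrow> bool" where
  "nondegenerate_pairing K L b \<longleftrightarrow>
     (\<forall>\<phi>\<in>K. (\<forall>\<psi>\<in>L. b \<phi> \<psi> = 0) \<longrightarrow> \<phi> = (\<lambda>\<sigma>. 0)) \<and>
     (\<forall>\<psi>\<in>L. (\<forall>\<phi>\<in>K. b \<phi> \<psi> = 0) \<longrightarrow> \<psi> = (\<lambda>\<sigma>. 0))"

end

theory Submission
  imports Defs
begin

text \<open>
  Only the fibres over the given point matter. Write \<open>T\<close> for the family \<open>P y\<close>, \<open>T'\<close> for its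
  adjoint family and \<open>S\<close> for the finite set of points where \<open>T\<close> is not invertible.

  An element \<open>\<phi>\<close> of the first space is a finite sum of principal parts at points of \<open>S\<close>, and
  \<open>T \<phi>\<close> extends holomorphically across \<open>S\<close>; the second space has the same description for \<open>T'\<close> at the
  conjugate points. Elements of the second space are obtained by inverting \<open>T'\<close>: for a polynomial \<open>q\<close> and a
  vector \<open>u\<close> let \<open>\<psi>\<close> be the singular part of the meromorphic solution \<open>\<Psi>\<close> of
  \<open>T'(\<tau>) \<Psi>(\<tau>) = cnj (q (cnj \<tau>)) u\<close>. Then \<open>h = \<Psi> - \<psi>\<close> is holomorphic, and on the boundary
  \<open>(\<phi>, T' \<psi>) = q (\<phi>, u) - (\<phi>, T' h) = q (\<phi>, u) - (T \<phi>, h)\<close>. The last term is holomorphic in the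
  whole region, so by Cauchy's theorem it contributes nothing, and pairing with \<open>\<psi>\<close> computes the sum of the
  residues of \<open>q (\<phi>, u)\<close> (\<open>moments_vanish\<close>). If all these vanish, choose \<open>q\<close> so that it removes every
  pole except for a simple one at \<open>p\<close>, whose residue is a nonzero multiple of \<open>(a, u)\<close> with \<open>a\<close> the
  leading coefficient of \<open>\<phi>\<close> at \<open>p\<close>; taking \<open>u = a\<close> gives \<open>a = 0\<close>. Hence \<open>\<phi> = 0\<close>
  (\<open>nondegenerate_left\<close>). Complex conjugation exchanges the roles of \<open>T\<close> and \<open>T'\<close> and turns the pairing into
  its conjugate, which gives nondegeneracy on the other side.

  Two results carry this argument. First, \<open>\<Psi>\<close> is meromorphic
  (\<open>fredholm_solution_meromorphic\<close>). This rests on the bound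
  \<open>|\<sigma> - p|^N |u| \<le> C |T(\<sigma>) u|\<close> near each point \<open>p\<close> (\<open>fredholm_lower_bound\<close>), which a
  Lyapunov-Schmidt reduction brings down to finitely many holomorphic vectors that are linearly independent away
  from \<open>p\<close> (\<open>independent_lower_bound\<close>). Second, the oriented boundary of \<open>\<Omega>\<close> has winding number one
  about the points of \<open>\<Omega>\<close> and zero about exterior points (\<open>oriented_boundary_winding_number\<close>): the total
  winding number jumps by one across each boundary curve, exactly as the indicator function of \<open>\<Omega>\<close> does,
  so their difference is locally constant on the whole plane and vanishes at infinity.

  Vector-valued holomorphic functions are reduced to scalar ones: estimates for the functions \<open>(f, u)\<close> that are
  linear in \<open>|u|\<close> become norm estimates when \<open>u\<close> is the vector to be estimated
  (\<open>holo_into_iff_weak\<close>, \<open>removable_singularity\<close>).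
\<close>

section \<open>Hilbert spaces\<close>

lemma tendsto_zero_boundI:
  fixes f g :: "'a \<Rightarrow> real"
  assumes "(g \<longlongrightarrow> 0) F" and "\<forall>\<^sub>F x in F. 0 \<le> f x" and "\<forall>\<^sub>F x in F. f x \<le> g x"
  shows "(f \<longlongrightarrow> 0) F"
  using tendsto_sandwich[OF assms(2,3) tendsto_const assms(1)] .

text \<open>
  Here \<open>c = (u, v) / |v|^2\<close> is the coefficient of the projection of \<open>u\<close> onto \<open>v\<close>; these are the terms
  that occur when the square of \<open>|u - c v|\<close> is expanded.
\<close>

lemma projection_coefficient:
  fixes z :: complex and n :: real
  assumes "n > 0" and c: "c = z / complex_of_real (n\<^sup>2)"
  shows "cmod c * n = cmod z / n" and "cnj c * z = complex_of_real ((cmod z / n)\<^sup>2)"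
proof -
  show "cmod c * n = cmod z / n"
    using assms by (simp add: norm_divide norm_mult power2_eq_square)
  have "cnj c * z = (z * cnj z) / complex_of_real (n\<^sup>2)"
    by (simp add: c)
  then show "cnj c * z = complex_of_real ((cmod z / n)\<^sup>2)"
    by (simp only: complex_norm_square[symmetric]) (simp add: power_divide)
qed

locale hilb =
  fixes X :: "'e::complex_vector hspace"
  assumes hilbert_space: "hilbert_space X"
begin

lemma subspace: "csubspace (carr X)"
  using hilbert_space by (simp add: hilbert_space_def)

lemma carr_zero [simp, intro]: "0 \<in> carr X"
  using subspace by (rule complex_vector.subspace_0)

lemma carr_add [simp, intro]: "u \<in> carr X \<Longrightarrow> v \<in> carr X \<Longrightarrow> u + v \<in> carr X"
  using subspace by (rule complex_vector.subspace_add)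

lemma carr_diff [simp, intro]: "u \<in> carr X \<Longrightarrow> v \<in> carr X \<Longrightarrow> u - v \<in> carr X"
  using subspace by (rule complex_vector.subspace_diff)

lemma carr_scale [simp, intro]: "u \<in> carr X \<Longrightarrow> c *\<^sub>C u \<in> carr X"
  using subspace by (rule complex_vector.subspace_scale)

lemma carr_minus [simp, intro]: "u \<in> carr X \<Longrightarrow> - u \<in> carr X"
  using subspace by (rule complex_vector.subspace_neg)

lemma carr_sum [intro]: "(\<And>i. i \<in> I \<Longrightarrow> f i \<in> carr X) \<Longrightarrow> (\<Sum>i\<in>I. f i) \<in> carr X"
  using subspace by (rule complex_vector.subspace_sum)

lemmas hilbert_axioms = hilbert_space[unfolded hilbert_space_def]

lemma ip_commute: "u \<in> carr X \<Longrightarrow> v \<in> carr X \<Longrightarrow> ip X u v = cnj (ip X v u)"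
  by (rule hilbert_axioms[THEN conjunct2, THEN conjunct1, rule_format])

lemma ip_add_left:
  "u \<in> carr X \<Longrightarrow> v \<in> carr X \<Longrightarrow> w \<in> carr X \<Longrightarrow> ip X (u + v) w = ip X u w + ip X v w"
  using hilbert_axioms[THEN conjunct2, THEN conjunct2, THEN conjunct1] by simp

lemma ip_scale_left: "u \<in> carr X \<Longrightarrow> v \<in> carr X \<Longrightarrow> ip X (a *\<^sub>C u) v = a * ip X u v"
  using hilbert_axioms[THEN conjunct2, THEN conjunct2, THEN conjunct2, THEN conjunct1] by simp

lemma Re_ip_pos: "u \<in> carr X \<Longrightarrow> u \<noteq> 0 \<Longrightarrow> 0 < Re (ip X u u)"
  using hilbert_axioms[THEN conjunct2, THEN conjunct2, THEN conjunct2, THEN conjunct2, THEN conjunct1] by simp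

lemma complete:
  assumes "\<And>n. s n \<in> carr X" "\<And>e. e > 0 \<Longrightarrow> \<exists>N. \<forall>m\<ge>N. \<forall>n\<ge>N. hnorm X (s m - s n) < e"
  obtains l where "l \<in> carr X" "hlim X s l"
  using hilbert_axioms[THEN conjunct2, THEN conjunct2, THEN conjunct2, THEN conjunct2, THEN conjunct2,
      THEN spec, of s] assms that unfolding hlim_def by auto

lemma ip_add_right:
  assumes "u \<in> carr X" "v \<in> carr X" "w \<in> carr X"
  shows "ip X w (u + v) = ip X w u + ip X w v"
proof -
  have "ip X w (u + v) = cnj (ip X (u + v) w)"
    using assms by (intro ip_commute) auto
  also have "\<dots> = cnj (ip X u w) + cnj (ip X v w)"
    using assms by (simp add: ip_add_left)
  also have "\<dots> = ip X w u + ip X w v"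
    using ip_commute[of w u] ip_commute[of w v] assms by simp
  finally show ?thesis .
qed

lemma ip_scale_right:
  assumes "u \<in> carr X" "v \<in> carr X"
  shows "ip X u (a *\<^sub>C v) = cnj a * ip X u v"
  using ip_commute[of u "a *\<^sub>C v"] ip_commute[of u v] assms by (simp add: ip_scale_left)

lemma ip_diff_left:
  assumes "u \<in> carr X" "v \<in> carr X" "w \<in> carr X"
  shows "ip X (u - v) w = ip X u w - ip X v w"
  using ip_add_left[of "u - v" v w] assms by simp

lemma ip_diff_right:
  assumes "u \<in> carr X" "v \<in> carr X" "w \<in> carr X"
  shows "ip X w (u - v) = ip X w u - ip X w v"
  using ip_add_right[of "u - v" v w] assms by simp

lemma ip_zero_left [simp]: "w \<in> carr X \<Longrightarrow> ip X 0 w = 0"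
  using ip_add_left[of 0 0 w] by simp

lemma ip_zero_right [simp]: "w \<in> carr X \<Longrightarrow> ip X w 0 = 0"
  using ip_add_right[of 0 0 w] by simp

lemma ip_sum_left:
  "finite I \<Longrightarrow> (\<And>i. i \<in> I \<Longrightarrow> f i \<in> carr X) \<Longrightarrow> w \<in> carr X \<Longrightarrow>
    ip X (\<Sum>i\<in>I. f i) w = (\<Sum>i\<in>I. ip X (f i) w)"
  by (induction I rule: finite_induct) (auto simp: ip_add_left carr_sum)

lemma Re_ip_nonneg [simp]: "u \<in> carr X \<Longrightarrow> 0 \<le> Re (ip X u u)"
  by (cases "u = 0") (auto intro: less_imp_le Re_ip_pos)

lemma ip_self: "u \<in> carr X \<Longrightarrow> ip X u u = complex_of_real ((hnorm X u)\<^sup>2)"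
  using arg_cong[OF ip_commute[of u u], of Im] by (simp add: hnorm_def complex_eq_iff)

lemma hnorm_nonneg [simp]: "u \<in> carr X \<Longrightarrow> 0 \<le> hnorm X u"
  by (simp add: hnorm_def)

lemma hnorm_eq_0 [simp]: "u \<in> carr X \<Longrightarrow> hnorm X u = 0 \<longleftrightarrow> u = 0"
  using Re_ip_pos[of u] by (cases "u = 0") (auto simp: hnorm_def)

lemma hnorm_zero [simp]: "hnorm X 0 = 0"
  by simp

lemma hnorm_pos: "u \<in> carr X \<Longrightarrow> u \<noteq> 0 \<Longrightarrow> 0 < hnorm X u"
  using hnorm_nonneg[of u] hnorm_eq_0[of u] by linarith

lemma hnorm_scale [simp]: "u \<in> carr X \<Longrightarrow> hnorm X (a *\<^sub>C u) = cmod a * hnorm X u"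
proof -
  assume u: "u \<in> carr X"
  have "complex_of_real ((hnorm X (a *\<^sub>C u))\<^sup>2) = (a * cnj a) * complex_of_real ((hnorm X u)\<^sup>2)"
    using u ip_self[of "a *\<^sub>C u"] ip_self[of u] by (simp add: ip_scale_left ip_scale_right mult_ac)
  also have "\<dots> = complex_of_real ((cmod a * hnorm X u)\<^sup>2)"
    by (simp add: complex_norm_square[symmetric] power_mult_distrib)
  finally have "(hnorm X (a *\<^sub>C u))\<^sup>2 = (cmod a * hnorm X u)\<^sup>2"
    by (simp only: of_real_eq_iff)
  then show ?thesis
    using u by (simp add: power2_eq_iff_nonneg)
qed

lemma hnorm_minus [simp]: "u \<in> carr X \<Longrightarrow> hnorm X (- u) = hnorm X u"
  using hnorm_scale[of u "-1"] by (simp add: complex_vector.scale_minus_left scaleC_one)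

lemma hnorm_commute: "u \<in> carr X \<Longrightarrow> v \<in> carr X \<Longrightarrow> hnorm X (u - v) = hnorm X (v - u)"
  using hnorm_minus[of "u - v"] by simp

lemma hnorm_sq_diff:
  assumes "u \<in> carr X" "v \<in> carr X"
  shows "(hnorm X (u - v))\<^sup>2 = (hnorm X u)\<^sup>2 + (hnorm X v)\<^sup>2 - 2 * Re (ip X u v)"
proof -
  have "complex_of_real ((hnorm X (u - v))\<^sup>2) = ip X (u - v) (u - v)"
    using assms by (simp add: ip_self)
  also have "\<dots> = ip X u u + ip X v v - (ip X u v + cnj (ip X u v))"
    using assms ip_commute[of v u] by (simp add: ip_diff_left ip_diff_right)
  also have "\<dots> = complex_of_real ((hnorm X u)\<^sup>2 + (hnorm X v)\<^sup>2 - 2 * Re (ip X u v))"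
    using assms by (simp add: ip_self complex_add_cnj)
  finally show ?thesis
    by (simp only: of_real_eq_iff)
qed

lemma cauchy_schwarz:
  assumes u: "u \<in> carr X" and v: "v \<in> carr X"
  shows "cmod (ip X u v) \<le> hnorm X u * hnorm X v"
proof (cases "v = 0")
  case False
  define c where "c = ip X u v / complex_of_real ((hnorm X v)\<^sup>2)"
  have nv: "hnorm X v > 0"
    using hnorm_pos v False by blast
  have "0 \<le> (hnorm X (u - c *\<^sub>C v))\<^sup>2"
    by simp
  also have "\<dots> = (hnorm X u)\<^sup>2 + (cmod c * hnorm X v)\<^sup>2 - 2 * Re (cnj c * ip X u v)"
    using u v by (subst hnorm_sq_diff) (auto simp: ip_scale_right)
  also note projection_coefficient(1)[OF nv c_def]
  also note projection_coefficient(2)[OF nv c_def]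
  finally have "(cmod (ip X u v))\<^sup>2 / (hnorm X v)\<^sup>2 \<le> (hnorm X u)\<^sup>2"
    by (simp add: power_divide)
  then have "(cmod (ip X u v))\<^sup>2 \<le> (hnorm X u * hnorm X v)\<^sup>2"
    using nv by (simp add: divide_le_eq power_mult_distrib)
  then show ?thesis
    by (rule power2_le_imp_le) (simp add: u v)
qed (use u in simp)

lemma hnorm_triangle_diff:
  assumes u: "u \<in> carr X" and v: "v \<in> carr X"
  shows "hnorm X (u - v) \<le> hnorm X u + hnorm X v"
proof -
  have "- Re (ip X u v) \<le> hnorm X u * hnorm X v"
    using cauchy_schwarz[OF u v] abs_Re_le_cmod[of "ip X u v"] by linarith
  then have "(hnorm X (u - v))\<^sup>2 \<le> (hnorm X u + hnorm X v)\<^sup>2"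
    using u v by (simp add: hnorm_sq_diff power2_sum)
  then show ?thesis
    by (rule power2_le_imp_le) (simp add: u v)
qed

lemma hnorm_triangle:
  assumes u: "u \<in> carr X" and v: "v \<in> carr X"
  shows "hnorm X (u + v) \<le> hnorm X u + hnorm X v"
  using hnorm_triangle_diff[of u "- v"] assms by simp

lemma hnorm_triangle3:
  assumes "u \<in> carr X" "v \<in> carr X" "w \<in> carr X"
  shows "hnorm X (u - w) \<le> hnorm X (u - v) + hnorm X (v - w)"
  using hnorm_triangle[of "u - v" "v - w"] assms by simp

lemma hnorm_reverse:
  assumes "u \<in> carr X" "v \<in> carr X"
  shows "hnorm X u - hnorm X v \<le> hnorm X (u - v)"
  using hnorm_triangle[of "u - v" v] assms by simp

lemma hnorm_sum:
  "finite I \<Longrightarrow> (\<And>i. i \<in> I \<Longrightarrow> f i \<in> carr X) \<Longrightarrow>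
    hnorm X (\<Sum>i\<in>I. f i) \<le> (\<Sum>i\<in>I. hnorm X (f i))"
proof (induction I rule: finite_induct)
  case (insert i I)
  then have "hnorm X (f i + (\<Sum>i\<in>I. f i)) \<le> hnorm X (f i) + hnorm X (\<Sum>i\<in>I. f i)"
    by (intro hnorm_triangle carr_sum) auto
  with insert show ?case
    by simp
qed simp

text \<open>
  The step from scalar to norm estimates: a bound on \<open>(u, w)\<close> that is linear in \<open>|w|\<close> is applied with
  \<open>w = u\<close>.
\<close>

lemma norm_le_if_ip_le:
  assumes u: "u \<in> carr X" and "cmod (ip X u u) \<le> C * hnorm X u" "0 \<le> C"
  shows "hnorm X u \<le> C"
proof (cases "u = 0")
  case False
  then have "hnorm X u > 0"
    using hnorm_pos u by blast
  moreover have "hnorm X u * hnorm X u \<le> C * hnorm X u"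
    using assms by (simp add: ip_self power2_eq_square norm_mult)
  ultimately show ?thesis
    by simp
qed (use assms in simp)

lemma hlim_unique:
  assumes "\<And>n. s n \<in> carr X" "l \<in> carr X" "l' \<in> carr X" "hlim X s l" "hlim X s l'"
  shows "l = l'"
proof -
  have "(\<lambda>n. hnorm X (s n - l) + hnorm X (s n - l')) \<longlonglongrightarrow> 0"
    using tendsto_add[OF assms(4,5)[unfolded hlim_def]] by simp
  moreover have "hnorm X (l - l') \<le> hnorm X (s n - l) + hnorm X (s n - l')" for n
    using hnorm_triangle3[of l "s n" l'] hnorm_commute[of l "s n"] assms by simp
  ultimately have "hnorm X (l - l') \<le> 0"
    by (metis (no_types, lifting) LIMSEQ_le_const)
  then show ?thesis
    using assms hnorm_pos[of "l - l'"] by fastforce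
qed

lemma hlim_ip:
  assumes "\<And>n. s n \<in> carr X" "l \<in> carr X" "w \<in> carr X" "hlim X s l"
  shows "(\<lambda>n. ip X (s n) w) \<longlonglongrightarrow> ip X l w"
proof (rule tendsto_norm_zero_cancel[THEN LIM_zero_cancel], rule tendsto_zero_boundI)
  show "(\<lambda>n. hnorm X (s n - l) * hnorm X w) \<longlonglongrightarrow> 0"
    using assms(4) unfolding hlim_def by (rule tendsto_mult_left_zero)
  show "\<forall>\<^sub>F n in sequentially. cmod (ip X (s n) w - ip X l w) \<le> hnorm X (s n - l) * hnorm X w"
    using assms cauchy_schwarz by (auto simp: ip_diff_left[symmetric])
qed auto

lemma hlim_hnorm:
  assumes "\<And>n. s n \<in> carr X" "l \<in> carr X" "hlim X s l"
  shows "(\<lambda>n. hnorm X (s n)) \<longlonglongrightarrow> hnorm X l"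
proof (rule tendsto_norm_zero_cancel[THEN LIM_zero_cancel], rule tendsto_zero_boundI)
  show "(\<lambda>n. hnorm X (s n - l)) \<longlonglongrightarrow> 0"
    using assms unfolding hlim_def by blast
  show "\<forall>\<^sub>F n in sequentially. norm (hnorm X (s n) - hnorm X l) \<le> hnorm X (s n - l)"
    using assms hnorm_reverse hnorm_commute by (intro always_eventually) (smt (verit) real_norm_def)
qed auto

text \<open>
  A \<open>Metric_space\<close> needs symmetry and nonnegativity on the whole type, where \<open>hnorm\<close> is
  uncontrolled; hence the value zero off the carrier.
\<close>

definition mdist :: "'e \<Rightarrow> 'e \<Rightarrow> real" where
  "mdist u v = (if u \<in> carr X \<and> v \<in> carr X then hnorm X (u - v) else 0)"

sublocale metric: Metric_space "carr X" mdist
proof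
  show "mdist u v = mdist v u" for u v
    using hnorm_commute by (auto simp: mdist_def)
  show "mdist u w \<le> mdist u v + mdist v w"
    if "u \<in> carr X" "v \<in> carr X" "w \<in> carr X" for u v w
    using hnorm_triangle3[of u v w] that by (simp add: mdist_def)
qed (auto simp: mdist_def)

lemma mcomplete: "metric.mcomplete"
  unfolding metric.mcomplete_def
proof (intro allI impI)
  fix s :: "nat \<Rightarrow> 'e" assume s: "metric.MCauchy s"
  then have c: "s n \<in> carr X" for n
    by (auto simp: metric.MCauchy_def)
  obtain l where l: "l \<in> carr X" "hlim X s l"
  proof (rule complete[of s])
    show "\<exists>N. \<forall>m\<ge>N. \<forall>n\<ge>N. hnorm X (s m - s n) < e" if "e > 0" for e
      using s that unfolding metric.MCauchy_def mdist_def by (auto simp: c)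
  qed (use c in auto)
  then have "limitin metric.mtopology s l sequentially"
    unfolding metric.limitin_metric_dist_null hlim_def
    using c by (auto simp: mdist_def)
  then show "\<exists>l. limitin metric.mtopology s l sequentially"
    by blast
qed

lemma mball_eq: "u \<in> carr X \<Longrightarrow> metric.mball u r = {v \<in> carr X. hnorm X (u - v) < r}"
  by (auto simp: metric.in_mball mdist_def)

end

section \<open>Closed subspaces, projections and the Riesz representation\<close>

definition closed_subspace :: "'e::complex_vector hspace \<Rightarrow> 'e set \<Rightarrow> bool" where
  "closed_subspace X M \<longleftrightarrow> csubspace M \<and> M \<subseteq> carr X \<and>
     (\<forall>s l. (\<forall>n. s n \<in> M) \<and> l \<in> carr X \<and> hlim X s l \<longrightarrow> l \<in> M)"

definition restrict_space_to :: "'e hspace \<Rightarrow> 'e set \<Rightarrow> 'e hspace" where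
  "restrict_space_to X M = \<lparr>carr = M, ip = ip X\<rparr>"

lemma restrict_space_to_simps [simp]:
  "carr (restrict_space_to X M) = M" "ip (restrict_space_to X M) = ip X"
  "hnorm (restrict_space_to X M) = hnorm X" "hlim (restrict_space_to X M) = hlim X"
  by (auto simp: restrict_space_to_def hnorm_def hlim_def fun_eq_iff)

context hilb
begin

lemma hilb_restrict:
  assumes M: "closed_subspace X M"
  shows "hilb (restrict_space_to X M)"
proof
  have MX: "u \<in> M \<Longrightarrow> u \<in> carr X" for u
    using M by (auto simp: closed_subspace_def)
  have "\<exists>l\<in>M. (\<lambda>n. hnorm X (s n - l)) \<longlonglongrightarrow> 0"
    if "\<forall>n. s n \<in> M" "\<forall>e>0. \<exists>N. \<forall>m\<ge>N. \<forall>n\<ge>N. hnorm X (s m - s n) < e" for s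
    using complete[of s] that M MX unfolding closed_subspace_def hlim_def by metis
  note cauchy = this
  show "Defs.hilbert_space (restrict_space_to X M)"
    unfolding hilbert_space_def restrict_space_to_simps
  proof (intro conjI ballI allI impI)
    show "csubspace M"
      using M by (simp add: closed_subspace_def)
    show "ip X u v = cnj (ip X v u)" if "u \<in> M" "v \<in> M" for u v
      using that MX by (intro ip_commute)
  qed (use MX cauchy in \<open>simp_all add: Re_ip_pos ip_add_left ip_scale_left\<close>)
qed

text \<open>
  A minimizing sequence for the distance from \<open>x\<close> to \<open>M\<close> is a Cauchy sequence by the parallelogram law.
  Its limit \<open>m\<close> is a nearest point, and comparing \<open>m\<close> with \<open>m + c n\<close> for the best \<open>c\<close> shows that
  \<open>x - m\<close> is orthogonal to \<open>n\<close>.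
\<close>

lemma projection_exists:
  assumes M: "closed_subspace X M" and x: "x \<in> carr X"
  obtains m where "m \<in> M" "\<And>n. n \<in> M \<Longrightarrow> ip X (x - m) n = 0"
proof -
  have MX: "u \<in> M \<Longrightarrow> u \<in> carr X" for u
    using M by (auto simp: closed_subspace_def)
  have sub: "csubspace M"
    using M by (simp add: closed_subspace_def)
  define d where "d = Inf ((\<lambda>m. (hnorm X (x - m))\<^sup>2) ` M)"
  have bdd: "bdd_below ((\<lambda>m. (hnorm X (x - m))\<^sup>2) ` M)"
    by (rule bdd_belowI[of _ 0]) auto
  have ne: "(\<lambda>m. (hnorm X (x - m))\<^sup>2) ` M \<noteq> {}"
    using complex_vector.subspace_0[OF sub] by blast
  have d_le: "d \<le> (hnorm X (x - m))\<^sup>2" if "m \<in> M" for m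
    unfolding d_def using that by (intro cInf_lower bdd) auto
  have "\<exists>m\<in>M. (hnorm X (x - m))\<^sup>2 < d + 1 / real (Suc n)" for n
    using cInf_lessD[OF ne, of "d + 1 / real (Suc n)"] unfolding d_def by force
  then obtain s where s: "\<And>n. s n \<in> M" "\<And>n. (hnorm X (x - s n))\<^sup>2 < d + 1 / real (Suc n)"
    by metis
  have par: "(hnorm X (m - n))\<^sup>2 \<le> 2 * (hnorm X (x - m))\<^sup>2 + 2 * (hnorm X (x - n))\<^sup>2 - 4 * d"
    if "m \<in> M" "n \<in> M" for m n
  proof -
    define h where "h = (1/2) *\<^sub>C (m + n)"
    have h: "h \<in> M"
      unfolding h_def using that sub
      by (intro complex_vector.subspace_scale complex_vector.subspace_add)
    have e1: "m - n = (x - n) - (x - m)"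
      by simp
    have "2 *\<^sub>C h = m + n"
      unfolding h_def by (simp add: scaleC_scaleC scaleC_one)
    moreover have "2 *\<^sub>C x = x + x"
      using scaleC_add_left[of 1 1 x] by (simp add: scaleC_one)
    ultimately have "2 *\<^sub>C (x - h) = (x - n) - (- (x - m))"
      by (simp add: complex_vector.scale_right_diff_distrib)
    then have "(hnorm X ((x - n) - (- (x - m))))\<^sup>2 = 4 * (hnorm X (x - h))\<^sup>2"
      using x MX[OF h] hnorm_scale[of "x - h" 2] by (simp add: power_mult_distrib)
    moreover have "(hnorm X ((x - n) - (- (x - m))))\<^sup>2
        = (hnorm X (x - n))\<^sup>2 + (hnorm X (x - m))\<^sup>2 + 2 * Re (ip X (x - n) (x - m))"
      using x MX that ip_diff_right[of 0 "x - m" "x - n"] by (subst hnorm_sq_diff) (auto simp del: minus_diff_eq)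
    moreover have "(hnorm X ((x - n) - (x - m)))\<^sup>2
        = (hnorm X (x - n))\<^sup>2 + (hnorm X (x - m))\<^sup>2 - 2 * Re (ip X (x - n) (x - m))"
      using x MX that by (subst hnorm_sq_diff) auto
    ultimately show ?thesis
      using d_le[OF h] unfolding e1 by linarith
  qed
  have par': "(hnorm X (s m - s n))\<^sup>2 \<le> 2 / real (Suc m) + 2 / real (Suc n)" for m n
    using par[OF s(1) s(1), of m n] s(2)[of m] s(2)[of n] by linarith
  obtain l where l: "l \<in> carr X" "hlim X s l"
  proof (rule complete[of s])
    fix e :: real assume e: "e > 0"
    obtain N where N: "4 / e\<^sup>2 < real N"
      using reals_Archimedean2 by blast
    have "hnorm X (s m - s n) < e" if "m \<ge> N" "n \<ge> N" for m n
    proof -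
      have N0: "0 < real N"
        using N e by (metis divide_pos_pos less_trans zero_less_numeral zero_less_power)
      have "2 / real (Suc m) + 2 / real (Suc n) \<le> 2 / real N + 2 / real N"
        using that N0 by (intro add_mono divide_left_mono) auto
      also have "\<dots> < e\<^sup>2"
        using N N0 e by (simp add: field_simps)
      finally have "(hnorm X (s m - s n))\<^sup>2 < e\<^sup>2"
        using par'[of m n] by linarith
      then show ?thesis
        using e by (simp add: power_less_imp_less_base)
    qed
    then show "\<exists>N. \<forall>m\<ge>N. \<forall>n\<ge>N. hnorm X (s m - s n) < e"
      by blast
  qed (use s MX in auto)
  have lM: "l \<in> M"
    using M s l unfolding closed_subspace_def by blast
  have "hlim X (\<lambda>n. x - s n) (x - l)"
    using l hnorm_commute[OF l(1)] MX s unfolding hlim_def by simp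
  then have "(\<lambda>n. (hnorm X (x - s n))\<^sup>2) \<longlonglongrightarrow> (hnorm X (x - l))\<^sup>2"
    using x MX s l by (intro tendsto_power hlim_hnorm) auto
  moreover have "(\<lambda>n. d + 1 / real (Suc n)) \<longlonglongrightarrow> d + 0"
    by (intro tendsto_intros LIMSEQ_inverse_real_of_nat[unfolded inverse_eq_divide])
  ultimately have dl: "(hnorm X (x - l))\<^sup>2 \<le> d"
    using s(2) by (intro LIMSEQ_le[of _ _ "\<lambda>n. d + 1 / real (Suc n)"]) (auto intro: less_imp_le)
  have "ip X (x - l) n = 0" if n: "n \<in> M" for n
  proof (cases "n = 0")
    case False
    define c where "c = ip X (x - l) n / complex_of_real ((hnorm X n)\<^sup>2)"
    have nn: "hnorm X n > 0"
      using hnorm_pos MX n False by blast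
    have "l + c *\<^sub>C n \<in> M"
      using lM n sub by (intro complex_vector.subspace_scale complex_vector.subspace_add)
    then have "(hnorm X (x - l))\<^sup>2 \<le> (hnorm X (x - l - c *\<^sub>C n))\<^sup>2"
      using d_le dl by (metis diff_diff_eq order_trans)
    also have "\<dots> = (hnorm X (x - l))\<^sup>2 + (cmod c * hnorm X n)\<^sup>2 - 2 * Re (cnj c * ip X (x - l) n)"
      using x l MX n by (subst hnorm_sq_diff) (auto simp: ip_scale_right)
    also note projection_coefficient(2)[OF nn c_def, folded projection_coefficient(1)[OF nn c_def]]
    finally have "(cmod c * hnorm X n)\<^sup>2 \<le> 0"
      by simp
    then show ?thesis
      using nn by (auto simp: c_def)
  qed (use x l in simp)
  then show ?thesis
    using that lM by blast
qed

text \<open>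
  Orthogonality of \<open>x - proj x\<close> to \<open>M\<close> determines \<open>proj x\<close>, and this uniqueness makes \<open>proj\<close> linear.
\<close>

lemma orthogonal_projection:
  assumes M: "closed_subspace X M"
  obtains proj where "\<And>x. x \<in> carr X \<Longrightarrow> proj x \<in> M" "\<And>x. x \<in> M \<Longrightarrow> proj x = x"
    "\<And>x. x \<in> carr X \<Longrightarrow> hnorm X (proj x) \<le> hnorm X x"
    "\<And>x y. x \<in> carr X \<Longrightarrow> y \<in> carr X \<Longrightarrow> proj (x + y) = proj x + proj y"
    "\<And>c x. x \<in> carr X \<Longrightarrow> proj (c *\<^sub>C x) = c *\<^sub>C proj x"
proof -
  have MX: "u \<in> M \<Longrightarrow> u \<in> carr X" for u
    using M by (auto simp: closed_subspace_def)
  have sub: "csubspace M"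
    using M by (simp add: closed_subspace_def)
  have "\<exists>m. m \<in> M \<and> (\<forall>n\<in>M. ip X (x - m) n = 0)" if "x \<in> carr X" for x
    using projection_exists[OF M that] by metis
  then obtain proj where proj: "\<And>x. x \<in> carr X \<Longrightarrow> proj x \<in> M"
    "\<And>x n. x \<in> carr X \<Longrightarrow> n \<in> M \<Longrightarrow> ip X (x - proj x) n = 0"
    by metis
  have unique: "proj x = m" if x: "x \<in> carr X" and m: "m \<in> M" "\<And>n. n \<in> M \<Longrightarrow> ip X (x - m) n = 0" for x m
  proof -
    have d: "m - proj x \<in> M"
      using proj(1)[OF x] m(1) sub by (rule_tac complex_vector.subspace_diff)
    have c: "m \<in> carr X" "proj x \<in> carr X" "m - proj x \<in> carr X"
      using d m(1) proj(1)[OF x] MX by auto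
    have "ip X ((x - proj x) - (x - m)) (m - proj x) = 0"
      using proj(2)[OF x d] m(2)[OF d] x c ip_diff_left[of "x - proj x" "x - m" "m - proj x"] by simp
    then have "ip X (m - proj x) (m - proj x) = 0"
      by simp
    then show ?thesis
      using c by (simp add: ip_self)
  qed
  show ?thesis
  proof (rule that[OF proj(1)])
    show "proj x = x" if "x \<in> M" for x
      using that MX by (intro unique) auto
    show "hnorm X (proj x) \<le> hnorm X x" if x: "x \<in> carr X" for x
    proof (rule norm_le_if_ip_le)
      show c: "proj x \<in> carr X"
        using proj(1)[OF x] MX by blast
      have "ip X (proj x) (proj x) = ip X x (proj x)"
        using proj(2)[OF x proj(1)[OF x]] c x by (simp add: ip_diff_left)
      then show "cmod (ip X (proj x) (proj x)) \<le> hnorm X x * hnorm X (proj x)"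
        using cauchy_schwarz[OF x c] by simp
    qed (use x in simp)
    show "proj (x + y) = proj x + proj y" if x: "x \<in> carr X" and y: "y \<in> carr X" for x y
    proof (rule unique)
      show "proj x + proj y \<in> M"
        using proj(1) x y sub by (intro complex_vector.subspace_add) auto
      fix n assume n: "n \<in> M"
      have c: "x - proj x \<in> carr X" "y - proj y \<in> carr X" "n \<in> carr X"
        using proj(1) x y MX n by auto
      have "ip X (x + y - (proj x + proj y)) n = ip X ((x - proj x) + (y - proj y)) n"
        by (simp only: add_diff_add)
      then show "ip X (x + y - (proj x + proj y)) n = 0"
        using ip_add_left[OF c] proj(2)[OF x n] proj(2)[OF y n] by simp
    qed (use x y in simp)
    show "proj (a *\<^sub>C x) = a *\<^sub>C proj x" if x: "x \<in> carr X" for a x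
    proof (rule unique)
      show "a *\<^sub>C proj x \<in> M"
        using proj(1)[OF x] sub by (intro complex_vector.subspace_scale)
      fix n assume n: "n \<in> M"
      have c: "x - proj x \<in> carr X" "n \<in> carr X"
        using proj(1)[OF x] x MX n by auto
      then show "ip X (a *\<^sub>C x - a *\<^sub>C proj x) n = 0"
        using ip_scale_left[OF c] proj(2)[OF x n]
        by (simp add: complex_vector.scale_right_diff_distrib[symmetric])
    qed (use x in simp)
  qed
qed

lemma closed_orthogonal_complement:
  assumes N: "N \<subseteq> carr X"
  shows "closed_subspace X {x \<in> carr X. \<forall>n\<in>N. ip X x n = 0}"
  unfolding closed_subspace_def
proof (intro conjI allI impI)
  show "csubspace {x \<in> carr X. \<forall>n\<in>N. ip X x n = 0}"
    unfolding complex_vector.subspace_def using N by (auto simp: ip_add_left ip_scale_left subset_iff)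
  fix s l assume s: "(\<forall>n. s n \<in> {x \<in> carr X. \<forall>n\<in>N. ip X x n = 0}) \<and> l \<in> carr X \<and> hlim X s l"
  have "ip X l n = 0" if n: "n \<in> N" for n
  proof -
    have "(\<lambda>k. ip X (s k) n) \<longlonglongrightarrow> ip X l n"
      using s N n by (intro hlim_ip) auto
    moreover have "ip X (s k) n = 0" for k
      using s n by simp
    ultimately show ?thesis
      by (simp add: LIMSEQ_const_iff)
  qed
  then show "l \<in> {x \<in> carr X. \<forall>n\<in>N. ip X x n = 0}"
    using s by simp
qed auto

text \<open>
  A vector orthogonal to the kernel of a nonzero bounded functional \<open>F\<close> represents \<open>F\<close> up to a scalar.
\<close>

lemma riesz:
  assumes add: "\<And>u v. u \<in> carr X \<Longrightarrow> v \<in> carr X \<Longrightarrow> F (u + v) = F u + F v"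
    and scale: "\<And>a u. u \<in> carr X \<Longrightarrow> F (a *\<^sub>C u) = a * F u"
    and bdd: "\<And>u. u \<in> carr X \<Longrightarrow> cmod (F u) \<le> C * hnorm X u"
  obtains v where "v \<in> carr X" "\<And>u. u \<in> carr X \<Longrightarrow> F u = ip X u v"
proof (cases "\<forall>u\<in>carr X. F u = 0")
  case True
  then show ?thesis
    using that[of 0] by simp
next
  case False
  then obtain y where y: "y \<in> carr X" "F y \<noteq> 0"
    by blast
  have diff: "F (u - v) = F u - F v" if "u \<in> carr X" "v \<in> carr X" for u v
    using add[of "u - v" v] that by simp
  define M where "M = {u \<in> carr X. F u = 0}"
  have "closed_subspace X M"
    unfolding closed_subspace_def
  proof (intro conjI allI impI)
    show "csubspace M"
      unfolding M_def using scale[of 0 0] by (auto simp: complex_vector.subspace_def add scale)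
    fix s l assume "(\<forall>n. s n \<in> M) \<and> l \<in> carr X \<and> hlim X s l"
    then have s: "\<And>n. s n \<in> carr X" "\<And>n. F (s n) = 0" "l \<in> carr X" "hlim X s l"
      by (auto simp: M_def)
    have "(\<lambda>n. C * hnorm X (s n - l)) \<longlonglongrightarrow> C * 0"
      using s unfolding hlim_def by (intro tendsto_intros)
    moreover have "cmod (F l) \<le> C * hnorm X (s n - l)" for n
      using bdd[of "s n - l"] s by (simp add: diff)
    ultimately have "cmod (F l) \<le> 0"
      using LIMSEQ_le_const by (metis (no_types, lifting) mult_zero_right)
    then show "l \<in> M"
      using s by (simp add: M_def)
  qed (auto simp: M_def)
  then obtain m where m: "m \<in> M" "\<And>n. n \<in> M \<Longrightarrow> ip X (y - m) n = 0"
    using projection_exists y by metis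
  define w where "w = y - m"
  have w: "w \<in> carr X" "F w = F y"
    using m y by (auto simp: w_def M_def diff)
  have nw: "hnorm X w > 0"
    using hnorm_pos[of w] w y scale[of 0 0] by force
  define v where "v = cnj (F w / complex_of_real ((hnorm X w)\<^sup>2)) *\<^sub>C w"
  have "F u = ip X u v" if u: "u \<in> carr X" for u
  proof -
    have "u - (F u / F w) *\<^sub>C w \<in> M"
      using u w y by (simp add: M_def diff scale)
    then have "ip X w (u - (F u / F w) *\<^sub>C w) = 0"
      using m w_def by blast
    then have "ip X (u - (F u / F w) *\<^sub>C w) w = 0"
      using ip_commute[of "u - (F u / F w) *\<^sub>C w" w] u w by simp
    then have "ip X u w = F u / F w * complex_of_real ((hnorm X w)\<^sup>2)"
      using u w by (simp add: ip_diff_left ip_scale_left ip_self)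
    then show ?thesis
      using u w y nw by (auto simp: v_def ip_scale_right)
  qed
  moreover have "v \<in> carr X"
    using w by (simp add: v_def)
  ultimately show ?thesis
    using that by blast
qed

end

section \<open>Bounded operators with bounded inverse\<close>

text \<open>
  The partial sums in the proof of the open mapping theorem converge by this criterion.
\<close>

lemma (in hilb) geometric_limit:
  assumes s: "\<And>n. s n \<in> carr X" and step: "\<And>n. hnorm X (s (Suc n) - s n) \<le> C / 2 ^ n"
  obtains l where "l \<in> carr X" "hlim X s l" "hnorm X (l - s 0) \<le> 2 * C"
proof -
  have dist: "hnorm X (s (n + k) - s n) \<le> 2 * C / 2 ^ n - 2 * C / 2 ^ (n + k)" for n k
  proof (induction k)
    case (Suc k)
    have "hnorm X (s (n + Suc k) - s n) \<le> hnorm X (s (Suc (n + k)) - s (n + k)) + hnorm X (s (n + k) - s n)"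
      using hnorm_triangle3[of "s (Suc (n + k))" "s (n + k)" "s n"] s by simp
    also have "\<dots> \<le> C / 2 ^ (n + k) + (2 * C / 2 ^ n - 2 * C / 2 ^ (n + k))"
      using Suc step[of "n + k"] by linarith
    also have "\<dots> = 2 * C / 2 ^ n - 2 * C / 2 ^ (n + Suc k)"
      by simp
    finally show ?case .
  qed simp
  have C: "C \<ge> 0"
    using order_trans[OF hnorm_nonneg step[of 0]] s by simp
  have dist': "hnorm X (s m - s n) \<le> 2 * C / 2 ^ n" if "n \<le> m" for m n
  proof -
    have "0 \<le> 2 * C / 2 ^ m"
      using C by simp
    then show ?thesis
      using dist[of n "m - n"] that by simp
  qed
  obtain l where l: "l \<in> carr X" "hlim X s l"
  proof (rule complete[of s])
    fix e :: real assume "e > 0"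
    have "(\<lambda>n. 2 * C * (1 / 2) ^ n) \<longlonglongrightarrow> 2 * C * 0"
      by (intro tendsto_intros LIMSEQ_realpow_zero) auto
    then have "\<forall>\<^sub>F n in sequentially. 2 * C * (1 / 2) ^ n < e"
      using \<open>e > 0\<close> by (intro order_tendstoD(2)) auto
    then obtain N where N: "2 * C / 2 ^ n < e" if "n \<ge> N" for n
      unfolding eventually_sequentially by (auto simp: power_divide)
    have "hnorm X (s m - s n) < e" if mn: "m \<ge> N" "n \<ge> N" for m n
    proof (cases "n \<le> m")
      case True
      then show ?thesis
        using dist'[of n m] N[of n] mn by simp
    next
      case False
      then show ?thesis
        using dist'[of m n] N[of m] mn hnorm_commute[of "s m" "s n"] s by simp
    qed
    then show "\<exists>N. \<forall>m\<ge>N. \<forall>n\<ge>N. hnorm X (s m - s n) < e"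
      by blast
  qed (use s in auto)
  have "hnorm X (l - s 0) \<le> 2 * C"
  proof (rule LIMSEQ_le_const)
    have "(\<lambda>n. 2 * C + hnorm X (s n - l)) \<longlonglongrightarrow> 2 * C + 0"
      using l unfolding hlim_def by (intro tendsto_intros)
    then show "(\<lambda>n. 2 * C + hnorm X (s n - l)) \<longlonglongrightarrow> 2 * C"
      by simp
    show "\<exists>N. \<forall>n\<ge>N. hnorm X (l - s 0) \<le> 2 * C + hnorm X (s n - l)"
      using hnorm_triangle3[of l "s n" "s 0" for n] hnorm_commute[of l "s n" for n] l s dist'[of 0 n for n]
      by (smt (verit) div_by_1 le0 power_0)
  qed
  then show ?thesis
    using that l by blast
qed

locale two_hilb = X: hilb X + Y: hilb Y
  for X :: "'e::complex_vector hspace" and Y :: "'f::complex_vector hspace"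
begin

abbreviation "linear_op \<equiv> clinear_between (carr X) (carr Y)"

lemma linear_carr [intro]: "linear_op T \<Longrightarrow> u \<in> carr X \<Longrightarrow> T u \<in> carr Y"
  by (simp add: clinear_between_def)

lemma linear_add: "linear_op T \<Longrightarrow> u \<in> carr X \<Longrightarrow> v \<in> carr X \<Longrightarrow> T (u + v) = T u + T v"
  by (simp add: clinear_between_def)

lemma linear_scale: "linear_op T \<Longrightarrow> u \<in> carr X \<Longrightarrow> T (a *\<^sub>C u) = a *\<^sub>C T u"
  by (simp add: clinear_between_def)

lemma linear_diff: "linear_op T \<Longrightarrow> u \<in> carr X \<Longrightarrow> v \<in> carr X \<Longrightarrow> T (u - v) = T u - T v"
  using linear_add[of T "u - v" v] by simp

lemma linear_zero: "linear_op T \<Longrightarrow> T 0 = 0"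
  using linear_add[of T 0 0] by simp

lemma linear_sum:
  "finite I \<Longrightarrow> linear_op T \<Longrightarrow> (\<And>i. i \<in> I \<Longrightarrow> f i \<in> carr X) \<Longrightarrow>
    T (\<Sum>i\<in>I. f i) = (\<Sum>i\<in>I. T (f i))"
  by (induction I rule: finite_induct) (auto simp: linear_zero linear_add X.carr_sum)

lemma bounded_opE:
  assumes "bounded_op X Y T"
  obtains C where "C \<ge> 0" "\<And>u. u \<in> carr X \<Longrightarrow> hnorm Y (T u) \<le> C * hnorm X u"
proof -
  obtain C where C: "\<And>u. u \<in> carr X \<Longrightarrow> hnorm Y (T u) \<le> C * hnorm X u"
    using assms unfolding bounded_op_def by blast
  have "hnorm Y (T u) \<le> max C 0 * hnorm X u" if "u \<in> carr X" for u
    using C[OF that] mult_right_mono[of C "max C 0" "hnorm X u"] that by simp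
  then show ?thesis
    using that[of "max C 0"] by simp
qed

lemma bounded_op_linear: "bounded_op X Y T \<Longrightarrow> linear_op T"
  by (simp add: bounded_op_def)

lemma bounded_hlim:
  assumes T: "bounded_op X Y T" and s: "\<And>n. s n \<in> carr X" "l \<in> carr X" "hlim X s l"
  shows "hlim Y (\<lambda>n. T (s n)) (T l)"
proof -
  obtain C where C: "C \<ge> 0" "\<And>u. u \<in> carr X \<Longrightarrow> hnorm Y (T u) \<le> C * hnorm X u"
    using bounded_opE[OF T] by blast
  note lin = bounded_op_linear[OF T]
  show ?thesis
    unfolding hlim_def
  proof (rule tendsto_zero_boundI)
    show "(\<lambda>n. C * hnorm X (s n - l)) \<longlonglongrightarrow> 0"
      using s unfolding hlim_def by (rule_tac tendsto_mult_right_zero)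
  qed (use C s lin in \<open>auto simp: linear_diff[symmetric] linear_carr intro!: always_eventually\<close>)
qed

lemma closed_kernel:
  assumes T: "bounded_op X Y T"
  shows "closed_subspace X {u \<in> carr X. T u = 0}"
  unfolding closed_subspace_def
proof (intro conjI allI impI)
  note lin = bounded_op_linear[OF T]
  show "csubspace {u \<in> carr X. T u = 0}"
    unfolding complex_vector.subspace_def
    using lin by (auto simp: linear_zero linear_add linear_scale)
  fix s l assume s: "(\<forall>n. s n \<in> {u \<in> carr X. T u = 0}) \<and> l \<in> carr X \<and> hlim X s l"
  then have "hlim Y (\<lambda>n. T (s n)) (T l)"
    by (intro bounded_hlim[OF T]) auto
  moreover have "hlim Y (\<lambda>n. T (s n)) 0"
    using s by (simp add: hlim_def)
  ultimately have "T l = 0"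
    using s lin by (intro Y.hlim_unique[of "\<lambda>n. T (s n)"]) (auto simp: linear_carr)
  then show "l \<in> {u \<in> carr X. T u = 0}"
    using s by simp
qed auto

lemma closed_range:
  assumes lin: "linear_op T"
    and lim: "\<And>s v. (\<And>n. s n \<in> T ` carr X) \<Longrightarrow> v \<in> carr Y \<Longrightarrow> hlim Y s v \<Longrightarrow> v \<in> T ` carr X"
  shows "closed_subspace Y (T ` carr X)"
  unfolding closed_subspace_def
proof (intro conjI allI impI)
  show "csubspace (T ` carr X)"
    unfolding complex_vector.subspace_def
  proof (intro conjI ballI allI)
    show "0 \<in> T ` carr X"
      using linear_zero[OF lin] by (metis X.carr_zero imageI)
    show "x + y \<in> T ` carr X" if "x \<in> T ` carr X" "y \<in> T ` carr X" for x y
      using that linear_add[OF lin] by (smt (verit) X.carr_add imageE imageI)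
    show "c *\<^sub>C x \<in> T ` carr X" if "x \<in> T ` carr X" for c x
      using that linear_scale[OF lin] by (smt (verit) X.carr_scale imageE imageI)
  qed
qed (use lin lim in auto)

text \<open>
  The open mapping theorem. By Baire's theorem the closure of the image of some ball of \<open>X\<close> contains a ball, so
  that every \<open>y\<close> is approximated arbitrarily well by images of vectors of norm at most \<open>c |y|\<close>. Approximating
  the error again, with halved tolerance each time, yields a preimage of norm at most \<open>2 c |y|\<close>.
\<close>

theorem bounded_inverse:
  assumes T: "bounded_op X Y T" and inj: "\<And>u. u \<in> carr X \<Longrightarrow> T u = 0 \<Longrightarrow> u = 0"
    and surj: "\<And>v. v \<in> carr Y \<Longrightarrow> \<exists>u\<in>carr X. T u = v"
  obtains K where "K > 0" "\<And>u. u \<in> carr X \<Longrightarrow> hnorm X u \<le> K * hnorm Y (T u)"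
proof -
  note lin = bounded_op_linear[OF T]
  define A where "A n = Y.metric.mtopology closure_of (T ` {u \<in> carr X. hnorm X u \<le> real n})" for n
  have A_iff: "y \<in> A n \<longleftrightarrow>
      y \<in> carr Y \<and> (\<forall>e>0. \<exists>u\<in>carr X. hnorm X u \<le> real n \<and> hnorm Y (y - T u) < e)" for y n
  proof (cases "y \<in> carr Y")
    case True
    then have "T u \<in> Y.metric.mball y e \<longleftrightarrow> hnorm Y (y - T u) < e" if "u \<in> carr X" for u e
      using that lin by (simp add: Y.mball_eq linear_carr)
    then show ?thesis
      using True unfolding A_def Y.metric.metric_closure_of bex_simps by blast
  qed (simp add: A_def Y.metric.metric_closure_of)
  have cover: "carr Y \<subseteq> \<Union>(range A)"
  proof
    fix y assume "y \<in> carr Y"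
    then obtain u where u: "u \<in> carr X" "T u = y"
      using surj by blast
    obtain n where "hnorm X u \<le> real n"
      using real_arch_simple by blast
    with u \<open>y \<in> carr Y\<close> have "y \<in> A n"
      unfolding A_iff by auto
    then show "y \<in> \<Union>(range A)"
      by blast
  qed
  have "\<exists>n. Y.metric.mtopology interior_of (A n) \<noteq> {}"
  proof (rule ccontr)
    assume none: "\<nexists>n. Y.metric.mtopology interior_of (A n) \<noteq> {}"
    have "Y.metric.mtopology interior_of \<Union>(range A) = {}"
      using none by (intro Y.metric.metric_Baire_category_alt[OF Y.mcomplete]) (auto simp: A_def)
    moreover have "\<Union>(range A) = carr Y"
      using cover by (auto simp: A_iff)
    then have "Y.metric.mtopology interior_of \<Union>(range A) = carr Y"
      by (metis Y.metric.topspace_mtopology interior_of_topspace)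
    ultimately show False
      using Y.carr_zero by simp
  qed
  then obtain n y0 where "y0 \<in> Y.metric.mtopology interior_of (A n)"
    by blast
  then obtain r where y0: "y0 \<in> carr Y" and r: "r > 0" "Y.metric.mball y0 r \<subseteq> A n"
    unfolding Y.metric.metric_interior_of by blast
  have ballA: "y0 + z \<in> A n" if "z \<in> carr Y" "hnorm Y z < r" for z
  proof -
    have "y0 + z \<in> Y.metric.mball y0 r"
      using that y0 by (simp add: Y.mball_eq)
    then show ?thesis
      using r by blast
  qed
  \<comment> \<open>A vector of norm below \<open>r\<close> is a difference of two elements of \<open>A n\<close>, hence approximated by an image of a
    vector of norm at most \<open>2 n\<close>; scaling \<open>y\<close> to norm \<open>r / 2\<close> costs another factor \<open>2 |y| / r\<close>.\<close>
  define c where "c = 4 * real n / r"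
  have c: "c \<ge> 0"
    using r by (simp add: c_def)
  have approx: "\<exists>u. u \<in> carr X \<and> hnorm X u \<le> c * hnorm Y y \<and> hnorm Y (y - T u) \<le> e"
    if y: "y \<in> carr Y" and e: "e > 0" for y e
  proof (cases "y = 0")
    case True
    then show ?thesis
      using e lin by (intro exI[of _ 0]) (simp add: linear_zero)
  next
    case False
    define t where "t = r / (2 * hnorm Y y)"
    have ny: "hnorm Y y > 0"
      using Y.hnorm_pos y False by blast
    have t: "t > 0" "t * hnorm Y y = r / 2"
      using r ny by (auto simp: t_def)
    define z where "z = complex_of_real t *\<^sub>C y"
    have z: "z \<in> carr Y" "hnorm Y z < r"
      using y t r by (auto simp: z_def)
    have te: "e * t / 2 > 0"
      using t e by simp
    obtain u1 where u1: "u1 \<in> carr X" "hnorm X u1 \<le> real n" "hnorm Y (y0 - T u1) < e * t / 2"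
      using ballA[of 0, simplified, OF r(1)] te unfolding A_iff by blast
    obtain u2 where u2: "u2 \<in> carr X" "hnorm X u2 \<le> real n" "hnorm Y (y0 + z - T u2) < e * t / 2"
      using ballA[OF z] te unfolding A_iff by blast
    define u where "u = complex_of_real (1 / t) *\<^sub>C (u2 - u1)"
    have u: "u \<in> carr X"
      using u1 u2 by (simp add: u_def)
    have "hnorm X u = (1 / t) * hnorm X (u2 - u1)"
      using u1 u2 t by (simp add: u_def norm_divide)
    also have "\<dots> \<le> (1 / t) * (2 * real n)"
      using X.hnorm_triangle_diff[of u2 u1] u1 u2 t by (intro mult_left_mono) auto
    also have "\<dots> = c * hnorm Y y"
      using ny r by (simp add: t_def c_def)
    finally have 1: "hnorm X u \<le> c * hnorm Y y" .
    have Tu: "T u1 \<in> carr Y" "T u2 \<in> carr Y"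
      using u1 u2 lin by auto
    have "complex_of_real t *\<^sub>C (y - T u) = z - (T u2 - T u1)"
      using t u1 u2 lin
      by (simp add: u_def z_def linear_scale linear_diff complex_vector.scale_right_diff_distrib
          scaleC_scaleC scaleC_one flip: of_real_mult)
    also have "\<dots> = (y0 + z - T u2) - (y0 - T u1)"
      by simp
    finally have "t * hnorm Y (y - T u) = hnorm Y ((y0 + z - T u2) - (y0 - T u1))"
      using Y.hnorm_scale[of "y - T u" "complex_of_real t"] y u lin t by (auto simp: linear_carr)
    also have "\<dots> \<le> hnorm Y (y0 + z - T u2) + hnorm Y (y0 - T u1)"
      using y0 z Tu by (intro Y.hnorm_triangle_diff) auto
    also have "\<dots> \<le> t * e"
      using u1 u2 by (simp add: mult.commute)
    finally have "hnorm Y (y - T u) \<le> e"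
      using t by simp
    with 1 u show ?thesis
      by blast
  qed
  then obtain g where g: "g y e \<in> carr X" "hnorm X (g y e) \<le> c * hnorm Y y" "hnorm Y (y - T (g y e)) \<le> e"
    if "y \<in> carr Y" "e > 0" for y e
    by metis
  have main: "hnorm X u \<le> 2 * c * hnorm Y (T u)" if u: "u \<in> carr X" for u
  proof (cases "u = 0")
    case False
    define y \<delta> where "y = T u" and "\<delta> = hnorm Y y"
    have y: "y \<in> carr Y" "\<delta> > 0"
      using u inj[of u] False Y.hnorm_pos[of y] lin by (auto simp: y_def \<delta>_def)
    define res where "res = rec_nat y (\<lambda>k v. v - T (g v (\<delta> / 2 ^ Suc k)))"
    have res_simps: "res 0 = y" "res (Suc k) = res k - T (g (res k) (\<delta> / 2 ^ Suc k))" for k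
      by (auto simp: res_def)
    have res_carr: "res k \<in> carr Y" for k
      by (induction k) (use y g(1) lin in \<open>auto simp: res_simps linear_carr simp del: power_Suc\<close>)
    have res_le: "hnorm Y (res k) \<le> \<delta> / 2 ^ k" for k
      using g(3)[OF res_carr] y by (cases k) (auto simp: res_simps \<delta>_def)
    define s where "s k = (\<Sum>i<k. g (res i) (\<delta> / 2 ^ Suc i))" for k
    have gc: "g (res i) (\<delta> / 2 ^ Suc i) \<in> carr X" for i
      using g(1) res_carr y by simp
    have sc: "s k \<in> carr X" for k
      unfolding s_def using gc by (intro X.carr_sum)
    have Ts: "T (s k) = y - res k" for k
      using gc sc lin
      by (induction k) (auto simp: s_def linear_zero linear_add res_simps X.carr_sum)
    have step: "hnorm X (s (Suc k) - s k) \<le> (c * \<delta>) / 2 ^ k" for k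
    proof -
      have "hnorm X (s (Suc k) - s k) \<le> c * hnorm Y (res k)"
        using g(2)[OF res_carr, of "\<delta> / 2 ^ Suc k" k] y by (simp add: s_def)
      also have "\<dots> \<le> c * (\<delta> / 2 ^ k)"
        by (intro mult_left_mono res_le c)
      finally show ?thesis by simp
    qed
    obtain l where l: "l \<in> carr X" "hlim X s l" "hnorm X (l - s 0) \<le> 2 * (c * \<delta>)"
      using X.geometric_limit[of s "c * \<delta>"] sc step by blast
    have "hlim Y (\<lambda>k. T (s k)) y"
      unfolding hlim_def
    proof (rule tendsto_zero_boundI)
      have "(\<lambda>k. \<delta> * (1 / 2) ^ k) \<longlonglongrightarrow> \<delta> * 0"
        by (intro tendsto_intros LIMSEQ_realpow_zero) auto
      then show "(\<lambda>k. \<delta> / 2 ^ k) \<longlonglongrightarrow> 0"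
        by (simp add: power_divide)
    qed (use res_le res_carr Y.hnorm_minus in \<open>auto simp: Ts\<close>)
    moreover have "hlim Y (\<lambda>k. T (s k)) (T l)"
      using bounded_hlim[OF T sc l(1,2)] .
    ultimately have "T l = y"
      using Y.hlim_unique[of "\<lambda>k. T (s k)" "T l" y] lin sc l y by auto
    then have "T (u - l) = 0"
      using lin u l by (simp add: linear_diff y_def)
    then have "u = l"
      using inj[of "u - l"] u l by simp
    with l show ?thesis
      by (simp add: s_def \<delta>_def y_def)
  qed (use lin in \<open>simp add: linear_zero\<close>)
  show ?thesis
  proof (rule that[of "2 * c + 1"])
    show "hnorm X u \<le> (2 * c + 1) * hnorm Y (T u)" if "u \<in> carr X" for u
      using main[OF that] Y.hnorm_nonneg[of "T u"] lin that by (auto simp: distrib_right linear_carr intro: order_trans)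
  qed (use c in simp)
qed

text \<open>
  The equation \<open>B u = v\<close> says that \<open>u\<close> is a fixed point of \<open>u \<mapsto> A^{-1} (v - (B - A) u)\<close>, which is a
  contraction with factor one half.
\<close>

lemma perturbation:
  assumes A: "linear_op A" and B: "linear_op B" and "c > 0"
    and below: "\<And>u. u \<in> carr X \<Longrightarrow> c * hnorm X u \<le> hnorm Y (A u)"
    and surj: "\<And>v. v \<in> carr Y \<Longrightarrow> \<exists>u\<in>carr X. A u = v"
    and close: "\<And>u. u \<in> carr X \<Longrightarrow> hnorm Y (B u - A u) \<le> c / 2 * hnorm X u"
  shows "\<And>u. u \<in> carr X \<Longrightarrow> c / 2 * hnorm X u \<le> hnorm Y (B u)"
    and "\<And>v. v \<in> carr Y \<Longrightarrow> \<exists>u\<in>carr X. B u = v"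
proof -
  fix u assume u: "u \<in> carr X"
  have "hnorm Y (A u) - hnorm Y (B u) \<le> hnorm Y (B u - A u)"
    using Y.hnorm_reverse[of "A u" "B u"] Y.hnorm_commute[of "A u" "B u"] A B u by auto
  then show "c / 2 * hnorm X u \<le> hnorm Y (B u)"
    using below[OF u] close[OF u] by simp
next
  fix v assume v: "v \<in> carr Y"
  obtain G where G: "G w \<in> carr X" "A (G w) = w" if "w \<in> carr Y" for w
    using surj by metis
  define f where "f u = G (v - (B u - A u))" for u
  have arg: "v - (B u - A u) \<in> carr Y" if "u \<in> carr X" for u
    using A B v that by auto
  have f: "f u \<in> carr X" "A (f u) = v - (B u - A u)" if "u \<in> carr X" for u
    using G arg that by (auto simp: f_def)
  obtain u where u: "u \<in> carr X" "f u = u"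
  proof (rule X.metric.Banach_fixedpoint_thm[OF X.mcomplete, of f "1/2"])
    show "X.mdist (f u) (f u') \<le> 1 / 2 * X.mdist u u'" if "u \<in> carr X" "u' \<in> carr X" for u u'
    proof -
      have "A (f u - f u') = - (B (u - u') - A (u - u'))"
        using f that A B by (simp add: linear_diff)
      then have "c * hnorm X (f u - f u') \<le> hnorm Y (B (u - u') - A (u - u'))"
        using below[of "f u - f u'"] f that A B Y.hnorm_minus[of "B (u - u') - A (u - u')"]
        by (auto simp del: minus_diff_eq simp: linear_carr)
      also have "\<dots> \<le> c / 2 * hnorm X (u - u')"
        using close[of "u - u'"] that by simp
      finally have "hnorm X (f u - f u') \<le> 1 / 2 * hnorm X (u - u')"
        using \<open>c > 0\<close> by simp
      then show ?thesis
        using f that by (simp add: X.mdist_def)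
    qed
  qed (use X.carr_zero f in auto)
  then have "B u = v"
    using f(2)[OF u(1)] by (simp add: algebra_simps)
  then show "\<exists>u\<in>carr X. B u = v"
    using u by blast
qed

end

section \<open>Holomorphic functions with values in a Hilbert space\<close>

definition hderiv :: "'e::complex_vector hspace \<Rightarrow> (complex \<Rightarrow> 'e) \<Rightarrow> 'e \<Rightarrow> complex \<Rightarrow> bool" where
  "hderiv X f d z \<longleftrightarrow> d \<in> carr X \<and>
     ((\<lambda>w. hnorm X (inverse (w - z) *\<^sub>C (f w - f z) - d)) \<longlongrightarrow> 0) (at z)"

lemma holo_into_open:
  assumes "open V"
  shows "holo_into V X f \<longleftrightarrow> (\<forall>z\<in>V. f z \<in> carr X) \<and> (\<forall>z\<in>V. \<exists>d. hderiv X f d z)"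
proof -
  have "at z within V = at z" if "z \<in> V" for z
    using assms that by (rule at_within_open[rotated])
  then show ?thesis
    unfolding holo_into_def hderiv_def Bex_def by (simp cong: ball_cong)
qed

lemma holo_into_carr: "holo_into V X f \<Longrightarrow> z \<in> V \<Longrightarrow> f z \<in> carr X"
  by (simp add: holo_into_def)

lemma holo_into_subset: "holo_into V X f \<Longrightarrow> U \<subseteq> V \<Longrightarrow> holo_into U X f"
  unfolding holo_into_def by (meson subsetD tendsto_within_subset)

lemma hderiv_cong:
  assumes "hderiv X g d z" "\<forall>\<^sub>F w in nhds z. f w = g w"
  shows "hderiv X f d z"
proof -
  have "\<forall>\<^sub>F w in at z. hnorm X (inverse (w - z) *\<^sub>C (f w - f z) - d)
      = hnorm X (inverse (w - z) *\<^sub>C (g w - g z) - d)"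
    using assms(2) eventually_nhds_x_imp_x[OF assms(2)]
    by (auto simp: eventually_at_filter elim: eventually_mono)
  from tendsto_cong[OF this] show ?thesis
    using assms(1) by (simp add: hderiv_def)
qed

lemma holo_into_cong:
  assumes "open V" "holo_into V X g" "\<And>z. z \<in> V \<Longrightarrow> f z = g z"
  shows "holo_into V X f"
proof -
  have "hderiv X f d z" if "z \<in> V" "hderiv X g d z" for d z
  proof (rule hderiv_cong[OF that(2)])
    show "\<forall>\<^sub>F w in nhds z. f w = g w"
      using eventually_nhds_in_open[OF assms(1) that(1)] by eventually_elim (rule assms(3))
  qed
  then show ?thesis
    using assms(2,3) unfolding holo_into_open[OF \<open>open V\<close>] by metis
qed

lemma holo_into_Un:
  assumes "open U" "open V" "holo_into U X f" "holo_into V X f"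
  shows "holo_into (U \<union> V) X f"
  using assms(3,4)
  unfolding holo_into_open[OF assms(1)] holo_into_open[OF assms(2)]
    holo_into_open[OF open_Un[OF assms(1,2)]] ball_Un
  by simp

text \<open>
  The remainder is linear in the bound \<open>B\<close>. Applied to the functions \<open>(f, u)\<close>, where \<open>B\<close> is a multiple of
  \<open>|u|\<close>, it becomes an estimate in norm.
\<close>

lemma scalar_taylor:
  assumes F: "F holomorphic_on ball z r" and r: "r > 0"
    and B: "\<And>w. w \<in> ball z r \<Longrightarrow> cmod (F w) \<le> B" and w: "dist z w < r / 2"
  shows "cmod (F w - F z - deriv F z * (w - z)) \<le> 32 * B / r\<^sup>2 * (cmod (w - z))\<^sup>2"
proof -
  have bd: "cmod ((deriv ^^ 2) F x) \<le> 32 * B / r\<^sup>2" if x: "x \<in> ball z (r/2)" for x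
  proof -
    \<comment> \<open>Radius \<open>r/4\<close> keeps the closed disc inside the domain; it produces the constant \<open>2 * 16\<close>.\<close>
    have sub: "cball x (r/4) \<subseteq> ball z r"
    proof
      fix t assume "t \<in> cball x (r/4)"
      then show "t \<in> ball z r"
        using x r dist_triangle[of z t x] by simp
    qed
    then have "ball x (r/4) \<subseteq> ball z r"
      by (meson ball_subset_cball order_trans)
    moreover have "continuous_on (cball x (r/4)) F"
      using holomorphic_on_imp_continuous_on[OF F] sub continuous_on_subset by blast
    moreover have "cmod (F t) \<le> B" if "cmod (x - t) = r/4" for t
      using B sub that by (auto simp: dist_norm subset_iff)
    ultimately have "cmod ((deriv ^^ 2) F x) \<le> fact 2 * B / (r/4)^2"
      using F r by (intro Cauchy_inequality) (auto intro: holomorphic_on_subset)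
    then show ?thesis
      by (simp add: power2_eq_square field_simps fact_2)
  qed
  have "cmod ((\<lambda>i. (deriv ^^ i) F) 0 w - (\<Sum>i\<le>1. (deriv ^^ i) F z * (w - z) ^ i / fact i))
      \<le> (32 * B / r\<^sup>2) * cmod (w - z) ^ Suc 1 / fact 1"
  proof (rule complex_Taylor[where S = "ball z (r/2)"])
    fix i :: nat and x assume x: "x \<in> ball z (r/2)"
    then have xr: "x \<in> ball z r"
      using r by simp
    have "(deriv ^^ i) F holomorphic_on ball z r"
      using F by (intro holomorphic_higher_deriv) auto
    then have "((deriv ^^ i) F has_field_derivative deriv ((deriv ^^ i) F) x) (at x)"
      using xr by (intro holomorphic_derivI[of _ "ball z r"]) auto
    then show "((deriv ^^ i) F has_field_derivative (deriv ^^ Suc i) F x) (at x within ball z (r/2))"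
      by (simp add: has_field_derivative_at_within)
  qed (use bd r w in \<open>auto simp: numeral_2_eq_2\<close>)
  then show ?thesis
    by (simp add: power2_eq_square algebra_simps)
qed

context hilb
begin

text \<open>
  Completeness along a sequence tending to \<open>z\<close> provides the limit, and the Cauchy estimate passes to it with
  the same constant.
\<close>

lemma pinched_limit:
  assumes carr: "\<And>w. w \<in> ball z r - {z} \<Longrightarrow> G w \<in> carr X" and r: "r > 0"
    and cauchy: "\<And>w w'. w \<in> ball z r - {z} \<Longrightarrow> w' \<in> ball z r - {z} \<Longrightarrow>
      hnorm X (G w - G w') \<le> C * (cmod (w - z) + cmod (w' - z))"
  obtains d where "d \<in> carr X"
    "\<And>w. w \<in> ball z r - {z} \<Longrightarrow> hnorm X (G w - d) \<le> C * cmod (w - z)"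
proof -
  define p where "p n = z + complex_of_real (r / (real n + 2))" for n
  have nz: "cmod (p n - z) = r / (real n + 2)" for n
    using r by (simp add: p_def norm_divide del: of_real_divide)
  have pn: "p n \<in> ball z r - {z}" for n
  proof -
    have "0 < r / (real n + 2)" "r / (real n + 2) < r"
      using r by (auto simp: field_simps add_pos_nonneg)
    then show ?thesis
      using nz[of n] by (auto simp: dist_norm norm_minus_commute)
  qed
  have lim: "(\<lambda>n. cmod (p n - z)) \<longlonglongrightarrow> 0"
    unfolding nz by real_asymp
  have C: "0 \<le> C"
  proof -
    have "0 \<le> C * (cmod (p 0 - z) + cmod (p 0 - z))"
      using order_trans[OF hnorm_nonneg cauchy[OF pn pn]] carr[OF pn] by (metis carr_diff)
    then show ?thesis
      using r unfolding nz by (simp add: zero_le_mult_iff)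
  qed
  obtain d where d: "d \<in> carr X" "hlim X (\<lambda>n. G (p n)) d"
  proof (rule complete[of "\<lambda>n. G (p n)"])
    fix e :: real assume e: "e > 0"
    have "(\<lambda>n. C * cmod (p n - z)) \<longlonglongrightarrow> C * 0"
      by (intro tendsto_intros lim)
    then have "\<forall>\<^sub>F n in sequentially. C * cmod (p n - z) < e / 2"
      using e by (intro order_tendstoD(2)) auto
    then obtain N where N: "\<And>n. n \<ge> N \<Longrightarrow> C * cmod (p n - z) < e / 2"
      unfolding eventually_sequentially by blast
    have "hnorm X (G (p m) - G (p n)) < e" if "m \<ge> N" "n \<ge> N" for m n
      using cauchy[OF pn[of m] pn[of n]] N[OF that(1)] N[OF that(2)] by (simp add: distrib_left)
    then show "\<exists>N. \<forall>m\<ge>N. \<forall>n\<ge>N. hnorm X (G (p m) - G (p n)) < e"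
      by blast
  qed (use carr pn in auto)
  have "hnorm X (G w - d) \<le> C * cmod (w - z)" if w: "w \<in> ball z r - {z}" for w
  proof (rule LIMSEQ_le_const)
    have "(\<lambda>n. C * (cmod (w - z) + cmod (p n - z)) + hnorm X (G (p n) - d))
        \<longlonglongrightarrow> C * (cmod (w - z) + 0) + 0"
      using d unfolding hlim_def by (intro tendsto_intros lim)
    then show "(\<lambda>n. C * (cmod (w - z) + cmod (p n - z)) + hnorm X (G (p n) - d))
        \<longlonglongrightarrow> C * cmod (w - z)"
      by simp
    show "\<exists>N. \<forall>n\<ge>N. hnorm X (G w - d) \<le> C * (cmod (w - z) + cmod (p n - z)) + hnorm X (G (p n) - d)"
    proof (intro exI[of _ 0] allI impI)
      fix n
      show "hnorm X (G w - d) \<le> C * (cmod (w - z) + cmod (p n - z)) + hnorm X (G (p n) - d)"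
        using hnorm_triangle3[OF carr[OF w] carr[OF pn[of n]] d(1)] cauchy[OF w pn[of n]] by linarith
    qed
  qed
  with d show ?thesis
    using that by blast
qed

text \<open>
  The difference quotients of the functions \<open>(f, u)\<close> at \<open>z\<close> satisfy a Cauchy estimate that is linear in
  \<open>|u|\<close>. With \<open>u\<close> the difference of two quotients of \<open>f\<close> this is a Cauchy estimate in norm, so the quotients
  of \<open>f\<close> converge.
\<close>

lemma weakly_holomorphic_hderiv:
  assumes r: "r > 0" and carr: "\<And>w. w \<in> ball z r \<Longrightarrow> f w \<in> carr X"
    and M: "\<And>w. w \<in> ball z r \<Longrightarrow> hnorm X (f w) \<le> M"
    and weak: "\<And>u. u \<in> carr X \<Longrightarrow> (\<lambda>w. ip X (f w) u) holomorphic_on ball z r"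
  shows "\<exists>d. hderiv X f d z"
proof -
  define K where "K = 32 * M / r\<^sup>2"
  have fz: "f z \<in> carr X"
    using carr r by simp
  have "0 \<le> M"
    using order_trans[OF hnorm_nonneg M[of z]] fz r by simp
  then have K: "0 \<le> K"
    by (simp add: K_def)
  define G where "G w = inverse (w - z) *\<^sub>C (f w - f z)" for w
  have Gc: "G w \<in> carr X" if "w \<in> ball z (r/2) - {z}" for w
    using that r carr[of w] fz by (auto simp: G_def)
  have G_ip: "cmod (ip X (G w) u - deriv (\<lambda>w. ip X (f w) u) z) \<le> K * hnorm X u * cmod (w - z)"
    if w: "w \<in> ball z (r/2) - {z}" and u: "u \<in> carr X" for w u
  proof -
    let ?F = "\<lambda>w. ip X (f w) u"
    have fw: "f w \<in> carr X"
      using w carr[of w] r by auto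
    have nz: "cmod (w - z) > 0"
      using w by simp
    have "cmod (?F w - ?F z - deriv ?F z * (w - z)) \<le> 32 * (M * hnorm X u) / r\<^sup>2 * (cmod (w - z))\<^sup>2"
    proof (rule scalar_taylor[OF weak[OF u] r])
      show "cmod (ip X (f t) u) \<le> M * hnorm X u" if "t \<in> ball z r" for t
        using cauchy_schwarz[OF carr[OF that] u] mult_right_mono[OF M[OF that], of "hnorm X u"] u by simp
    qed (use w in auto)
    moreover have "?F w - ?F z - deriv ?F z * (w - z) = (w - z) * (ip X (G w) u - deriv ?F z)"
    proof -
      have "ip X (G w) u = (?F w - ?F z) / (w - z)"
        using fw fz u by (simp add: G_def ip_scale_left ip_diff_left divide_inverse)
      then have "(w - z) * ip X (G w) u = ?F w - ?F z"
        using nz by simp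
      then show ?thesis
        by (metis mult.commute right_diff_distrib)
    qed
    ultimately have "cmod (w - z) * cmod (ip X (G w) u - deriv ?F z)
        \<le> 32 * (M * hnorm X u) / r\<^sup>2 * (cmod (w - z))\<^sup>2"
      by (simp only: norm_mult)
    also have "\<dots> = cmod (w - z) * (K * hnorm X u * cmod (w - z))"
      by (simp add: K_def power2_eq_square)
    finally have "cmod (w - z) * cmod (ip X (G w) u - deriv ?F z)
        \<le> cmod (w - z) * (K * hnorm X u * cmod (w - z))" .
    then show ?thesis
      using nz by simp
  qed
  have cauchy: "hnorm X (G w - G w') \<le> K * (cmod (w - z) + cmod (w' - z))"
    if w: "w \<in> ball z (r/2) - {z}" "w' \<in> ball z (r/2) - {z}" for w w'
  proof (rule norm_le_if_ip_le)
    let ?u = "G w - G w'"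
    let ?d = "deriv (\<lambda>w. ip X (f w) ?u) z"
    have u: "?u \<in> carr X"
      using Gc w by auto
    have "ip X ?u ?u = (ip X (G w) ?u - ?d) - (ip X (G w') ?u - ?d)"
      using Gc[OF w(1)] Gc[OF w(2)] u ip_diff_left[of "G w" "G w'" ?u] by simp
    then have "cmod (ip X ?u ?u) \<le> cmod (ip X (G w) ?u - ?d) + cmod (ip X (G w') ?u - ?d)"
      by (metis norm_triangle_ineq4)
    also have "\<dots> \<le> K * hnorm X ?u * cmod (w - z) + K * hnorm X ?u * cmod (w' - z)"
      by (intro add_mono G_ip w u)
    finally show "cmod (ip X ?u ?u) \<le> K * (cmod (w - z) + cmod (w' - z)) * hnorm X ?u"
      by (simp add: algebra_simps)
  qed (use Gc w K in auto)
  obtain d where d: "d \<in> carr X"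
    "\<And>w. w \<in> ball z (r/2) - {z} \<Longrightarrow> hnorm X (G w - d) \<le> K * cmod (w - z)"
    using pinched_limit[of z "r/2" G K] Gc cauchy r by auto
  have "((\<lambda>w. hnorm X (G w - d)) \<longlongrightarrow> 0) (at z)"
  proof (rule tendsto_zero_boundI)
    have "((\<lambda>w. K * cmod (w - z)) \<longlongrightarrow> K * cmod (z - z)) (at z)"
      by (intro tendsto_intros)
    then show "((\<lambda>w. K * cmod (w - z)) \<longlongrightarrow> 0) (at z)"
      by simp
    have ev: "\<forall>\<^sub>F w in at z. w \<in> ball z (r/2) - {z}"
      using r by (intro eventually_at_in_open) auto
    show "\<forall>\<^sub>F w in at z. 0 \<le> hnorm X (G w - d)"
      using ev by eventually_elim (use Gc d in auto)
    show "\<forall>\<^sub>F w in at z. hnorm X (G w - d) \<le> K * cmod (w - z)"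
      using ev by eventually_elim (use d in auto)
  qed
  then show ?thesis
    using d by (auto simp: hderiv_def G_def)
qed

lemma hderiv_ip:
  assumes "hderiv X f d z" "\<forall>\<^sub>F w in nhds z. f w \<in> carr X" and u: "u \<in> carr X"
  shows "((\<lambda>w. ip X (f w) u) has_field_derivative ip X d u) (at z)"
  unfolding has_field_derivative_iff
proof (rule tendsto_norm_zero_cancel[THEN LIM_zero_cancel], rule tendsto_zero_boundI)
  show "((\<lambda>w. hnorm X (inverse (w - z) *\<^sub>C (f w - f z) - d) * hnorm X u) \<longlongrightarrow> 0) (at z)"
    using assms(1) unfolding hderiv_def by (intro tendsto_mult_left_zero) auto
  have d: "d \<in> carr X"
    using assms by (simp add: hderiv_def)
  have fz: "f z \<in> carr X"
    using eventually_nhds_x_imp_x[OF assms(2)] .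
  have "\<forall>\<^sub>F w in at z. f w \<in> carr X"
    using assms(2) by (auto simp: eventually_at_filter elim: eventually_mono)
  then show "\<forall>\<^sub>F w in at z. cmod ((ip X (f w) u - ip X (f z) u) / (w - z) - ip X d u)
      \<le> hnorm X (inverse (w - z) *\<^sub>C (f w - f z) - d) * hnorm X u"
  proof eventually_elim
    case (elim w)
    have "(ip X (f w) u - ip X (f z) u) / (w - z) - ip X d u
        = ip X (inverse (w - z) *\<^sub>C (f w - f z) - d) u"
      using elim fz d u by (simp add: ip_diff_left ip_scale_left divide_inverse mult.commute)
    then show ?case
      using cauchy_schwarz[of "inverse (w - z) *\<^sub>C (f w - f z) - d" u] elim fz d u by simp
  qed
qed auto

lemma hderiv_continuous:
  assumes "hderiv X f d z" "\<forall>\<^sub>F w in nhds z. f w \<in> carr X"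
  shows "((\<lambda>w. hnorm X (f w - f z)) \<longlongrightarrow> 0) (at z)"
proof (rule tendsto_zero_boundI)
  have d: "d \<in> carr X"
    using assms by (simp add: hderiv_def)
  have fz: "f z \<in> carr X"
    using eventually_nhds_x_imp_x[OF assms(2)] .
  have ev: "\<forall>\<^sub>F w in at z. f w \<in> carr X \<and> w \<noteq> z"
    using assms(2) by (auto simp: eventually_at_filter elim: eventually_mono)
  have "((\<lambda>w. cmod (w - z) * (hnorm X (inverse (w - z) *\<^sub>C (f w - f z) - d) + hnorm X d))
      \<longlongrightarrow> cmod (z - z) * (0 + hnorm X d)) (at z)"
    using assms(1) unfolding hderiv_def by (intro tendsto_intros) auto
  then show "((\<lambda>w. cmod (w - z) * (hnorm X (inverse (w - z) *\<^sub>C (f w - f z) - d) + hnorm X d))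
      \<longlongrightarrow> 0) (at z)"
    by simp
  show "\<forall>\<^sub>F w in at z. 0 \<le> hnorm X (f w - f z)"
    using ev by eventually_elim (use fz in auto)
  show "\<forall>\<^sub>F w in at z. hnorm X (f w - f z)
      \<le> cmod (w - z) * (hnorm X (inverse (w - z) *\<^sub>C (f w - f z) - d) + hnorm X d)"
    using ev
  proof eventually_elim
    case (elim w)
    let ?D = "inverse (w - z) *\<^sub>C (f w - f z)"
    have "f w - f z = (w - z) *\<^sub>C ?D"
      using elim by (simp add: scaleC_scaleC scaleC_one)
    then have "hnorm X (f w - f z) = cmod (w - z) * hnorm X ?D"
      using elim fz by (metis carr_diff carr_scale hnorm_scale)
    also have "hnorm X ?D \<le> hnorm X (?D - d) + hnorm X d"
      using hnorm_triangle[of "?D - d" d] elim fz d by simp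
    finally show ?case
      by (simp add: mult_left_mono)
  qed
qed

text \<open>
  This criterion makes closure under sums and scalar multiples, and removal of singularities, consequences of
  the scalar case.
\<close>

theorem holo_into_iff_weak:
  assumes V: "open V"
  shows "holo_into V X f \<longleftrightarrow> (\<forall>z\<in>V. f z \<in> carr X) \<and>
     (\<forall>z\<in>V. \<exists>M. \<forall>\<^sub>F w in nhds z. hnorm X (f w) \<le> M) \<and>
     (\<forall>u\<in>carr X. (\<lambda>w. ip X (f w) u) holomorphic_on V)" (is "?L \<longleftrightarrow> ?R")
proof
  assume L: ?L
  have fc: "f z \<in> carr X" if "z \<in> V" for z
    using L that by (rule holo_into_carr)
  have ev: "\<forall>\<^sub>F w in nhds z. f w \<in> carr X" if "z \<in> V" for z
    using eventually_nhds_in_open[OF V that] by eventually_elim (rule fc)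
  have "\<exists>M. \<forall>\<^sub>F w in nhds z. hnorm X (f w) \<le> M" if z: "z \<in> V" for z
  proof -
    obtain d where "hderiv X f d z"
      using L z V by (auto simp: holo_into_open)
    then have "\<forall>\<^sub>F w in at z. hnorm X (f w - f z) < 1"
      using ev[OF z] by (intro order_tendstoD(2)[OF hderiv_continuous]) auto
    then have "\<forall>\<^sub>F w in nhds z. w \<noteq> z \<longrightarrow> hnorm X (f w - f z) < 1"
      by (simp add: eventually_at_filter)
    with ev[OF z] have "\<forall>\<^sub>F w in nhds z. hnorm X (f w) \<le> hnorm X (f z) + 1"
    proof eventually_elim
      case (elim w)
      then show ?case
        using hnorm_reverse[of "f w" "f z"] fc[OF z] by (cases "w = z") auto
    qed
    then show ?thesis by blast
  qed
  moreover have "(\<lambda>w. ip X (f w) u) holomorphic_on V" if u: "u \<in> carr X" for u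
    unfolding holomorphic_on_open[OF V]
  proof
    fix z assume z: "z \<in> V"
    then obtain d where "hderiv X f d z"
      using L V by (auto simp: holo_into_open)
    then show "\<exists>f'. ((\<lambda>w. ip X (f w) u) has_field_derivative f') (at z)"
      using hderiv_ip[OF _ ev[OF z] u] by blast
  qed
  ultimately show ?R
    using fc by blast
next
  assume R: ?R
  have "\<exists>d. hderiv X f d z" if z: "z \<in> V" for z
  proof -
    obtain M where "\<forall>\<^sub>F w in nhds z. hnorm X (f w) \<le> M"
      using R z by blast
    with eventually_nhds_in_open[OF V z]
    have "\<forall>\<^sub>F w in nhds z. w \<in> V \<and> hnorm X (f w) \<le> M"
      by eventually_elim auto
    then obtain r where r: "r > 0" "\<And>w. w \<in> ball z r \<Longrightarrow> w \<in> V \<and> hnorm X (f w) \<le> M"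
      unfolding eventually_nhds_metric by (auto simp: dist_commute)
    show ?thesis
    proof (rule weakly_holomorphic_hderiv[OF r(1), where M = M])
      show "(\<lambda>w. ip X (f w) u) holomorphic_on ball z r" if "u \<in> carr X" for u
        using R that r by (meson holomorphic_on_subset subsetI)
    qed (use R r in auto)
  qed
  then show ?L
    using R by (simp add: holo_into_open[OF V])
qed

lemma holo_into_ip:
  "open V \<Longrightarrow> holo_into V X f \<Longrightarrow> u \<in> carr X \<Longrightarrow> (\<lambda>w. ip X (f w) u) holomorphic_on V"
  using holo_into_iff_weak by blast

lemma holo_into_bounded:
  "open V \<Longrightarrow> holo_into V X f \<Longrightarrow> z \<in> V \<Longrightarrow> \<exists>M. \<forall>\<^sub>F w in nhds z. hnorm X (f w) \<le> M"
  using holo_into_iff_weak by blast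

lemma holo_into_const: "c \<in> carr X \<Longrightarrow> holo_into V X (\<lambda>_. c)"
  unfolding holo_into_def by (auto intro!: bexI[of _ 0])

lemma holo_into_add:
  assumes V: "open V" and f: "holo_into V X f" and g: "holo_into V X g"
  shows "holo_into V X (\<lambda>w. f w + g w)"
  unfolding holo_into_iff_weak[OF V]
proof (intro conjI ballI)
  note fc = holo_into_carr[OF f] and gc = holo_into_carr[OF g]
  show "f z + g z \<in> carr X" if "z \<in> V" for z
    using fc gc that by blast
  show "\<exists>M. \<forall>\<^sub>F w in nhds z. hnorm X (f w + g w) \<le> M" if z: "z \<in> V" for z
  proof -
    obtain M N where "\<forall>\<^sub>F w in nhds z. hnorm X (f w) \<le> M" "\<forall>\<^sub>F w in nhds z. hnorm X (g w) \<le> N"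
      using holo_into_bounded[OF V f z] holo_into_bounded[OF V g z] by blast
    with eventually_nhds_in_open[OF V z] have "\<forall>\<^sub>F w in nhds z. hnorm X (f w + g w) \<le> M + N"
      by eventually_elim (meson add_mono fc gc hnorm_triangle order_trans)
    then show ?thesis by blast
  qed
  show "(\<lambda>w. ip X (f w + g w) u) holomorphic_on V" if u: "u \<in> carr X" for u
    using holomorphic_on_add[OF holo_into_ip[OF V f u] holo_into_ip[OF V g u]]
    by (rule holomorphic_transform) (use fc gc u in \<open>auto simp: ip_add_left\<close>)
qed

lemma holo_into_scale:
  assumes V: "open V" and f: "holo_into V X f" and c: "c holomorphic_on V"
  shows "holo_into V X (\<lambda>w. c w *\<^sub>C f w)"
  unfolding holo_into_iff_weak[OF V]
proof (intro conjI ballI)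
  note fc = holo_into_carr[OF f]
  show "c z *\<^sub>C f z \<in> carr X" if "z \<in> V" for z
    using fc that by blast
  show "\<exists>M. \<forall>\<^sub>F w in nhds z. hnorm X (c w *\<^sub>C f w) \<le> M" if z: "z \<in> V" for z
  proof -
    obtain M where 1: "\<forall>\<^sub>F w in nhds z. hnorm X (f w) \<le> M"
      using holo_into_bounded[OF V f z] by blast
    have "isCont c z"
      using c V z holomorphic_on_imp_continuous_on continuous_on_eq_continuous_at by blast
    then have "((\<lambda>w. cmod (c w)) \<longlongrightarrow> cmod (c z)) (nhds z)"
      by (intro tendsto_norm) (simp add: isCont_def tendsto_at_iff_tendsto_nhds)
    then have "\<forall>\<^sub>F w in nhds z. cmod (c w) < cmod (c z) + 1"
      by (rule order_tendstoD) simp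
    with 1 eventually_nhds_in_open[OF V z]
    have "\<forall>\<^sub>F w in nhds z. hnorm X (c w *\<^sub>C f w) \<le> (cmod (c z) + 1) * M"
      by eventually_elim (auto simp: fc intro!: mult_mono)
    then show ?thesis by blast
  qed
  show "(\<lambda>w. ip X (c w *\<^sub>C f w) u) holomorphic_on V" if u: "u \<in> carr X" for u
    using holomorphic_on_mult[OF c holo_into_ip[OF V f u]]
    by (rule holomorphic_transform) (use fc u in \<open>auto simp: ip_scale_left\<close>)
qed

lemma holo_into_diff:
  assumes V: "open V" and f: "holo_into V X f" and g: "holo_into V X g"
  shows "holo_into V X (\<lambda>w. f w - g w)"
proof -
  have "holo_into V X (\<lambda>w. f w + (-1) *\<^sub>C g w)"
    by (intro holo_into_add holo_into_scale V f g) auto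
  then show ?thesis
    by (simp add: complex_vector.scale_minus_left scaleC_one)
qed

lemma holo_into_sum:
  assumes V: "open V" and f: "finite I" "\<And>i. i \<in> I \<Longrightarrow> holo_into V X (f i)"
  shows "holo_into V X (\<lambda>w. \<Sum>i\<in>I. f i w)"
  using f by (induction I rule: finite_induct) (auto intro: holo_into_const holo_into_add V)

lemma holo_into_continuous:
  assumes V: "open V" and f: "holo_into V X f" and z: "z \<in> V"
  shows "((\<lambda>w. hnorm X (f w - f z)) \<longlongrightarrow> 0) (at z)"
proof -
  obtain d where "hderiv X f d z"
    using f z V by (auto simp: holo_into_open)
  then show ?thesis
  proof (rule hderiv_continuous)
    show "\<forall>\<^sub>F w in nhds z. f w \<in> carr X"
      using eventually_nhds_in_open[OF V z] by eventually_elim (rule holo_into_carr[OF f])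
  qed
qed

text \<open>
  The scalar functions \<open>(f, u)\<close> extend to functions \<open>g u\<close> bounded by \<open>M' |u|\<close>. Their Lipschitz estimates at
  \<open>p\<close> are again linear in \<open>|u|\<close>, so \<open>f\<close> itself converges in norm at \<open>p\<close>, and the extension is weakly
  holomorphic.
\<close>

theorem removable_singularity:
  assumes V: "open V" and p: "p \<in> V" and f: "holo_into (V - {p}) X f"
    and bdd: "\<forall>\<^sub>F w in at p. hnorm X (f w) \<le> M"
  obtains h where "holo_into V X h" "\<And>w. w \<in> V - {p} \<Longrightarrow> h w = f w"
proof -
  have V': "open (V - {p})"
    using V by blast
  note fc = holo_into_carr[OF f]
  have "\<forall>\<^sub>F w in at p. w \<in> V - {p} \<and> hnorm X (f w) \<le> M"
    using eventually_at_in_open[OF V p] bdd by eventually_elim auto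
  then obtain r where r: "r > 0" "\<And>w. w \<in> ball p r - {p} \<Longrightarrow> w \<in> V \<and> hnorm X (f w) \<le> M"
    unfolding eventually_at by (force simp: dist_commute)
  have fc': "f w \<in> carr X" if "w \<in> ball p r - {p}" for w
    using fc r that by blast
  define M' where "M' = max M 0"
  have M': "hnorm X (f w) \<le> M'" "0 \<le> M'" if "w \<in> ball p r - {p}" for w
    using r(2)[OF that] by (auto simp: M'_def)
  define g where "g u = (SOME g. g holomorphic_on ball p r \<and> (\<forall>w\<in>ball p r - {p}. g w = ip X (f w) u))" for u
  have g: "g u holomorphic_on ball p r" "\<And>w. w \<in> ball p r - {p} \<Longrightarrow> g u w = ip X (f w) u"
    if u: "u \<in> carr X" for u
  proof -
    have "\<exists>g. g holomorphic_on ball p r \<and> (\<forall>w\<in>ball p r - {p}. g w = ip X (f w) u)"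
    proof (subst holomorphic_on_extend_bounded)
      have "ball p r - {p} \<subseteq> V - {p}"
        using r by blast
      then show "(\<lambda>w. ip X (f w) u) holomorphic_on ball p r - {p}"
        using holo_into_ip[OF V' f u] holomorphic_on_subset by blast
      have "\<forall>\<^sub>F w in at p. w \<in> ball p r - {p}"
        using r by (intro eventually_at_in_open) auto
      then have "\<forall>\<^sub>F w in at p. cmod (ip X (f w) u) \<le> M' * hnorm X u"
        by eventually_elim
          (meson M' cauchy_schwarz fc' hnorm_nonneg mult_right_mono order_trans u)
      then show "\<exists>B. \<forall>\<^sub>F w in at p. cmod (ip X (f w) u) \<le> B"
        by blast
    qed (use r in auto)
    from someI_ex[OF this] show "g u holomorphic_on ball p r"
      "\<And>w. w \<in> ball p r - {p} \<Longrightarrow> g u w = ip X (f w) u"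
      by (auto simp: g_def)
  qed
  have gp: "(g u \<longlongrightarrow> g u p) (at p)" if u: "u \<in> carr X" for u
    using g(1)[OF u] r holomorphic_on_imp_continuous_on
      continuous_on_eq_continuous_at[of "ball p r"] by (metis centre_in_ball continuous_at open_ball)
  have g_le: "cmod (g u w) \<le> M' * hnorm X u" if u: "u \<in> carr X" and w: "w \<in> ball p r" for u w
  proof -
    have *: "cmod (g u w) \<le> M' * hnorm X u" if "w \<in> ball p r - {p}" for w
      using g(2)[OF u that] cauchy_schwarz[OF fc'[OF that] u]
        mult_right_mono[OF M'(1)[OF that], of "hnorm X u"] u by simp
    show ?thesis
    proof (cases "w = p")
      case True
      have "\<forall>\<^sub>F w in at p. w \<in> ball p r - {p}"
        using r by (intro eventually_at_in_open) auto
      then have "\<forall>\<^sub>F w in at p. cmod (g u w) \<le> M' * hnorm X u"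
        by eventually_elim (rule *)
      then show ?thesis
        using tendsto_upperbound[OF tendsto_norm[OF gp[OF u]]] True by simp
    qed (use * w in auto)
  qed
  have M0: "0 \<le> M'"
    by (simp add: M'_def)
  \<comment> \<open>On the half ball the Taylor remainder contributes \<open>32 (r / 2) / r^2 = 16 / r\<close> and Cauchy's bound on the
    derivative \<open>2 / r\<close>.\<close>
  define K where "K = 18 * M' / r"
  have g_lip: "cmod (g u w - g u p) \<le> K * hnorm X u * cmod (w - p)"
    if u: "u \<in> carr X" and w: "w \<in> ball p (r/2)" for u w
  proof -
    let ?B = "M' * hnorm X u" and ?d = "cmod (w - p)"
    have B0: "0 \<le> ?B"
      using M0 u by simp
    have wd: "?d \<le> r / 2"
      using w by (simp add: dist_norm norm_minus_commute)
    have 1: "cmod (g u w - g u p - deriv (g u) p * (w - p)) \<le> 32 * ?B / r\<^sup>2 * ?d\<^sup>2"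
      using w g_le[OF u] by (intro scalar_taylor g(1) u r) auto
    have "cmod ((deriv ^^ 1) (g u) p) \<le> fact 1 * ?B / (r/2) ^ 1"
    proof (rule Cauchy_inequality)
      have "cball p (r/2) \<subseteq> ball p r"
        using r by auto
      then show "g u holomorphic_on ball p (r/2)" "continuous_on (cball p (r/2)) (g u)"
        using g(1)[OF u] by (meson ball_subset_cball holomorphic_on_imp_continuous_on
            holomorphic_on_subset continuous_on_subset order_trans)+
      show "cmod (g u x) \<le> ?B" if "cmod (p - x) = r / 2" for x
        using that r by (intro g_le u) (auto simp: dist_norm)
    qed (use r in auto)
    then have "cmod (deriv (g u) p) * ?d \<le> ?B / (r/2) * ?d"
      by (intro mult_right_mono) auto
    moreover have "32 * ?B / r\<^sup>2 * ?d\<^sup>2 \<le> 32 * ?B / r\<^sup>2 * (?d * (r / 2))"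
      unfolding power2_eq_square[of ?d] using wd B0 by (intro mult_left_mono) auto
    moreover have "cmod (g u w - g u p) \<le> cmod (g u w - g u p - deriv (g u) p * (w - p)) + cmod (deriv (g u) p) * ?d"
      using norm_triangle_ineq[of "g u w - g u p - deriv (g u) p * (w - p)" "deriv (g u) p * (w - p)"]
      by (simp add: norm_mult)
    ultimately have "cmod (g u w - g u p) \<le> 32 * ?B / r\<^sup>2 * (?d * (r / 2)) + ?B / (r/2) * ?d"
      using 1 by linarith
    also have "\<dots> = K * hnorm X u * ?d"
      using r by (simp add: K_def power2_eq_square field_simps)
    finally show ?thesis .
  qed
  have K: "0 \<le> K"
    using M0 r by (simp add: K_def)
  have half: "w \<in> ball p r - {p}" if "w \<in> ball p (r/2) - {p}" for w
    using that r by auto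
  have cauchy: "hnorm X (f w - f w') \<le> K * (cmod (w - p) + cmod (w' - p))"
    if w: "w \<in> ball p (r/2) - {p}" "w' \<in> ball p (r/2) - {p}" for w w'
  proof (rule norm_le_if_ip_le)
    let ?u = "f w - f w'"
    have u: "?u \<in> carr X"
      using fc'[OF half] w by blast
    have "ip X ?u ?u = (g ?u w - g ?u p) - (g ?u w' - g ?u p)"
      using g(2)[OF u half] w ip_diff_left[of "f w" "f w'" ?u] fc'[OF half] u by simp
    then have "cmod (ip X ?u ?u) \<le> cmod (g ?u w - g ?u p) + cmod (g ?u w' - g ?u p)"
      by (metis norm_triangle_ineq4)
    also have "\<dots> \<le> K * hnorm X ?u * cmod (w - p) + K * hnorm X ?u * cmod (w' - p)"
      using w by (intro add_mono g_lip u) auto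
    finally show "cmod (ip X ?u ?u) \<le> K * (cmod (w - p) + cmod (w' - p)) * hnorm X ?u"
      by (simp add: algebra_simps)
  qed (use fc' half w K in auto)
  obtain l where l: "l \<in> carr X"
    "\<And>w. w \<in> ball p (r/2) - {p} \<Longrightarrow> hnorm X (f w - l) \<le> K * cmod (w - p)"
    using pinched_limit[of p "r/2" f K] fc' half cauchy r by (metis half_gt_zero)
  define h where "h = f(p := l)"
  have hf: "h w = f w" if "w \<noteq> p" for w
    using that by (simp add: h_def)
  have g_eq: "g u w = ip X (h w) u" if u: "u \<in> carr X" and w: "w \<in> ball p r" for u w
  proof (cases "w = p")
    case True
    have ev: "\<forall>\<^sub>F w in at p. w \<in> ball p (r/2) - {p}"
      using r by (intro eventually_at_in_open) auto
    have "((\<lambda>w. ip X (f w) u) \<longlongrightarrow> ip X l u) (at p)"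
    proof (rule tendsto_norm_zero_cancel[THEN LIM_zero_cancel], rule tendsto_zero_boundI)
      have "((\<lambda>w. K * cmod (w - p) * hnorm X u) \<longlongrightarrow> K * cmod (p - p) * hnorm X u) (at p)"
        by (intro tendsto_intros)
      then show "((\<lambda>w. K * cmod (w - p) * hnorm X u) \<longlongrightarrow> 0) (at p)"
        by simp
      show "\<forall>\<^sub>F w in at p. cmod (ip X (f w) u - ip X l u) \<le> K * cmod (w - p) * hnorm X u"
        using ev
      proof eventually_elim
        case (elim w)
        have "cmod (ip X (f w) u - ip X l u) \<le> hnorm X (f w - l) * hnorm X u"
          using cauchy_schwarz[of "f w - l" u] fc'[OF half[OF elim]] l u by (simp add: ip_diff_left)
        also have "\<dots> \<le> K * cmod (w - p) * hnorm X u"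
          using l(2)[OF elim] u by (intro mult_right_mono) auto
        finally show ?case .
      qed
    qed auto
    moreover have "\<forall>\<^sub>F w in at p. g u w = ip X (f w) u"
      using ev by eventually_elim (use g(2)[OF u half] in auto)
    ultimately have "(g u \<longlongrightarrow> ip X l u) (at p)"
      by (simp add: tendsto_cong)
    then have "g u p = ip X l u"
      using gp[OF u] tendsto_unique[OF at_neq_bot] by blast
    then show ?thesis
      using True by (simp add: h_def)
  qed (use g u w hf in auto)
  have "holo_into (ball p r) X h"
    unfolding holo_into_iff_weak[OF open_ball]
  proof (intro conjI ballI)
    show hc: "h w \<in> carr X" if "w \<in> ball p r" for w
      using fc'[of w] l that by (auto simp: h_def)
    show "\<exists>M. \<forall>\<^sub>F w in nhds z. hnorm X (h w) \<le> M" if z: "z \<in> ball p r" for z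
    proof -
      have "\<forall>\<^sub>F w in nhds z. w \<in> ball p r"
        using z by (intro eventually_nhds_in_open) auto
      then have "\<forall>\<^sub>F w in nhds z. hnorm X (h w) \<le> max M' (hnorm X l)"
        by eventually_elim (use M' in \<open>force simp: h_def\<close>)
      then show ?thesis by blast
    qed
    show "(\<lambda>w. ip X (h w) u) holomorphic_on ball p r" if u: "u \<in> carr X" for u
      using g(1)[OF u] g_eq[OF u] by (rule holomorphic_transform)
  qed
  moreover have "holo_into (V - {p}) X h"
    using V' f by (rule holo_into_cong) (auto simp: h_def)
  ultimately have "holo_into (ball p r \<union> (V - {p})) X h"
    using V' by (intro holo_into_Un) auto
  then have "holo_into V X h"
    by (rule holo_into_subset) (use r in auto)
  then show ?thesis
    using that hf by auto
qed

text \<open>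
  The difference quotient at \<open>p\<close> has a limit there, so it extends holomorphically.
\<close>

lemma factor_out:
  assumes V: "open V" and p: "p \<in> V" and f: "holo_into V X f"
  obtains g where "holo_into V X g" "\<And>w. w \<in> V \<Longrightarrow> f w = f p + (w - p) *\<^sub>C g w"
proof -
  define G where "G w = inverse (w - p) *\<^sub>C (f w - f p)" for w
  have fp: "f p \<in> carr X"
    using holo_into_carr[OF f p] .
  have V': "open (V - {p})"
    using V by blast
  have G: "holo_into (V - {p}) X G"
    unfolding G_def using holo_into_subset[OF f, of "V - {p}"] fp V'
    by (intro holo_into_scale holo_into_diff holo_into_const) (auto intro!: holomorphic_intros)
  obtain d where d: "hderiv X f d p"
    using f V p by (auto simp: holo_into_open)
  then have dc: "d \<in> carr X" and near: "\<forall>\<^sub>F w in at p. hnorm X (G w - d) < 1"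
    unfolding hderiv_def G_def by (auto dest: order_tendstoD(2)[of _ _ _ 1])
  from near eventually_at_in_open[OF V p]
  have "\<forall>\<^sub>F w in at p. hnorm X (G w) \<le> hnorm X d + 1"
  proof eventually_elim
    case (elim w)
    then show ?case
      using hnorm_reverse[of "G w" d] holo_into_carr[OF G, of w] dc by auto
  qed
  then obtain g where g: "holo_into V X g" "\<And>w. w \<in> V - {p} \<Longrightarrow> g w = G w"
    using removable_singularity[OF V p G] by metis
  have "f w = f p + (w - p) *\<^sub>C g w" if "w \<in> V" for w
    using that g(2)[of w] by (cases "w = p") (auto simp: G_def scaleC_scaleC scaleC_one)
  with g show ?thesis
    using that by blast
qed

end

section \<open>Principal parts\<close>

lemma laurent_tail_eq:
  assumes "\<And>k. k \<ge> N \<Longrightarrow> a k = 0"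
  shows "laurent_tail p a \<sigma> = (\<Sum>k<N. (inverse (\<sigma> - p) ^ Suc k) *\<^sub>C a k)"
  unfolding laurent_tail_def
proof (rule sum.mono_neutral_left)
  show "{k. a k \<noteq> 0} \<subseteq> {..<N}"
    using assms leI by auto
qed auto

lemma finite_support_bound:
  assumes "finite {k. a k \<noteq> (0::'a::zero)}"
  obtains N where "\<And>k::nat. k \<ge> N \<Longrightarrow> a k = 0"
proof -
  obtain m where "\<forall>k\<in>{k. a k \<noteq> 0}. k < m"
    using assms finite_nat_set_iff_bounded by blast
  then show ?thesis
    using that[of m] not_less by blast
qed

lemma leading_coefficient:
  assumes "finite {k. a k \<noteq> (0::'a::zero)}" "a \<noteq> (\<lambda>_. 0)"
  obtains K :: nat where "a K \<noteq> 0" "\<And>k. k > K \<Longrightarrow> a k = 0"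
proof -
  have "{k. a k \<noteq> 0} \<noteq> {}"
    using assms(2) by (auto simp: fun_eq_iff)
  then have "a (Max {k. a k \<noteq> 0}) \<noteq> 0"
    using Max_in[OF assms(1)] by simp
  moreover have "a k = 0" if "k > Max {k. a k \<noteq> 0}" for k
    using Max_ge[OF assms(1), of k] that by (metis mem_Collect_eq not_less)
  ultimately show ?thesis
    using that by blast
qed

lemma laurent_tail_diff:
  assumes "finite {k. a k \<noteq> 0}" "finite {k. b k \<noteq> 0}"
  shows "laurent_tail p (\<lambda>k. a k - b k) \<sigma> = laurent_tail p a \<sigma> - laurent_tail p b \<sigma>"
proof -
  obtain M N where M: "\<And>k. k \<ge> M \<Longrightarrow> a k = 0" and N: "\<And>k. k \<ge> N \<Longrightarrow> b k = 0"
    using assms finite_support_bound by metis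
  have eq: "laurent_tail p c \<sigma> = (\<Sum>k<max M N. (inverse (\<sigma> - p) ^ Suc k) *\<^sub>C c k)"
    if "\<And>k. k \<ge> max M N \<Longrightarrow> c k = 0" for c
    using laurent_tail_eq that .
  show ?thesis
    using M N eq[of a] eq[of b] eq[of "\<lambda>k. a k - b k"]
    by (simp add: complex_vector.scale_right_diff_distrib sum_subtractf)
qed

context hilb
begin

lemma laurent_tail_carr:
  assumes "\<And>k. a k \<in> carr X"
  shows "laurent_tail p a \<sigma> \<in> carr X"
  unfolding laurent_tail_def using assms by (intro carr_sum) auto

lemma holo_laurent_tail:
  assumes a: "\<And>k. a k \<in> carr X" and "finite {k. a k \<noteq> 0}"
  shows "holo_into (- {p}) X (laurent_tail p a)"
proof -
  obtain N where N: "\<And>k. k \<ge> N \<Longrightarrow> a k = 0"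
    using assms finite_support_bound by metis
  have "holo_into (- {p}) X (\<lambda>\<sigma>. \<Sum>k<N. (inverse (\<sigma> - p) ^ Suc k) *\<^sub>C a k)"
    using a by (intro holo_into_sum holo_into_scale holo_into_const) (auto intro!: holomorphic_intros)
  then show ?thesis
    by (rule holo_into_cong[rotated]) (auto simp: laurent_tail_eq[OF N])
qed

text \<open>
  Multiplication by \<open>(\<sigma> - p)^(K+1)\<close> turns the tail into a polynomial, and the value of this polynomial
  at \<open>p\<close> is the coefficient of the pole of highest order. Coefficients are detected in this way below.
\<close>

lemma laurent_tail_clear_pole:
  assumes a: "\<And>k. a k \<in> carr X" and K: "\<And>k. k > K \<Longrightarrow> a k = 0"
  obtains W where "holo_into UNIV X W" "W p = a K"
    "\<And>\<sigma>. \<sigma> \<noteq> p \<Longrightarrow> (\<sigma> - p) ^ Suc K *\<^sub>C laurent_tail p a \<sigma> = W \<sigma>"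
proof
  define W where "W \<sigma> = (\<Sum>k<Suc K. (\<sigma> - p) ^ (K - k) *\<^sub>C a k)" for \<sigma>
  show "holo_into UNIV X W"
    unfolding W_def using a
    by (intro holo_into_sum holo_into_scale holo_into_const) (auto intro!: holomorphic_intros)
  have "(\<Sum>k<K. (p - p) ^ (K - k) *\<^sub>C a k) = 0"
    by (intro sum.neutral) (auto simp: power_0_left)
  then show "W p = a K"
    by (simp add: W_def scaleC_one)
  fix \<sigma> :: complex assume \<sigma>: "\<sigma> \<noteq> p"
  have "(\<sigma> - p) ^ Suc K * inverse (\<sigma> - p) ^ Suc k = (\<sigma> - p) ^ (K - k)" if "k < Suc K" for k
  proof -
    have "Suc K = (K - k) + Suc k"
      using that by simp
    then have "(\<sigma> - p) ^ Suc K * inverse (\<sigma> - p) ^ Suc k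
        = (\<sigma> - p) ^ (K - k) * ((\<sigma> - p) * inverse (\<sigma> - p)) ^ Suc k"
      by (simp only: power_add power_mult_distrib mult.assoc)
    then show ?thesis
      using \<sigma> by simp
  qed
  moreover have "laurent_tail p a \<sigma> = (\<Sum>k<Suc K. (inverse (\<sigma> - p) ^ Suc k) *\<^sub>C a k)"
    using K by (intro laurent_tail_eq) auto
  ultimately show "(\<sigma> - p) ^ Suc K *\<^sub>C laurent_tail p a \<sigma> = W \<sigma>"
    by (simp add: W_def complex_vector.scale_sum_right scaleC_scaleC del: power_Suc sum.lessThan_Suc)
qed

lemma holo_eq_at:
  assumes V: "open V" and p: "p \<in> V" and f: "holo_into V X f" and g: "holo_into V X g"
    and eq: "\<And>w. w \<in> V - {p} \<Longrightarrow> f w = g w"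
  shows "f p = g p"
proof -
  let ?d = "\<lambda>w. f w - g w"
  have d: "holo_into V X ?d"
    using holo_into_diff[OF V f g] .
  have dp: "?d p \<in> carr X"
    using holo_into_carr[OF d p] .
  have "((\<lambda>w. hnorm X (?d w - ?d p)) \<longlongrightarrow> 0) (at p)"
    using holo_into_continuous[OF V d p] .
  moreover have "\<forall>\<^sub>F w in at p. hnorm X (?d w - ?d p) = hnorm X (?d p)"
    using eventually_at_in_open[OF V p]
    by eventually_elim (use eq hnorm_minus[OF dp] in auto)
  ultimately have "((\<lambda>w. hnorm X (?d p)) \<longlongrightarrow> 0) (at p)"
    by (simp add: tendsto_cong)
  then have "hnorm X (?d p) = 0"
    by (simp add: tendsto_const_iff)
  then show ?thesis
    using dp by simp
qed

text \<open>
  Otherwise let \<open>a K\<close> be the leading coefficient. After multiplication by \<open>(\<sigma> - p)^(K+1)\<close> the left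
  side tends to \<open>a K\<close> at \<open>p\<close>, while the right side tends to zero.
\<close>

lemma laurent_tail_holomorphic_zero:
  assumes a: "\<And>k. a k \<in> carr X" and fin: "finite {k. a k \<noteq> 0}" and r: "r > 0"
    and h: "holo_into (ball p r) X h" and eq: "\<And>\<sigma>. \<sigma> \<in> ball p r - {p} \<Longrightarrow> laurent_tail p a \<sigma> = h \<sigma>"
  shows "a = (\<lambda>_. 0)"
proof (rule ccontr)
  assume "a \<noteq> (\<lambda>_. 0)"
  then obtain K where K: "a K \<noteq> 0" "\<And>k. k > K \<Longrightarrow> a k = 0"
    using leading_coefficient[OF fin] by metis
  obtain W where W: "holo_into UNIV X W" "W p = a K"
    "\<And>\<sigma>. \<sigma> \<noteq> p \<Longrightarrow> (\<sigma> - p) ^ Suc K *\<^sub>C laurent_tail p a \<sigma> = W \<sigma>"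
    by (rule laurent_tail_clear_pole[of a K p, OF a K(2)]) (assumption, rule that, assumption)
  have "W p = (p - p) ^ Suc K *\<^sub>C h p"
  proof (rule holo_eq_at[where V = "ball p r" and f = W and g = "\<lambda>\<sigma>. (\<sigma> - p) ^ Suc K *\<^sub>C h \<sigma>"])
    show "holo_into (ball p r) X W"
      using W holo_into_subset by blast
    show "holo_into (ball p r) X (\<lambda>\<sigma>. (\<sigma> - p) ^ Suc K *\<^sub>C h \<sigma>)"
      by (intro holo_into_scale h) (auto intro!: holomorphic_intros)
    show "W \<sigma> = (\<sigma> - p) ^ Suc K *\<^sub>C h \<sigma>" if "\<sigma> \<in> ball p r - {p}" for \<sigma>
      using W(3)[of \<sigma>] eq[OF that] that by simp
  qed (use r in auto)
  then show False
    using K W by simp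
qed

lemma principal_part_unique:
  assumes "has_principal_part X f p a" "has_principal_part X f p b"
  shows "a = b"
proof -
  obtain r h where a: "\<And>k. a k \<in> carr X" "finite {k. a k \<noteq> 0}" "0 < r" "holo_into (ball p r) X h"
    "\<And>\<sigma>. \<sigma> \<in> ball p r - {p} \<Longrightarrow> f \<sigma> = h \<sigma> + laurent_tail p a \<sigma>"
    using assms(1) unfolding has_principal_part_def by blast
  obtain s g where b: "\<And>k. b k \<in> carr X" "finite {k. b k \<noteq> 0}" "0 < s" "holo_into (ball p s) X g"
    "\<And>\<sigma>. \<sigma> \<in> ball p s - {p} \<Longrightarrow> f \<sigma> = g \<sigma> + laurent_tail p b \<sigma>"
    using assms(2) unfolding has_principal_part_def by blast
  have fin: "finite {k. a k - b k \<noteq> 0}"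
    by (rule finite_subset[of _ "{k. a k \<noteq> 0} \<union> {k. b k \<noteq> 0}"]) (use a b in auto)
  have "(\<lambda>k. a k - b k) = (\<lambda>_. 0)"
  proof (rule laurent_tail_holomorphic_zero[where r = "min r s" and p = p])
    show "holo_into (ball p (min r s)) X (\<lambda>\<sigma>. g \<sigma> - h \<sigma>)"
      using a b by (intro holo_into_diff) (auto elim: holo_into_subset)
    fix \<sigma> assume "\<sigma> \<in> ball p (min r s) - {p}"
    then have "\<sigma> \<in> ball p r - {p}" "\<sigma> \<in> ball p s - {p}"
      by auto
    then have "h \<sigma> + laurent_tail p a \<sigma> = g \<sigma> + laurent_tail p b \<sigma>"
      using a(5) b(5) by metis
    then show "laurent_tail p (\<lambda>k. a k - b k) \<sigma> = g \<sigma> - h \<sigma>"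
      unfolding laurent_tail_diff[OF a(2) b(2)] by (simp add: algebra_simps)
  qed (use a b fin in auto)
  then show ?thesis
    by (auto simp: fun_eq_iff)
qed

lemma principal_part_eqI: "has_principal_part X f p a \<Longrightarrow> principal_part X f p = a"
  unfolding principal_part_def by (rule the_equality) (auto intro: principal_part_unique)

text \<open>
  The order \<open>N\<close> of the pole is lowered by one in each step: writing \<open>h = h p + (\<sigma> - p) h'\<close>, subtract
  the term \<open>(\<sigma> - p)^(-N) h p\<close> from \<open>f\<close>.
\<close>

lemma principal_part_if_cleared:
  assumes V: "open V" "p \<in> V" and f: "\<And>\<sigma>. \<sigma> \<in> V - {p} \<Longrightarrow> f \<sigma> \<in> carr X"
    and h: "holo_into V X h" "\<And>\<sigma>. \<sigma> \<in> V - {p} \<Longrightarrow> (\<sigma> - p) ^ N *\<^sub>C f \<sigma> = h \<sigma>"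
  shows "\<exists>a g. (\<forall>k. a k \<in> carr X) \<and> (\<forall>k\<ge>N. a k = 0) \<and> holo_into V X g \<and>
    (\<forall>\<sigma>\<in>V - {p}. f \<sigma> = g \<sigma> + laurent_tail p a \<sigma>)"
  using f h
proof (induction N arbitrary: f h)
  case 0
  then show ?case
    by (intro exI[of _ "\<lambda>_. 0"] exI[of _ h]) (auto simp: laurent_tail_def scaleC_one)
next
  case (Suc N)
  obtain h' where h': "holo_into V X h'" "\<And>w. w \<in> V \<Longrightarrow> h w = h p + (w - p) *\<^sub>C h' w"
    using factor_out[OF V Suc.prems(2)] by metis
  have hp: "h p \<in> carr X"
    using holo_into_carr[OF Suc.prems(2) V(2)] .
  define f' where "f' \<sigma> = f \<sigma> - (inverse (\<sigma> - p) ^ Suc N) *\<^sub>C h p" for \<sigma>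
  have "\<exists>a g. (\<forall>k. a k \<in> carr X) \<and> (\<forall>k\<ge>N. a k = 0) \<and> holo_into V X g \<and>
    (\<forall>\<sigma>\<in>V - {p}. f' \<sigma> = g \<sigma> + laurent_tail p a \<sigma>)"
  proof (rule Suc.IH)
    show "f' \<sigma> \<in> carr X" if "\<sigma> \<in> V - {p}" for \<sigma>
      using Suc.prems(1)[OF that] hp by (simp add: f'_def)
    fix \<sigma> assume \<sigma>: "\<sigma> \<in> V - {p}"
    then have nz: "\<sigma> - p \<noteq> 0" and \<sigma>V: "\<sigma> \<in> V"
      by auto
    have "(\<sigma> - p) *\<^sub>C ((\<sigma> - p) ^ N *\<^sub>C f' \<sigma>) = (\<sigma> - p) ^ Suc N *\<^sub>C f \<sigma> -
        ((\<sigma> - p) ^ Suc N * inverse (\<sigma> - p) ^ Suc N) *\<^sub>C h p"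
      by (simp add: f'_def complex_vector.scale_right_diff_distrib scaleC_scaleC mult.assoc)
    also have "(\<sigma> - p) ^ Suc N * inverse (\<sigma> - p) ^ Suc N = 1"
      using nz by (simp only: power_mult_distrib[symmetric]) simp
    also have "(\<sigma> - p) ^ Suc N *\<^sub>C f \<sigma> - 1 *\<^sub>C h p = (\<sigma> - p) *\<^sub>C h' \<sigma>"
      unfolding Suc.prems(3)[OF \<sigma>] h'(2)[OF \<sigma>V] by (simp add: scaleC_one)
    finally have "inverse (\<sigma> - p) *\<^sub>C ((\<sigma> - p) *\<^sub>C ((\<sigma> - p) ^ N *\<^sub>C f' \<sigma>))
        = inverse (\<sigma> - p) *\<^sub>C ((\<sigma> - p) *\<^sub>C h' \<sigma>)"
      by simp
    then show "(\<sigma> - p) ^ N *\<^sub>C f' \<sigma> = h' \<sigma>"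
      using nz by (simp add: scaleC_scaleC[of "inverse (\<sigma> - p)" "\<sigma> - p"] scaleC_one del: scaleC_scaleC)
  qed (rule h')
  then obtain a g where ag: "\<And>k. a k \<in> carr X" "\<And>k. k \<ge> N \<Longrightarrow> a k = 0" "holo_into V X g"
    "\<And>\<sigma>. \<sigma> \<in> V - {p} \<Longrightarrow> f' \<sigma> = g \<sigma> + laurent_tail p a \<sigma>"
    by metis
  define b where "b = a(N := h p)"
  have "laurent_tail p b \<sigma> = laurent_tail p a \<sigma> + (inverse (\<sigma> - p) ^ Suc N) *\<^sub>C h p" for \<sigma>
  proof -
    have "laurent_tail p b \<sigma> = (\<Sum>k<Suc N. (inverse (\<sigma> - p) ^ Suc k) *\<^sub>C b k)"
      by (rule laurent_tail_eq) (use ag in \<open>auto simp: b_def\<close>)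
    also have "\<dots> = (\<Sum>k<N. (inverse (\<sigma> - p) ^ Suc k) *\<^sub>C a k) + (inverse (\<sigma> - p) ^ Suc N) *\<^sub>C h p"
      by (simp add: b_def)
    also have "(\<Sum>k<N. (inverse (\<sigma> - p) ^ Suc k) *\<^sub>C a k) = laurent_tail p a \<sigma>"
      using ag by (intro laurent_tail_eq[symmetric]) auto
    finally show ?thesis .
  qed
  then have "f \<sigma> = g \<sigma> + laurent_tail p b \<sigma>" if "\<sigma> \<in> V - {p}" for \<sigma>
    using ag(4)[OF that] by (simp add: f'_def algebra_simps)
  moreover have "\<forall>k. b k \<in> carr X" "\<forall>k\<ge>Suc N. b k = 0"
    using ag hp by (auto simp: b_def)
  ultimately show ?case
    using ag(3) by blast
qed

lemma principal_part_if_bounded: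
  assumes V: "open V" "p \<in> V" and f: "holo_into (V - {p}) X f"
    and bdd: "\<forall>\<^sub>F \<sigma> in at p. cmod (\<sigma> - p) ^ N * hnorm X (f \<sigma>) \<le> M"
  shows "\<exists>a. has_principal_part X f p a"
proof -
  have V': "open (V - {p})"
    using V by blast
  note fc = holo_into_carr[OF f]
  have 1: "holo_into (V - {p}) X (\<lambda>\<sigma>. (\<sigma> - p) ^ N *\<^sub>C f \<sigma>)"
    by (intro holo_into_scale f V') (auto intro!: holomorphic_intros)
  have 2: "\<forall>\<^sub>F \<sigma> in at p. hnorm X ((\<sigma> - p) ^ N *\<^sub>C f \<sigma>) \<le> M"
    using bdd eventually_at_in_open[OF V]
    by eventually_elim (use fc in \<open>auto simp: norm_power\<close>)
  obtain h where h: "holo_into V X h" "\<And>w. w \<in> V - {p} \<Longrightarrow> h w = (w - p) ^ N *\<^sub>C f w"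
    by (rule removable_singularity[OF V 1 2]) (rule that; assumption)
  have "\<exists>a g. (\<forall>k. a k \<in> carr X) \<and> (\<forall>k\<ge>N. a k = 0) \<and> holo_into V X g \<and>
    (\<forall>\<sigma>\<in>V - {p}. f \<sigma> = g \<sigma> + laurent_tail p a \<sigma>)"
    by (rule principal_part_if_cleared[OF V fc h(1)]) (auto simp: h(2))
  then obtain a g where ag: "\<And>k. a k \<in> carr X" "\<And>k. k \<ge> N \<Longrightarrow> a k = 0" "holo_into V X g"
    "\<And>\<sigma>. \<sigma> \<in> V - {p} \<Longrightarrow> f \<sigma> = g \<sigma> + laurent_tail p a \<sigma>"
    by (elim exE conjE) (rule that; auto)
  obtain r where r: "r > 0" "ball p r \<subseteq> V"
    using V open_contains_ball by metis
  have "finite {k. a k \<noteq> 0}"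
  proof (rule finite_subset)
    show "{k. a k \<noteq> 0} \<subseteq> {..<N}"
      using ag(2) not_less by blast
  qed simp
  moreover have "holo_into (ball p r) X g"
    using ag(3) r(2) by (rule holo_into_subset)
  moreover have "\<forall>\<sigma>\<in>ball p r - {p}. f \<sigma> = g \<sigma> + laurent_tail p a \<sigma>"
    using ag(4) r by blast
  ultimately show ?thesis
    unfolding has_principal_part_def using ag(1) r(1)
    by (intro exI[of _ a] conjI allI exI[of _ r] exI[of _ g])
qed

end

section \<open>Holomorphic families of bounded operators\<close>

lemma holo_family_subset: "holo_family V X Y T \<Longrightarrow> U \<subseteq> V \<Longrightarrow> holo_family U X Y T"
  unfolding holo_family_def by (meson subsetD)

context two_hilb
begin

lemma holo_family_bounded_op: "holo_family V X Y T \<Longrightarrow> z \<in> V \<Longrightarrow> bounded_op X Y (T z)"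
  by (simp add: holo_family_def)

lemma holo_family_linear: "holo_family V X Y T \<Longrightarrow> z \<in> V \<Longrightarrow> linear_op (T z)"
  by (simp add: holo_family_def bounded_op_def)

lemma holo_family_const:
  assumes "bounded_op X Y B"
  shows "holo_family V X Y (\<lambda>_. B)"
  unfolding holo_family_def
proof (intro conjI ballI assms)
  show "\<exists>Q. bounded_op X Y Q \<and> (\<forall>e>0. \<exists>d>0. \<forall>w\<in>V. cmod (w - z) < d \<longrightarrow>
      (\<forall>u\<in>carr X. hnorm Y (B u - B u - (w - z) *\<^sub>C Q u) \<le> e * cmod (w - z) * hnorm X u))" for z
    by (intro exI[of _ "\<lambda>_. 0"])
      (auto simp: bounded_op_def clinear_between_def intro!: exI[of _ 0] exI[of _ 1])
qed

text \<open>
  Differentiability in operator norm is used through three consequences near \<open>z\<close>: a uniform bound, a Lipschitz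
  bound, and the derivative of \<open>T w u\<close> for each fixed vector \<open>u\<close>.
\<close>

lemma holo_familyE:
  assumes V: "open V" and T: "holo_family V X Y T" and z: "z \<in> V"
  obtains Q L d where "bounded_op X Y Q" "L \<ge> 0" "d > 0" "ball z d \<subseteq> V"
    "\<And>w u. w \<in> ball z d \<Longrightarrow> u \<in> carr X \<Longrightarrow> hnorm Y (T w u) \<le> L * hnorm X u"
    "\<And>w u. w \<in> ball z d \<Longrightarrow> u \<in> carr X \<Longrightarrow> hnorm Y (T w u - T z u) \<le> L * cmod (w - z) * hnorm X u"
    "\<And>u. u \<in> carr X \<Longrightarrow> hderiv Y (\<lambda>w. T w u) (Q u) z"
proof -
  obtain Q where Q: "bounded_op X Y Q"
    and diff: "\<And>e. e > 0 \<Longrightarrow> \<exists>d>0. \<forall>w\<in>V. cmod (w - z) < d \<longrightarrow>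
      (\<forall>u\<in>carr X. hnorm Y (T w u - T z u - (w - z) *\<^sub>C Q u) \<le> e * cmod (w - z) * hnorm X u)"
    using T z unfolding holo_family_def by blast
  obtain CQ where CQ: "CQ \<ge> 0" "\<And>u. u \<in> carr X \<Longrightarrow> hnorm Y (Q u) \<le> CQ * hnorm X u"
    using bounded_opE[OF Q] by blast
  obtain CT where CT: "CT \<ge> 0" "\<And>u. u \<in> carr X \<Longrightarrow> hnorm Y (T z u) \<le> CT * hnorm X u"
    using bounded_opE[OF holo_family_bounded_op[OF T z]] by blast
  have Tc: "T w u \<in> carr Y" if "w \<in> V" "u \<in> carr X" for w u
    using holo_family_linear[OF T that(1)] that by blast
  have Qc: "Q u \<in> carr Y" if "u \<in> carr X" for u
    using bounded_op_linear[OF Q] that by blast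
  obtain d1 where d1: "d1 > 0" "\<And>w u. w \<in> V \<Longrightarrow> cmod (w - z) < d1 \<Longrightarrow> u \<in> carr X \<Longrightarrow>
      hnorm Y (T w u - T z u - (w - z) *\<^sub>C Q u) \<le> 1 * cmod (w - z) * hnorm X u"
    using diff[of 1] by auto
  obtain d2 where d2: "d2 > 0" "ball z d2 \<subseteq> V"
    using V z open_contains_ball by metis
  define d where "d = min 1 (min d1 d2)"
  define L where "L = CT + CQ + 1"
  have "d > 0" "L \<ge> 0" "ball z d \<subseteq> V"
    using d1 d2 CT CQ by (auto simp: d_def L_def)
  have lip: "hnorm Y (T w u - T z u) \<le> (CQ + 1) * cmod (w - z) * hnorm X u"
    if w: "w \<in> ball z d" and u: "u \<in> carr X" for w u
  proof -
    have wV: "w \<in> V" "cmod (w - z) < d1"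
      using w d2 by (auto simp: d_def dist_norm norm_minus_commute)
    have "hnorm Y (T w u - T z u)
        \<le> hnorm Y (T w u - T z u - (w - z) *\<^sub>C Q u) + hnorm Y ((w - z) *\<^sub>C Q u)"
      using Y.hnorm_triangle[of "T w u - T z u - (w - z) *\<^sub>C Q u" "(w - z) *\<^sub>C Q u"]
        Tc[OF wV(1) u] Tc[OF z u] Qc[OF u] by simp
    also have "\<dots> \<le> 1 * cmod (w - z) * hnorm X u + cmod (w - z) * (CQ * hnorm X u)"
      using d1(2)[OF wV u] CQ(2)[OF u] Qc[OF u] by (intro add_mono) (auto intro: mult_left_mono)
    finally show ?thesis
      by (simp add: algebra_simps)
  qed
  have 1: "hnorm Y (T w u - T z u) \<le> L * cmod (w - z) * hnorm X u"
    if w: "w \<in> ball z d" and u: "u \<in> carr X" for w u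
  proof -
    have "(CQ + 1) * cmod (w - z) * hnorm X u \<le> L * cmod (w - z) * hnorm X u"
      using CT u by (intro mult_right_mono) (auto simp: L_def)
    then show ?thesis
      using lip[OF w u] by linarith
  qed
  have 2: "hnorm Y (T w u) \<le> L * hnorm X u" if w: "w \<in> ball z d" and u: "u \<in> carr X" for w u
  proof -
    have wV: "w \<in> V" and w1: "cmod (w - z) \<le> 1"
      using w d2 by (auto simp: d_def dist_norm norm_minus_commute)
    have "hnorm Y (T w u) \<le> hnorm Y (T w u - T z u) + hnorm Y (T z u)"
      using Y.hnorm_reverse[OF Tc[OF wV u] Tc[OF z u]] by simp
    also have "\<dots> \<le> (CQ + 1) * 1 * hnorm X u + CT * hnorm X u"
    proof (intro add_mono CT(2)[OF u])
      have "(CQ + 1) * cmod (w - z) * hnorm X u \<le> (CQ + 1) * 1 * hnorm X u"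
        using w1 CQ(1) u by (intro mult_right_mono mult_left_mono) auto
      then show "hnorm Y (T w u - T z u) \<le> (CQ + 1) * 1 * hnorm X u"
        using lip[OF w u] by linarith
    qed
    finally show ?thesis
      by (simp add: L_def algebra_simps)
  qed
  have 3: "hderiv Y (\<lambda>w. T w u) (Q u) z" if u: "u \<in> carr X" for u
    unfolding hderiv_def
  proof
    show "Q u \<in> carr Y"
      using Qc u .
    show "((\<lambda>w. hnorm Y (inverse (w - z) *\<^sub>C (T w u - T z u) - Q u)) \<longlongrightarrow> 0) (at z)"
    proof (rule tendstoI)
      fix e :: real assume e: "e > 0"
      define e' where "e' = e / (hnorm X u + 1)"
      have nu: "hnorm X u + 1 > 0"
        using u by (simp add: add_nonneg_pos)
      have e': "e' > 0"
        using e nu by (simp add: e'_def)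
      obtain d3 where d3: "d3 > 0" "\<And>w. w \<in> V \<Longrightarrow> cmod (w - z) < d3 \<Longrightarrow>
          hnorm Y (T w u - T z u - (w - z) *\<^sub>C Q u) \<le> e' * cmod (w - z) * hnorm X u"
        using diff[OF e'] u by blast
      have "\<forall>\<^sub>F w in at z. w \<in> ball z d3 - {z}"
        using d3 by (intro eventually_at_in_open) auto
      with eventually_at_in_open[OF V z]
      show "\<forall>\<^sub>F w in at z. dist (hnorm Y (inverse (w - z) *\<^sub>C (T w u - T z u) - Q u)) 0 < e"
      proof eventually_elim
        case (elim w)
        then have w: "w \<in> V" "cmod (w - z) < d3" "w - z \<noteq> 0"
          by (auto simp: dist_norm norm_minus_commute)
        have eq: "inverse (w - z) *\<^sub>C (T w u - T z u) - Q u
            = inverse (w - z) *\<^sub>C (T w u - T z u - (w - z) *\<^sub>C Q u)"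
          using w by (simp add: complex_vector.scale_right_diff_distrib scaleC_scaleC scaleC_one)
        have "hnorm Y (inverse (w - z) *\<^sub>C (T w u - T z u) - Q u)
            = inverse (cmod (w - z)) * hnorm Y (T w u - T z u - (w - z) *\<^sub>C Q u)"
          unfolding eq using Tc[OF w(1) u] Tc[OF z u] Qc[OF u] by (simp add: norm_inverse)
        also have "\<dots> \<le> inverse (cmod (w - z)) * (e' * cmod (w - z) * hnorm X u)"
          using d3(2)[OF w(1,2)] by (intro mult_left_mono) auto
        also have "\<dots> = e' * hnorm X u"
          using w by simp
        also have "\<dots> < e' * (hnorm X u + 1)"
          using e' by simp
        also have "\<dots> = e"
          using nu by (simp add: e'_def)
        finally show ?case
          using Tc[OF w(1) u] Tc[OF z u] Qc[OF u] by simp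
      qed
    qed
  qed
  from that[OF Q \<open>L \<ge> 0\<close> \<open>d > 0\<close> \<open>ball z d \<subseteq> V\<close> 2 1 3] show ?thesis .
qed

lemma holo_family_apply:
  assumes V: "open V" and T: "holo_family V X Y T" and f: "holo_into V X f"
  shows "holo_into V Y (\<lambda>w. T w (f w))"
  unfolding holo_into_open[OF V]
proof (intro conjI ballI)
  have Tc: "T w u \<in> carr Y" if "w \<in> V" "u \<in> carr X" for w u
    using holo_family_linear[OF T that(1)] that by blast
  note fc = holo_into_carr[OF f]
  show "T z (f z) \<in> carr Y" if "z \<in> V" for z
    using Tc fc that by blast
  fix z assume z: "z \<in> V"
  obtain Q L \<delta> where Q: "bounded_op X Y Q" "L \<ge> 0" "\<delta> > 0" "ball z \<delta> \<subseteq> V"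
    and bd: "\<And>w u. w \<in> ball z \<delta> \<Longrightarrow> u \<in> carr X \<Longrightarrow> hnorm Y (T w u) \<le> L * hnorm X u"
    and lip: "\<And>w u. w \<in> ball z \<delta> \<Longrightarrow> u \<in> carr X \<Longrightarrow> hnorm Y (T w u - T z u) \<le> L * cmod (w - z) * hnorm X u"
    and der: "\<And>u. u \<in> carr X \<Longrightarrow> hderiv Y (\<lambda>w. T w u) (Q u) z"
    using holo_familyE[OF V T z] by metis
  obtain d where d: "hderiv X f d z"
    using f V z by (auto simp: holo_into_open)
  then have dc: "d \<in> carr X"
    by (simp add: hderiv_def)
  have Qc: "Q (f z) \<in> carr Y"
    using bounded_op_linear[OF Q(1)] fc[OF z] by blast
  let ?Df = "\<lambda>w. inverse (w - z) *\<^sub>C (f w - f z)"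
  let ?DT = "\<lambda>w. inverse (w - z) *\<^sub>C (T w (f z) - T z (f z))"
  have "hderiv Y (\<lambda>w. T w (f w)) (T z d + Q (f z)) z"
    unfolding hderiv_def
  proof (rule conjI[OF _ tendsto_zero_boundI])
    show "T z d + Q (f z) \<in> carr Y"
      using Tc[OF z dc] Qc by blast
    have "((\<lambda>w. L * hnorm X (?Df w - d) + hnorm Y (?DT w - Q (f z)) + L * cmod (w - z) * hnorm X d)
        \<longlongrightarrow> L * 0 + 0 + L * cmod (z - z) * hnorm X d) (at z)"
      using d der[OF fc[OF z]] unfolding hderiv_def by (intro tendsto_intros) auto
    then show "((\<lambda>w. L * hnorm X (?Df w - d) + hnorm Y (?DT w - Q (f z)) + L * cmod (w - z) * hnorm X d)
        \<longlongrightarrow> 0) (at z)"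
      by simp
    have ev: "\<forall>\<^sub>F w in at z. w \<in> ball z \<delta> - {z}"
      using Q by (intro eventually_at_in_open) auto
    show "\<forall>\<^sub>F w in at z. 0 \<le> hnorm Y (inverse (w - z) *\<^sub>C (T w (f w) - T z (f z)) - (T z d + Q (f z)))"
      using ev by eventually_elim
        (use Q(4) Tc fc z dc Qc in \<open>auto intro!: Y.hnorm_nonneg Y.carr_diff Y.carr_scale Y.carr_add\<close>)
    show "\<forall>\<^sub>F w in at z. hnorm Y (inverse (w - z) *\<^sub>C (T w (f w) - T z (f z)) - (T z d + Q (f z)))
        \<le> L * hnorm X (?Df w - d) + hnorm Y (?DT w - Q (f z)) + L * cmod (w - z) * hnorm X d"
      using ev
    proof eventually_elim
      case (elim w)
      then have w: "w \<in> ball z \<delta>" "w \<in> V"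
        using Q by auto
      note lin = holo_family_linear[OF T w(2)]
      have Dfc: "?Df w - d \<in> carr X"
        using fc w z dc by simp
      have DTc: "?DT w - Q (f z) \<in> carr Y"
        using Tc w z fc Qc by simp
      have lipc: "T w d - T z d \<in> carr Y"
        using Tc w z dc by simp
      have "T w (?Df w - d) = inverse (w - z) *\<^sub>C (T w (f w) - T w (f z)) - T w d"
        using lin fc w z dc by (simp add: linear_diff linear_scale)
      then have "inverse (w - z) *\<^sub>C (T w (f w) - T z (f z)) - (T z d + Q (f z))
          = T w (?Df w - d) + (?DT w - Q (f z)) + (T w d - T z d)"
        by (simp add: complex_vector.scale_right_diff_distrib)
      also have "hnorm Y \<dots> \<le> hnorm Y (T w (?Df w - d)) + hnorm Y (?DT w - Q (f z)) + hnorm Y (T w d - T z d)"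
        using Y.hnorm_triangle[of "T w (?Df w - d) + (?DT w - Q (f z))" "T w d - T z d"]
          Y.hnorm_triangle[of "T w (?Df w - d)" "?DT w - Q (f z)"] Tc[OF w(2) Dfc] DTc lipc by fastforce
      also have "\<dots> \<le> L * hnorm X (?Df w - d) + hnorm Y (?DT w - Q (f z)) + L * cmod (w - z) * hnorm X d"
        by (intro add_mono bd lip order_refl w Dfc dc)
      finally show ?case .
    qed
  qed
  then show "\<exists>d. hderiv Y (\<lambda>w. T w (f w)) d z"
    by blast
qed

text \<open>
  Subtracting the equations at \<open>w\<close> and \<open>z\<close> gives \<open>T w (x w - x z) = (g w - g z) - (T w - T z) (x z)\<close>. The
  quotient of the right side by \<open>w - z\<close> converges, and the locally uniform lower bound for \<open>T w\<close> carries the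
  convergence over to \<open>x\<close>; the derivative \<open>d\<close> of \<open>x\<close> solves \<open>T z d = y' - Q (x z)\<close>.
\<close>

lemma holo_solution:
  assumes V: "open V" and T: "holo_family V X Y T" and g: "holo_into V Y g"
    and x: "\<And>w. w \<in> V \<Longrightarrow> x w \<in> carr X" "\<And>w. w \<in> V \<Longrightarrow> T w (x w) = g w"
    and surj: "\<And>w y. w \<in> V \<Longrightarrow> y \<in> carr Y \<Longrightarrow> \<exists>u\<in>carr X. T w u = y"
    and below: "\<And>z. z \<in> V \<Longrightarrow> \<exists>K. \<forall>\<^sub>F w in nhds z. \<forall>u\<in>carr X. hnorm X u \<le> K * hnorm Y (T w u)"
  shows "holo_into V X x"
  unfolding holo_into_open[OF V]
proof (intro conjI ballI)
  have Tc: "T w u \<in> carr Y" if "w \<in> V" "u \<in> carr X" for w u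
    using holo_family_linear[OF T that(1)] that by blast
  note gc = holo_into_carr[OF g]
  show "x z \<in> carr X" if "z \<in> V" for z
    using x that by blast
  fix z assume z: "z \<in> V"
  obtain Q L \<delta> where Q: "bounded_op X Y Q" "L \<ge> 0" "\<delta> > 0" "ball z \<delta> \<subseteq> V"
    and lip: "\<And>w u. w \<in> ball z \<delta> \<Longrightarrow> u \<in> carr X \<Longrightarrow> hnorm Y (T w u - T z u) \<le> L * cmod (w - z) * hnorm X u"
    and der: "\<And>u. u \<in> carr X \<Longrightarrow> hderiv Y (\<lambda>w. T w u) (Q u) z"
    using holo_familyE[OF V T z] by metis
  obtain K0 where K0: "\<forall>\<^sub>F w in nhds z. \<forall>u\<in>carr X. hnorm X u \<le> K0 * hnorm Y (T w u)"
    using below[OF z] by blast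
  define K where "K = max K0 0"
  have K: "K \<ge> 0"
    by (simp add: K_def)
  have evK: "\<forall>\<^sub>F w in at z. \<forall>u\<in>carr X. hnorm X u \<le> K0 * hnorm Y (T w u)"
    using K0 by (simp add: eventually_at_filter eventually_mono)
  obtain y' where y': "hderiv Y g y' z"
    using g V z by (auto simp: holo_into_open)
  have xz: "x z \<in> carr X"
    using x z by blast
  have Qc: "Q (x z) \<in> carr Y"
    using bounded_op_linear[OF Q(1)] xz by blast
  have y'c: "y' \<in> carr Y"
    using y' by (simp add: hderiv_def)
  obtain d where d: "d \<in> carr X" "T z d = y' - Q (x z)"
    using surj[OF z, of "y' - Q (x z)"] y'c Qc by blast
  let ?Dx = "\<lambda>w. inverse (w - z) *\<^sub>C (x w - x z)"
  let ?Dg = "\<lambda>w. inverse (w - z) *\<^sub>C (g w - g z)"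
  let ?DT = "\<lambda>w. inverse (w - z) *\<^sub>C (T w (x z) - T z (x z))"
  have "hderiv X x d z"
    unfolding hderiv_def
  proof (rule conjI[OF _ tendsto_zero_boundI])
    show "d \<in> carr X"
      using d by blast
    have "((\<lambda>w. K * (hnorm Y (?Dg w - y') + hnorm Y (?DT w - Q (x z)) + L * cmod (w - z) * hnorm X d))
        \<longlongrightarrow> K * (0 + 0 + L * cmod (z - z) * hnorm X d)) (at z)"
      using y' der[OF xz] unfolding hderiv_def by (intro tendsto_intros) auto
    then show "((\<lambda>w. K * (hnorm Y (?Dg w - y') + hnorm Y (?DT w - Q (x z)) + L * cmod (w - z) * hnorm X d))
        \<longlongrightarrow> 0) (at z)"
      by simp
    have ev: "\<forall>\<^sub>F w in at z. w \<in> ball z \<delta> - {z}"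
      using Q by (intro eventually_at_in_open) auto
    show "\<forall>\<^sub>F w in at z. 0 \<le> hnorm X (?Dx w - d)"
      using ev by eventually_elim (use Q(4) x z d in \<open>auto intro!: X.hnorm_nonneg X.carr_diff X.carr_scale\<close>)
    show "\<forall>\<^sub>F w in at z. hnorm X (?Dx w - d)
        \<le> K * (hnorm Y (?Dg w - y') + hnorm Y (?DT w - Q (x z)) + L * cmod (w - z) * hnorm X d)"
      using ev evK
    proof eventually_elim
      case (elim w)
      then have w: "w \<in> ball z \<delta>" "w \<in> V"
        using Q by auto
      note lin = holo_family_linear[OF T w(2)]
      have Dxc: "?Dx w - d \<in> carr X"
        using x w z d by simp
      have DTc: "?DT w - Q (x z) \<in> carr Y"
        using Tc w z xz Qc by simp
      have Dgc: "?Dg w - y' \<in> carr Y"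
        using gc w z y'c by simp
      have lipc: "T w d - T z d \<in> carr Y"
        using Tc w z d(1) by simp
      have "T w (?Dx w - d) = inverse (w - z) *\<^sub>C (T w (x w) - T w (x z)) - T w d"
        using lin x(1) w z d by (simp add: linear_diff linear_scale)
      also have "\<dots> = (?Dg w - y') - (?DT w - Q (x z)) - (T w d - T z d)"
        using d(2) x(2) w z by (simp add: complex_vector.scale_right_diff_distrib)
      finally have eq: "T w (?Dx w - d) = (?Dg w - y') - (?DT w - Q (x z)) - (T w d - T z d)" .
      have "hnorm X (?Dx w - d) \<le> K0 * hnorm Y (T w (?Dx w - d))"
        using elim Dxc by blast
      also have "\<dots> \<le> K * hnorm Y (T w (?Dx w - d))"
        using Tc[OF w(2) Dxc] by (intro mult_right_mono) (auto simp: K_def)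
      also have "hnorm Y (T w (?Dx w - d))
          \<le> hnorm Y (?Dg w - y') + hnorm Y (?DT w - Q (x z)) + hnorm Y (T w d - T z d)"
        unfolding eq
        using Y.hnorm_triangle_diff[of "(?Dg w - y') - (?DT w - Q (x z))" "T w d - T z d"]
          Y.hnorm_triangle_diff[of "?Dg w - y'" "?DT w - Q (x z)"] Dgc DTc lipc by fastforce
      also have "hnorm Y (T w d - T z d) \<le> L * cmod (w - z) * hnorm X d"
        by (intro lip w d)
      finally show ?case
        using K by (simp add: mult_left_mono)
    qed
  qed
  then show "\<exists>d. hderiv X x d z"
    by blast
qed

lemma holo_family_restrict_compose:
  assumes T: "holo_family V X Y T" and M: "csubspace M" "M \<subseteq> carr X"
    and B: "bounded_op Y Z B" and Z: "hilb Z"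
  shows "holo_family V (restrict_space_to X M) Z (\<lambda>\<sigma> u. B (T \<sigma> u))"
proof -
  interpret Z: two_hilb Y Z
    using Z by unfold_locales (auto simp: hilb_def)
  obtain C where C: "C \<ge> 0" "\<And>u. u \<in> carr Y \<Longrightarrow> hnorm Z (B u) \<le> C * hnorm Y u"
    using Z.bounded_opE[OF B] by blast
  note Blin = Z.bounded_op_linear[OF B]
  have comp: "bounded_op (restrict_space_to X M) Z (\<lambda>u. B (Q u))" if Q: "bounded_op X Y Q" for Q
  proof -
    obtain D where D: "D \<ge> 0" "\<And>u. u \<in> carr X \<Longrightarrow> hnorm Y (Q u) \<le> D * hnorm X u"
      using bounded_opE[OF Q] by blast
    note Qlin = bounded_op_linear[OF Q]
    have "hnorm Z (B (Q u)) \<le> (C * D) * hnorm X u" if "u \<in> carr X" for u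
    proof -
      have "hnorm Z (B (Q u)) \<le> C * hnorm Y (Q u)"
        using C(2) Qlin that by blast
      also have "\<dots> \<le> C * (D * hnorm X u)"
        using C(1) D(2)[OF that] by (rule mult_left_mono[rotated])
      finally show ?thesis
        by simp
    qed
    then show ?thesis
      unfolding bounded_op_def restrict_space_to_simps clinear_between_def
      using M(2) Qlin Blin
      by (intro conjI ballI allI exI[of _ "C * D"])
        (auto simp: subset_iff linear_add linear_scale Z.linear_add Z.linear_scale linear_carr Z.linear_carr)
  qed
  show ?thesis
    unfolding holo_family_def
  proof (intro conjI ballI)
    show "bounded_op (restrict_space_to X M) Z (\<lambda>u. B (T z u))" if "z \<in> V" for z
      using comp holo_family_bounded_op[OF T that] .
    fix z assume z: "z \<in> V"
    obtain Q where Q: "bounded_op X Y Q"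
      and diff: "\<And>e. e > 0 \<Longrightarrow> \<exists>d>0. \<forall>w\<in>V. cmod (w - z) < d \<longrightarrow>
        (\<forall>u\<in>carr X. hnorm Y (T w u - T z u - (w - z) *\<^sub>C Q u) \<le> e * cmod (w - z) * hnorm X u)"
      using T z unfolding holo_family_def by blast
    note Qlin = bounded_op_linear[OF Q]
    show "\<exists>Q. bounded_op (restrict_space_to X M) Z Q \<and> (\<forall>e>0. \<exists>d>0. \<forall>w\<in>V. cmod (w - z) < d \<longrightarrow>
        (\<forall>u\<in>carr (restrict_space_to X M). hnorm Z (B (T w u) - B (T z u) - (w - z) *\<^sub>C Q u)
          \<le> e * cmod (w - z) * hnorm (restrict_space_to X M) u))"
    proof (intro exI[of _ "\<lambda>u. B (Q u)"] conjI comp Q allI impI)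
      fix e :: real assume e: "e > 0"
      have e': "e / (C + 1) > 0"
        using e C by simp
      obtain d where d: "d > 0" "\<And>w u. w \<in> V \<Longrightarrow> cmod (w - z) < d \<Longrightarrow> u \<in> carr X \<Longrightarrow>
          hnorm Y (T w u - T z u - (w - z) *\<^sub>C Q u) \<le> e / (C + 1) * cmod (w - z) * hnorm X u"
        using diff[OF e'] by blast
      have "hnorm Z (B (T w u) - B (T z u) - (w - z) *\<^sub>C B (Q u)) \<le> e * cmod (w - z) * hnorm X u"
        if w: "w \<in> V" "cmod (w - z) < d" and u: "u \<in> carr X" for w u
      proof -
        have Tc: "T w u \<in> carr Y" "T z u \<in> carr Y" "Q u \<in> carr Y"
          using holo_family_linear[OF T w(1)] holo_family_linear[OF T z] Qlin u by auto
        have "B (T w u) - B (T z u) - (w - z) *\<^sub>C B (Q u) = B (T w u - T z u - (w - z) *\<^sub>C Q u)"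
          using Tc Blin by (simp add: Z.linear_diff Z.linear_scale)
        then have "hnorm Z (B (T w u) - B (T z u) - (w - z) *\<^sub>C B (Q u))
            \<le> C * hnorm Y (T w u - T z u - (w - z) *\<^sub>C Q u)"
          using C(2)[of "T w u - T z u - (w - z) *\<^sub>C Q u"] Tc by simp
        also have "\<dots> \<le> C * (e / (C + 1) * cmod (w - z) * hnorm X u)"
          using d(2)[OF w u] C(1) by (rule mult_left_mono)
        also have "\<dots> = (C / (C + 1)) * (e * cmod (w - z) * hnorm X u)"
          by simp
        also have "\<dots> \<le> 1 * (e * cmod (w - z) * hnorm X u)"
          using C(1) e u by (intro mult_right_mono) auto
        finally show ?thesis by simp
      qed
      then show "\<exists>d>0. \<forall>w\<in>V. cmod (w - z) < d \<longrightarrow>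
        (\<forall>u\<in>carr (restrict_space_to X M). hnorm Z (B (T w u) - B (T z u) - (w - z) *\<^sub>C B (Q u))
          \<le> e * cmod (w - z) * hnorm (restrict_space_to X M) u)"
        using d(1) M(2) by (intro exI[of _ d]) auto
    qed
  qed
qed

end

section \<open>Independent holomorphic vectors\<close>

context hilb
begin

text \<open>
  If \<open>w - p\<close> could be factored out of \<open>f\<close> arbitrarily often, then so it could from the scalar function
  \<open>(f, f q)\<close>, which is not identically zero and therefore has at most a zero of finite order at \<open>p\<close>.
\<close>

lemma factor_out_order:
  assumes r: "r > 0" and f: "holo_into (ball p r) X f" and q: "q \<in> ball p r" "f q \<noteq> 0"
  shows "\<exists>n g. holo_into (ball p r) X g \<and> g p \<noteq> 0 \<and>
    (\<forall>w\<in>ball p r. f w = (w - p) ^ n *\<^sub>C g w)"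
proof (rule ccontr)
  assume contr: "\<not> ?thesis"
  have none: "g p = 0" if "holo_into (ball p r) X g"
    "\<And>w. w \<in> ball p r \<Longrightarrow> f w = (w - p) ^ n *\<^sub>C g w" for g n
  proof (rule ccontr)
    assume "g p \<noteq> 0"
    with that have "\<exists>n g. holo_into (ball p r) X g \<and> g p \<noteq> 0 \<and>
        (\<forall>w\<in>ball p r. f w = (w - p) ^ n *\<^sub>C g w)"
      by (intro exI[of _ n] exI[of _ g]) simp
    then show False
      using contr by simp
  qed
  have pr: "p \<in> ball p r"
    using r by simp
  have fq: "f q \<in> carr X"
    using holo_into_carr[OF f q(1)] .
  have div: "\<exists>g. holo_into (ball p r) X g \<and> (\<forall>w\<in>ball p r. f w = (w - p) ^ n *\<^sub>C g w)" for n
  proof (induction n)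
    case 0
    then show ?case
      using f by (auto simp: scaleC_one)
  next
    case (Suc n)
    then obtain g where g: "holo_into (ball p r) X g" "\<And>w. w \<in> ball p r \<Longrightarrow> f w = (w - p) ^ n *\<^sub>C g w"
      by (elim exE conjE) (rule that, assumption, drule (1) bspec, assumption)
    obtain h where h: "holo_into (ball p r) X h" "\<And>w. w \<in> ball p r \<Longrightarrow> g w = g p + (w - p) *\<^sub>C h w"
      by (rule factor_out[OF open_ball pr g(1)]) (rule that; assumption)
    have "f w = (w - p) ^ Suc n *\<^sub>C h w" if "w \<in> ball p r" for w
      using g(2)[OF that] h(2)[OF that] none[OF g]
      by (simp add: scaleC_scaleC mult.commute)
    then show ?case
      using h(1) by (intro exI[of _ h]) simp
  qed
  define F where "F w = ip X (f w) (f q)" for w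
  have F: "F holomorphic_on ball p r"
    unfolding F_def by (rule holo_into_ip[OF open_ball f fq])
  have Fq: "F q \<noteq> 0"
    using q fq by (simp add: F_def ip_self)
  define n where "n = nat (zorder F p)"
  define g0 where "g0 = zor_poly F p"
  have nz: "\<exists>w\<in>ball p r. F w \<noteq> 0"
    using q Fq by blast
  obtain s where s: "s > 0" "cball p s \<subseteq> ball p r" "g0 holomorphic_on cball p s"
    "\<And>w. w \<in> cball p s \<Longrightarrow> F w = g0 w * (w - p) ^ n \<and> g0 w \<noteq> 0"
    using zorder_exist_zero[OF F open_ball connected_ball pr nz]
    unfolding n_def g0_def by blast
  obtain g where g: "holo_into (ball p r) X g"
    "\<And>w. w \<in> ball p r \<Longrightarrow> f w = (w - p) ^ Suc n *\<^sub>C g w"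
    using div[of "Suc n"] by (elim exE conjE) (rule that, assumption, drule (1) bspec, assumption)
  define G where "G w = ip X (g w) (f q)" for w
  have "G holomorphic_on ball p r"
    unfolding G_def by (rule holo_into_ip[OF open_ball g(1) fq])
  then have "isCont G p"
    by (metis continuous_on_eq_continuous_at holomorphic_on_imp_continuous_on open_ball pr)
  then have "((\<lambda>w. (w - p) * G w) \<longlongrightarrow> (p - p) * G p) (at p)"
    unfolding isCont_def by (intro tendsto_intros)
  moreover have "\<forall>\<^sub>F w in at p. (w - p) * G w = g0 w"
  proof -
    have "\<forall>\<^sub>F w in at p. w \<in> ball p s - {p}"
      using s by (intro eventually_at_in_open) auto
    then show ?thesis
    proof eventually_elim
      case (elim w)
      then have w: "w \<in> cball p s" "w - p \<noteq> 0"
        by auto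
      then have wr: "w \<in> ball p r"
        using s(2) by blast
      have "F w = (w - p) ^ Suc n * G w"
        unfolding F_def G_def g(2)[OF wr] using holo_into_carr[OF g(1) wr] fq
        by (rule ip_scale_left)
      then have "g0 w * (w - p) ^ n = ((w - p) * G w) * (w - p) ^ n"
        using s(4)[OF w(1)] by simp
      then show ?case
        using w(2) by simp
    qed
  qed
  ultimately have "(g0 \<longlongrightarrow> 0) (at p)"
    by (simp add: tendsto_cong)
  moreover have "isCont g0 p"
    using holomorphic_on_imp_continuous_on[OF holomorphic_on_subset[OF s(3) ball_subset_cball]] s
    by (simp add: continuous_on_eq_continuous_at)
  then have "(g0 \<longlongrightarrow> g0 p) (at p)"
    by (simp add: isCont_def)
  ultimately have "g0 p = 0"
    using tendsto_unique[OF at_neq_bot] by blast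
  then show False
    using s(4)[of p] s(1) by simp
qed

text \<open>
  Gaussian elimination by induction on the number of vectors. Divide a power of \<open>\<sigma> - p\<close> out of one of
  them, so that the quotient \<open>g\<close> does not vanish at \<open>p\<close>, and subtract multiples of \<open>g\<close> from the others to
  make them orthogonal to \<open>g p\<close>. The remaining vectors stay independent away from \<open>p\<close> and satisfy the estimate
  by induction. The coefficient of \<open>g\<close> is read off from the inner product with \<open>g p\<close>, and undoing the
  division increases the exponent by the order of the zero.
\<close>

lemma independent_lower_bound:
  assumes "finite J" and "r > 0" and "\<And>j. j \<in> J \<Longrightarrow> holo_into (ball p r) X (f j)"
    and "\<And>\<sigma> c j. \<sigma> \<in> ball p r - {p} \<Longrightarrow> (\<Sum>j\<in>J. c j *\<^sub>C f j \<sigma>) = 0 \<Longrightarrow> j \<in> J \<Longrightarrow> c j = 0"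
  shows "\<exists>N C s. 0 < s \<and> s \<le> r \<and> 0 \<le> C \<and>
    (\<forall>\<sigma>\<in>ball p s - {p}. \<forall>c. \<forall>j\<in>J.
      cmod (c j) * cmod (\<sigma> - p) ^ N \<le> C * hnorm X (\<Sum>j\<in>J. c j *\<^sub>C f j \<sigma>))"
  using assms
proof (induction J arbitrary: r f rule: finite_induct)
  case empty
  then show ?case
    by (intro exI[of _ 0] exI[of _ r]) auto
next
  case (insert i J)
  have sum_insert: "(\<Sum>j\<in>insert i J. G j) = G i + (\<Sum>j\<in>J. G j)" for G :: "_ \<Rightarrow> 'e"
    using insert.hyps by simp
  have fi: "holo_into (ball p r) X (f i)"
    and fJ: "\<And>j. j \<in> J \<Longrightarrow> holo_into (ball p r) X (f j)"
    using insert.prems by auto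
  define q where "q = p + complex_of_real (r / 2)"
  have q: "q \<in> ball p r - {p}"
    using insert.prems(1) by (auto simp: q_def dist_norm norm_divide)
  have "f i q \<noteq> 0"
  proof
    assume "f i q = 0"
    moreover have "(\<Sum>j\<in>J. (if j = i then 1 else 0) *\<^sub>C f j q) = 0"
      using insert.hyps by (intro sum.neutral) auto
    ultimately have "(\<Sum>j\<in>insert i J. (if j = i then 1 else 0) *\<^sub>C f j q) = 0"
      unfolding sum_insert by simp
    from insert.prems(3)[OF q this, of i] show False
      by simp
  qed
  then have "\<exists>n g. holo_into (ball p r) X g \<and> g p \<noteq> 0 \<and>
    (\<forall>w\<in>ball p r. f i w = (w - p) ^ n *\<^sub>C g w)"
    using factor_out_order[OF insert.prems(1) fi, of q] q by simp
  then obtain n g where g: "holo_into (ball p r) X g" "g p \<noteq> 0"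
    and fi_eq: "\<And>w. w \<in> ball p r \<Longrightarrow> f i w = (w - p) ^ n *\<^sub>C g w"
    by (elim exE conjE) (rule that, assumption, assumption, drule (1) bspec, assumption)
  have pr: "p \<in> ball p r"
    using insert.prems(1) by simp
  define g0 where "g0 = g p"
  have g0: "g0 \<in> carr X"
    using holo_into_carr[OF g(1) pr] by (simp add: g0_def)
  define \<delta> where "\<delta> = (hnorm X g0)\<^sup>2 / 2"
  have \<delta>: "\<delta> > 0"
    using hnorm_pos[OF g0] g(2) by (simp add: \<delta>_def g0_def)
  \<comment> \<open>The inner product with \<open>g p\<close> of the direction that is eliminated. It stays above \<open>\<delta>\<close>, half of its value
    at \<open>p\<close>, near \<open>p\<close>.\<close>
  define s where "s w = ip X (g w) g0" for w
  have s_holo: "s holomorphic_on ball p r"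
    unfolding s_def by (rule holo_into_ip[OF open_ball g(1) g0])
  have s_p: "cmod (s p) = 2 * \<delta>"
    using g0 by (simp add: s_def g0_def[symmetric] ip_self \<delta>_def norm_power)
  have cont: "(h \<longlongrightarrow> h p) (nhds p)" if "h holomorphic_on ball p t" "t > 0" for h t
    using that holomorphic_on_imp_continuous_on[OF that(1)]
    by (simp add: continuous_on_eq_continuous_at isCont_def tendsto_at_iff_tendsto_nhds)
  have "\<forall>\<^sub>F w in nhds p. \<delta> < cmod (s w)"
    using \<delta> s_p tendsto_norm[OF cont[OF s_holo insert.prems(1)]]
    by (intro order_tendstoD(1)[where a = \<delta>]) auto
  moreover obtain Mg where Mg: "\<forall>\<^sub>F w in nhds p. hnorm X (g w) \<le> Mg"
    using holo_into_bounded[OF open_ball g(1) pr] by blast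
  moreover have "\<forall>\<^sub>F w in nhds p. w \<in> ball p (min r 1)"
    using insert.prems(1) by (intro eventually_nhds_in_open) auto
  ultimately have "\<forall>\<^sub>F w in nhds p. \<delta> < cmod (s w) \<and> hnorm X (g w) \<le> Mg \<and> w \<in> ball p (min r 1)"
    by eventually_elim auto
  then obtain r0 where r0: "r0 > 0"
    "\<And>w. dist w p < r0 \<Longrightarrow> \<delta> < cmod (s w) \<and> hnorm X (g w) \<le> Mg \<and> w \<in> ball p (min r 1)"
    unfolding eventually_nhds_metric by metis
  have s_ne: "s w \<noteq> 0" "\<delta> < cmod (s w)" "hnorm X (g w) \<le> Mg" "w \<in> ball p r" "cmod (w - p) \<le> 1"
    if "w \<in> ball p r0" for w
    using r0(2)[of w] that \<delta> by (auto simp: dist_commute dist_norm norm_minus_commute)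
  \<comment> \<open>The multiple of \<open>g\<close> to be subtracted from \<open>f j\<close>.\<close>
  define t where "t j w = ip X (f j w) g0 / s w" for j w
  have t_holo: "t j holomorphic_on ball p r0" if "j \<in> J" for j
    unfolding t_def
    by (intro holomorphic_intros holomorphic_on_subset[OF holo_into_ip[OF open_ball fJ[OF that] g0]]
        holomorphic_on_subset[OF s_holo]) (use s_ne in auto)
  have "\<forall>\<^sub>F w in nhds p. \<forall>j\<in>J. cmod (t j w) < cmod (t j p) + 1"
  proof (intro eventually_ball_finite insert.hyps(1) ballI)
    fix j assume "j \<in> J"
    show "\<forall>\<^sub>F w in nhds p. cmod (t j w) < cmod (t j p) + 1"
      using tendsto_norm[OF cont[OF t_holo[OF \<open>j \<in> J\<close>] r0(1)]]
      by (rule order_tendstoD(2)) simp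
  qed
  then obtain r1 where r1: "r1 > 0" "\<And>w j. dist w p < r1 \<Longrightarrow> j \<in> J \<Longrightarrow> cmod (t j w) < cmod (t j p) + 1"
    unfolding eventually_nhds_metric by metis
  define Mt where "Mt = (\<Sum>j\<in>J. cmod (t j p) + 1)"
  have Mt: "cmod (t j w) \<le> Mt" if "dist w p < r1" "j \<in> J" for j w
  proof -
    have "cmod (t j p) + 1 \<le> Mt"
      unfolding Mt_def using insert.hyps(1) that(2) by (intro member_le_sum) auto
    then show ?thesis
      using r1(2)[OF that] by simp
  qed
  have Mt0: "0 \<le> Mt"
    unfolding Mt_def by (intro sum_nonneg) auto
  define r2 where "r2 = min r0 r1"
  have r2: "r2 > 0" "ball p r2 \<subseteq> ball p r0" "ball p r2 \<subseteq> ball p r"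
    using r0 r1 s_ne(4) by (auto simp: r2_def)
  define f' where "f' j w = f j w - t j w *\<^sub>C g w" for j w
  have gc: "g w \<in> carr X" if "w \<in> ball p r2" for w
    using holo_into_carr[OF g(1)] r2 that by blast
  have fc: "f j w \<in> carr X" if "w \<in> ball p r2" "j \<in> J" for j w
    using holo_into_carr[OF fJ] r2 that by blast
  have f'_holo: "holo_into (ball p r2) X (f' j)" if "j \<in> J" for j
    unfolding f'_def
    by (intro holo_into_diff holo_into_scale open_ball holo_into_subset[OF fJ[OF that]]
        holo_into_subset[OF g(1)] holomorphic_on_subset[OF t_holo[OF that]] r2)
  have split: "(\<Sum>j\<in>J. c j *\<^sub>C f' j w) = (\<Sum>j\<in>J. c j *\<^sub>C f j w) - (\<Sum>j\<in>J. c j * t j w) *\<^sub>C g w"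
    for c w
    by (simp add: f'_def complex_vector.scale_right_diff_distrib sum_subtractf scaleC_scaleC
        complex_vector.scale_sum_left)
  have "\<exists>N C r3. 0 < r3 \<and> r3 \<le> r2 \<and> 0 \<le> C \<and>
    (\<forall>\<sigma>\<in>ball p r3 - {p}. \<forall>c. \<forall>j\<in>J.
      cmod (c j) * cmod (\<sigma> - p) ^ N \<le> C * hnorm X (\<Sum>j\<in>J. c j *\<^sub>C f' j \<sigma>))"
  proof (rule insert.IH[OF r2(1) f'_holo])
    fix \<sigma> c j assume \<sigma>: "\<sigma> \<in> ball p r2 - {p}" and zero: "(\<Sum>j\<in>J. c j *\<^sub>C f' j \<sigma>) = 0" and j: "j \<in> J"
    have \<sigma>r: "\<sigma> \<in> ball p r - {p}" "\<sigma> \<in> ball p r" and nz: "\<sigma> - p \<noteq> 0"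
      using \<sigma> r2 by auto
    define \<alpha> where "\<alpha> = (\<Sum>j\<in>J. c j * t j \<sigma>)"
    \<comment> \<open>A relation between the reduced vectors is one between the original vectors, since \<open>g\<close> is a multiple of \<open>f i\<close>
      away from \<open>p\<close>.\<close>
    define c' where "c' = c(i := - \<alpha> * inverse ((\<sigma> - p) ^ n))"
    have "(\<Sum>j\<in>J. c' j *\<^sub>C f j \<sigma>) = (\<Sum>j\<in>J. c j *\<^sub>C f j \<sigma>)"
      by (rule sum.cong) (use insert.hyps in \<open>auto simp: c'_def\<close>)
    moreover have "c' i *\<^sub>C f i \<sigma> = - (\<alpha> *\<^sub>C g \<sigma>)"
    proof -
      have "inverse ((\<sigma> - p) ^ n) * (\<sigma> - p) ^ n = 1"
        using nz by simp
      then have "- \<alpha> * inverse ((\<sigma> - p) ^ n) * (\<sigma> - p) ^ n = - \<alpha>"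
        by (metis mult.assoc mult.right_neutral)
      then show ?thesis
        unfolding fi_eq[OF \<sigma>r(2)] c'_def fun_upd_same scaleC_scaleC
        by (simp only: complex_vector.scale_minus_left)
    qed
    ultimately have "(\<Sum>j\<in>insert i J. c' j *\<^sub>C f j \<sigma>) = (\<Sum>j\<in>J. c j *\<^sub>C f' j \<sigma>)"
      unfolding sum_insert split \<alpha>_def by simp
    then have "c' j = 0"
      using insert.prems(3)[OF \<sigma>r(1), of c' j] zero j by simp
    then show "c j = 0"
      using j insert.hyps by (auto simp: c'_def split: if_splits)
  qed
  then obtain N C r3 where r3: "0 < r3" "r3 \<le> r2" "0 \<le> C"
    and IH: "\<And>\<sigma> c j. \<sigma> \<in> ball p r3 - {p} \<Longrightarrow> j \<in> J \<Longrightarrow>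
      cmod (c j) * cmod (\<sigma> - p) ^ N \<le> C * hnorm X (\<Sum>j\<in>J. c j *\<^sub>C f' j \<sigma>)"
    by metis
  define A where "A = hnorm X g0 / \<delta>"
  have A: "0 \<le> A"
    using \<delta> g0 by (simp add: A_def)
  define B where "B = 1 + A * Mg"
  define D where "D = A + real (card J) * Mt * C * B"
  have Mg0: "0 \<le> Mg"
    using order_trans[OF hnorm_nonneg[OF g0[unfolded g0_def]] s_ne(3)[of p]] r0(1) by simp
  have B: "0 \<le> B"
    using A Mg0 by (simp add: B_def)
  have D: "0 \<le> D"
    using A B Mt0 r3 by (simp add: D_def)
  have main: "cmod (c j) * cmod (\<sigma> - p) ^ (n + N) \<le> (C * B + D) * hnorm X (\<Sum>j\<in>insert i J. c j *\<^sub>C f j \<sigma>)"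
    if \<sigma>: "\<sigma> \<in> ball p r3 - {p}" and j: "j \<in> insert i J" for \<sigma> c j
  proof -
    have \<sigma>2: "\<sigma> \<in> ball p r2"
      using \<sigma> r3 by auto
    then have \<sigma>0: "\<sigma> \<in> ball p r0" "\<sigma> \<in> ball p r" "dist \<sigma> p < r1"
      using r2(2,3) by (blast, blast, simp add: r2_def dist_commute)
    note sn = s_ne[OF \<sigma>0(1)]
    define S where "S = (\<Sum>j\<in>insert i J. c j *\<^sub>C f j \<sigma>)"
    define W where "W = (\<Sum>j\<in>J. c j *\<^sub>C f' j \<sigma>)"
    define \<alpha> where "\<alpha> = c i * (\<sigma> - p) ^ n + (\<Sum>j\<in>J. c j * t j \<sigma>)"
    have g\<sigma>: "g \<sigma> \<in> carr X"
      using gc[OF \<sigma>2] .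
    have f'c: "f' j \<sigma> \<in> carr X" if "j \<in> J" for j
      using gc[OF \<sigma>2] fc[OF \<sigma>2 that] by (simp add: f'_def)
    have Wc: "W \<in> carr X"
      unfolding W_def using f'c by (intro carr_sum) auto
    have S_eq: "S = \<alpha> *\<^sub>C g \<sigma> + W"
      unfolding S_def sum_insert W_def split fi_eq[OF \<sigma>0(2)] \<alpha>_def
      by (simp add: scaleC_scaleC scaleC_add_left)
    then have Sc: "S \<in> carr X"
      using g\<sigma> Wc by simp
    have ip_f': "ip X (f' j \<sigma>) g0 = 0" if "j \<in> J" for j
      using g\<sigma> fc[OF \<sigma>2 that] g0 sn(1) by (simp add: f'_def ip_diff_left ip_scale_left t_def s_def)
    have "ip X W g0 = 0"
      unfolding W_def using f'c g0 ip_f' insert.hyps(1) by (simp add: ip_sum_left ip_scale_left)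
    then have "ip X S g0 = \<alpha> * s \<sigma>"
      unfolding S_eq using g\<sigma> Wc g0 by (simp add: ip_add_left ip_scale_left s_def)
    then have "cmod \<alpha> * cmod (s \<sigma>) \<le> hnorm X S * hnorm X g0"
      using cauchy_schwarz[OF Sc g0] by (simp add: norm_mult)
    moreover have "cmod \<alpha> * \<delta> \<le> cmod \<alpha> * cmod (s \<sigma>)"
      using sn(2) by (intro mult_left_mono) auto
    ultimately have "cmod \<alpha> * \<delta> \<le> hnorm X S * hnorm X g0"
      by linarith
    then have \<alpha>_le: "cmod \<alpha> \<le> A * hnorm X S"
      using \<delta> by (simp add: A_def pos_le_divide_eq mult.commute)
    have "W = S - \<alpha> *\<^sub>C g \<sigma>"
      by (simp add: S_eq)
    then have "hnorm X W \<le> hnorm X S + cmod \<alpha> * hnorm X (g \<sigma>)"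
      using hnorm_triangle_diff[of S "\<alpha> *\<^sub>C g \<sigma>"] Sc g\<sigma> by simp
    also have "cmod \<alpha> * hnorm X (g \<sigma>) \<le> (A * hnorm X S) * Mg"
      using \<alpha>_le sn(3) g\<sigma> A Sc by (intro mult_mono) auto
    finally have W_le: "hnorm X W \<le> B * hnorm X S"
      by (simp add: B_def algebra_simps)
    have cJ: "cmod (c j) * cmod (\<sigma> - p) ^ N \<le> C * B * hnorm X S" if "j \<in> J" for j
    proof -
      have "cmod (c j) * cmod (\<sigma> - p) ^ N \<le> C * hnorm X W"
        unfolding W_def using IH[OF \<sigma> that] .
      also have "\<dots> \<le> C * (B * hnorm X S)"
        using W_le r3(3) by (rule mult_left_mono)
      finally show ?thesis by simp
    qed
    have nn: "0 \<le> hnorm X S"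
      using Sc by simp
    have pow: "cmod (\<sigma> - p) ^ m \<le> 1" for m
      using sn(5) by (simp add: power_le_one)
    show ?thesis
    proof (cases "j = i")
      case False
      then have jJ: "j \<in> J"
        using j by simp
      have "cmod (c j) * cmod (\<sigma> - p) ^ (n + N) = (cmod (c j) * cmod (\<sigma> - p) ^ N) * cmod (\<sigma> - p) ^ n"
        by (simp add: power_add)
      also have "\<dots> \<le> (cmod (c j) * cmod (\<sigma> - p) ^ N) * 1"
        using pow by (intro mult_left_mono) auto
      also have "\<dots> \<le> C * B * hnorm X S + D * hnorm X S"
        using cJ[OF jJ] D nn by (simp add: add_increasing2)
      finally show ?thesis
        by (simp add: S_def distrib_right)
    next
      case True
      have "c i * (\<sigma> - p) ^ n = \<alpha> - (\<Sum>j\<in>J. c j * t j \<sigma>)"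
        by (simp add: \<alpha>_def)
      then have "cmod (c i) * cmod (\<sigma> - p) ^ n \<le> cmod \<alpha> + (\<Sum>j\<in>J. cmod (c j) * cmod (t j \<sigma>))"
        using norm_triangle_ineq4[of \<alpha> "\<Sum>j\<in>J. c j * t j \<sigma>"] norm_sum[of "\<lambda>j. c j * t j \<sigma>" J]
        by (simp add: norm_mult norm_power flip: norm_power norm_mult)
      then have "cmod (c i) * cmod (\<sigma> - p) ^ n * cmod (\<sigma> - p) ^ N
          \<le> (cmod \<alpha> + (\<Sum>j\<in>J. cmod (c j) * cmod (t j \<sigma>))) * cmod (\<sigma> - p) ^ N"
        by (intro mult_right_mono) auto
      also have "\<dots> = cmod \<alpha> * cmod (\<sigma> - p) ^ N
          + (\<Sum>j\<in>J. cmod (t j \<sigma>) * (cmod (c j) * cmod (\<sigma> - p) ^ N))"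
        by (simp add: distrib_left distrib_right sum_distrib_left sum_distrib_right mult_ac)
      also have "\<dots> \<le> A * hnorm X S * 1 + (\<Sum>j\<in>J. Mt * (C * B * hnorm X S))"
      proof (rule add_mono)
        show "cmod \<alpha> * cmod (\<sigma> - p) ^ N \<le> A * hnorm X S * 1"
          using \<alpha>_le pow A nn by (intro mult_mono) auto
        show "(\<Sum>j\<in>J. cmod (t j \<sigma>) * (cmod (c j) * cmod (\<sigma> - p) ^ N))
            \<le> (\<Sum>j\<in>J. Mt * (C * B * hnorm X S))"
          by (intro sum_mono mult_mono Mt[OF \<sigma>0(3)] cJ Mt0) auto
      qed
      also have "\<dots> = D * hnorm X S"
        by (simp add: D_def algebra_simps)
      also have "\<dots> \<le> (C * B + D) * hnorm X S"
        using r3(3) B nn by (intro mult_right_mono) auto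
      finally show ?thesis
        using True by (simp add: S_def power_add mult.assoc)
    qed
  qed
  have "r3 \<le> r"
    using r2(1,3) r3 by (simp add: ball_subset_ball_iff)
  moreover have "0 \<le> C * B + D"
    using r3(3) B D by simp
  ultimately show ?case
    using r3(1) main by (intro exI[of _ "n + N"] exI[of _ "C * B + D"] exI[of _ r3]) blast
qed

end

section \<open>Meromorphic inversion of Fredholm families\<close>

context two_hilb
begin

text \<open>
  Lyapunov-Schmidt reduction. Let \<open>V\<close> be the orthogonal complement of the kernel of \<open>T p\<close> and \<open>R\<close> the closed
  range of \<open>T p\<close>. The compression \<open>A \<sigma>\<close> of \<open>T \<sigma>\<close> to a map from \<open>V\<close> to \<open>R\<close> is invertible at
  \<open>p\<close>, with bounded inverse by the open mapping theorem, and hence near \<open>p\<close>. A basis vector \<open>j\<close> of the kernel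
  can therefore be corrected by a holomorphic \<open>v j \<sigma>\<close> in \<open>V\<close> such that
  \<open>f j \<sigma> = T \<sigma> (j - v j \<sigma>)\<close> is orthogonal to \<open>R\<close>. These finitely many vectors are
  independent away from \<open>p\<close> because \<open>T \<sigma>\<close> is injective there, so the estimate for independent holomorphic
  vectors controls the kernel components, and the bound for \<open>A \<sigma>\<close> controls the remaining part.
\<close>

theorem fredholm_lower_bound:
  assumes r: "r > 0" and T: "holo_family (ball p r) X Y T"
    and fred: "fredholm_op (carr X) Y (T p)"
    and inj: "\<And>\<sigma> u. \<sigma> \<in> ball p r - {p} \<Longrightarrow> u \<in> carr X \<Longrightarrow> T \<sigma> u = 0 \<Longrightarrow> u = 0"
  obtains N C s where "0 < s" "s \<le> r" "0 \<le> C"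
    "\<And>\<sigma> u. \<sigma> \<in> ball p s - {p} \<Longrightarrow> u \<in> carr X \<Longrightarrow> cmod (\<sigma> - p) ^ N * hnorm X u \<le> C * hnorm Y (T \<sigma> u)"
proof -
  have pr: "p \<in> ball p r"
    using r by simp
  note lin = holo_family_linear[OF T]
  note bdd = holo_family_bounded_op[OF T pr]
  have Tc: "T w u \<in> carr Y" if "w \<in> ball p r" "u \<in> carr X" for w u
    using lin[OF that(1)] that(2) by blast
  define Nk where "Nk = {u \<in> carr X. T p u = 0}"
  have Nk_closed: "closed_subspace X Nk"
    unfolding Nk_def by (rule closed_kernel[OF bdd])
  then have Nk_sub: "csubspace Nk" and NkX: "Nk \<subseteq> carr X"
    by (simp_all add: closed_subspace_def)
  obtain B0 where B0: "finite B0" "Nk \<subseteq> cspan B0"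
    using fred unfolding fredholm_op_def Nk_def by blast
  obtain J where J: "J \<subseteq> Nk" "\<not> complex_vector.dependent J" "Nk \<subseteq> cspan J"
    using complex_vector.maximal_independent_subset by blast
  have Jfin: "finite J"
    using complex_vector.independent_span_bound[OF B0(1) J(2)] J(1) B0(2) by auto
  have Jc: "j \<in> carr X" if "j \<in> J" for j
    using J(1) that by (auto simp: Nk_def)
  define R where "R = T p ` carr X"
  have R_closed: "closed_subspace Y R"
    unfolding R_def using fred unfolding fredholm_op_def by (intro closed_range lin pr) blast
  then have R_sub: "csubspace R" and RY: "R \<subseteq> carr Y"
    by (simp_all add: closed_subspace_def)
  define V where "V = {x \<in> carr X. \<forall>n\<in>Nk. ip X x n = 0}"
  have V_closed: "closed_subspace X V"
    unfolding V_def by (rule X.closed_orthogonal_complement[OF NkX])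
  then have V_sub: "csubspace V" and VX: "V \<subseteq> carr X"
    by (simp_all add: closed_subspace_def)
  have meet: "u = 0" if "u \<in> V" "u \<in> Nk" for u
    using that by (auto simp: V_def X.ip_self)
  obtain proj where proj: "\<And>y. y \<in> carr Y \<Longrightarrow> proj y \<in> R"
    and proj_id: "\<And>y. y \<in> R \<Longrightarrow> proj y = y"
    and proj_norm: "\<And>y. y \<in> carr Y \<Longrightarrow> hnorm Y (proj y) \<le> hnorm Y y"
    and proj_add: "\<And>y z. y \<in> carr Y \<Longrightarrow> z \<in> carr Y \<Longrightarrow> proj (y + z) = proj y + proj z"
    and proj_scale: "\<And>c y. y \<in> carr Y \<Longrightarrow> proj (c *\<^sub>C y) = c *\<^sub>C proj y"
    by (rule Y.orthogonal_projection[OF R_closed]) (rule that; assumption)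
  define XV where "XV = restrict_space_to X V"
  define YR where "YR = restrict_space_to Y R"
  have XV_simps [simp]: "carr XV = V" "hnorm XV = hnorm X" "ip XV = ip X"
    and YR_simps [simp]: "carr YR = R" "hnorm YR = hnorm Y" "ip YR = ip Y"
    by (auto simp: XV_def YR_def)
  have hXV: "hilb XV" and hYR: "hilb YR"
    unfolding XV_def YR_def by (rule X.hilb_restrict V_closed Y.hilb_restrict R_closed)+
  interpret W: two_hilb XV YR
    using hXV hYR by (simp add: two_hilb_def)
  have proj_op: "bounded_op Y YR proj"
    unfolding bounded_op_def clinear_between_def
    using proj proj_add proj_scale proj_norm by (auto intro!: exI[of _ 1])
  define A where "A \<sigma> u = proj (T \<sigma> u)" for \<sigma> u
  have A_fam: "holo_family (ball p r) XV YR A"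
    unfolding A_def XV_def by (rule holo_family_restrict_compose[OF T V_sub VX proj_op hYR])
  have A_p: "A p u = T p u" if "u \<in> V" for u
    using that VX by (auto simp: A_def R_def intro!: proj_id)
  note Alin = W.holo_family_linear[OF A_fam]
  have A_surj: "\<exists>u\<in>V. A p u = v" if v: "v \<in> R" for v
  proof -
    obtain x where x: "x \<in> carr X" "T p x = v"
      using v by (auto simp: R_def)
    obtain m where m: "m \<in> Nk" "\<And>n. n \<in> Nk \<Longrightarrow> ip X (x - m) n = 0"
      using X.projection_exists[OF Nk_closed x(1)] by metis
    then have "x - m \<in> V" "T p (x - m) = v"
      using x NkX linear_diff[OF lin[OF pr]] by (auto simp: V_def Nk_def)
    then show ?thesis
      using A_p by blast
  qed
  obtain K where K: "K > 0" "\<And>u. u \<in> V \<Longrightarrow> hnorm X u \<le> K * hnorm Y (A p u)"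
  proof (rule W.bounded_inverse[OF W.holo_family_bounded_op[OF A_fam pr]])
    show "u = 0" if "u \<in> carr XV" "A p u = 0" for u
      using that A_p VX by (intro meet) (auto simp: Nk_def)
    show "\<exists>u\<in>carr XV. A p u = v" if "v \<in> carr YR" for v
      using A_surj that by simp
  qed (use that in auto)
  define c where "c = 1 / K"
  have c: "c > 0" "\<And>u. u \<in> V \<Longrightarrow> c * hnorm X u \<le> hnorm Y (A p u)"
    using K by (auto simp: c_def divide_simps mult.commute)
  obtain L d where L: "L \<ge> 0" "d > 0" "ball p d \<subseteq> ball p r"
    and LT: "\<And>w u. w \<in> ball p d \<Longrightarrow> u \<in> carr X \<Longrightarrow> hnorm Y (T w u) \<le> L * hnorm X u"
    and Llip: "\<And>w u. w \<in> ball p d \<Longrightarrow> u \<in> carr X \<Longrightarrow> hnorm Y (T w u - T p u) \<le> L * cmod (w - p) * hnorm X u"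
    by (rule holo_familyE[OF open_ball T pr]) (rule that; assumption)
  \<comment> \<open>Small enough for \<open>A w\<close> to differ from \<open>A p\<close> by at most half of the lower bound \<open>c\<close> of \<open>A p\<close>.\<close>
  define r1 where "r1 = min 1 (min d (c / (2 * (L + 1))))"
  have r1: "r1 > 0" "ball p r1 \<subseteq> ball p d" "r1 \<le> d"
    using L c by (auto simp: r1_def)
  have r1r: "ball p r1 \<subseteq> ball p r"
    using r1 L by blast
  have close: "hnorm Y (A w u - A p u) \<le> c / 2 * hnorm X u" if w: "w \<in> ball p r1" and u: "u \<in> V" for w u
  proof -
    have wd: "w \<in> ball p d" "w \<in> ball p r" and uX: "u \<in> carr X"
      using w r1 r1r u VX by auto
    have Tcc: "T w u \<in> carr Y" "T p u \<in> carr Y"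
      using Tc wd pr uX by auto
    have "proj (T w u - T p u) = proj (T w u) - proj (T p u)"
      using proj_add[of "T w u - T p u" "T p u"] Tcc by (simp add: algebra_simps)
    then have "hnorm Y (A w u - A p u) \<le> hnorm Y (T w u - T p u)"
      using proj_norm[of "T w u - T p u"] Tcc by (simp add: A_def)
    also have "\<dots> \<le> L * cmod (w - p) * hnorm X u"
      by (rule Llip[OF wd(1) uX])
    also have "\<dots> \<le> c / 2 * hnorm X u"
    proof (rule mult_right_mono)
      have "cmod (w - p) \<le> c / (2 * (L + 1))"
        using w by (auto simp: r1_def dist_norm norm_minus_commute)
      then have "L * cmod (w - p) \<le> (L + 1) * (c / (2 * (L + 1)))"
        using L by (intro mult_mono) auto
      also have "\<dots> = c / 2"
        using L by (simp add: divide_simps)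
      finally show "L * cmod (w - p) \<le> c / 2" .
    qed (use uX in simp)
    finally show ?thesis .
  qed
  have A_below: "c / 2 * hnorm X u \<le> hnorm Y (A w u)" if "w \<in> ball p r1" "u \<in> V" for w u
    using W.perturbation(1)[OF Alin[OF pr] Alin[of w] c(1), of u] c(2) A_surj close that r1r by auto
  have A_surj': "\<exists>u\<in>V. A w u = v" if "w \<in> ball p r1" "v \<in> R" for w v
    using W.perturbation(2)[OF Alin[OF pr] Alin[of w] c(1), of v] c(2) A_surj close that r1r by auto
  have A_below': "hnorm X u \<le> (2 / c) * hnorm Y (A w u)" if "w \<in> ball p r1" "u \<in> V" for w u
    using A_below[OF that] c(1) by (simp add: field_simps)
  define v where "v j w = (SOME u. u \<in> V \<and> A w u = proj (T w j))" for j w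
  have v: "v j w \<in> V" "A w (v j w) = proj (T w j)" if "j \<in> J" "w \<in> ball p r1" for j w
  proof -
    have "proj (T w j) \<in> R"
      using proj Tc Jc that r1r by blast
    then have "\<exists>u. u \<in> V \<and> A w u = proj (T w j)"
      using A_surj'[OF that(2)] by blast
    from someI_ex[OF this] show "v j w \<in> V" "A w (v j w) = proj (T w j)"
      by (auto simp: v_def)
  qed
  have T1: "holo_family (ball p r1) X Y T"
    using holo_family_subset[OF T r1r] .
  interpret P: two_hilb Y YR
    using hYR by unfold_locales (auto simp: hilb_def)
  have v_holo: "holo_into (ball p r1) XV (v j)" if j: "j \<in> J" for j
  proof (rule W.holo_solution[OF open_ball holo_family_subset[OF A_fam r1r]])
    have "holo_family (ball p r1) Y YR (\<lambda>_. proj)"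
      by (rule P.holo_family_const[OF proj_op])
    then show "holo_into (ball p r1) YR (\<lambda>w. proj (T w j))"
      using holo_family_apply[OF open_ball T1 X.holo_into_const[OF Jc[OF j]]]
      by (rule P.holo_family_apply[OF open_ball])
    show "\<exists>K. \<forall>\<^sub>F w in nhds z. \<forall>u\<in>carr XV. hnorm XV u \<le> K * hnorm YR (A w u)"
      if z: "z \<in> ball p r1" for z
    proof -
      have "\<forall>\<^sub>F w in nhds z. w \<in> ball p r1"
        using z by (intro eventually_nhds_in_open) auto
      then have "\<forall>\<^sub>F w in nhds z. \<forall>u\<in>carr XV. hnorm XV u \<le> (2 / c) * hnorm YR (A w u)"
        by eventually_elim (use A_below' in simp)
      then show ?thesis by blast
    qed
  qed (use v j A_surj' in auto)
  have v_holoX: "holo_into (ball p r1) X (v j)" if "j \<in> J" for j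
    using v_holo[OF that] VX unfolding holo_into_def XV_simps by (meson subsetD)
  define f where "f j w = T w (j - v j w)" for j w
  have jv_holo: "holo_into (ball p r1) X (\<lambda>w. j - v j w)" if "j \<in> J" for j
    by (intro X.holo_into_diff open_ball X.holo_into_const Jc v_holoX that)
  have jvc: "j - v j w \<in> carr X" if "j \<in> J" "w \<in> ball p r1" for j w
    using holo_into_carr[OF jv_holo[OF that(1)] that(2)] .
  have f_holo: "holo_into (ball p r1) Y (f j)" if "j \<in> J" for j
    unfolding f_def by (rule holo_family_apply[OF open_ball T1 jv_holo[OF that]])
  have sum_f: "(\<Sum>j\<in>J. a j *\<^sub>C f j w) = T w (\<Sum>j\<in>J. a j *\<^sub>C (j - v j w))" if w: "w \<in> ball p r1" for a w
  proof -
    have wl: "linear_op (T w)"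
      using lin w r1r by blast
    have "T w (\<Sum>j\<in>J. a j *\<^sub>C (j - v j w)) = (\<Sum>j\<in>J. T w (a j *\<^sub>C (j - v j w)))"
      using jvc w by (intro linear_sum Jfin wl) auto
    also have "\<dots> = (\<Sum>j\<in>J. a j *\<^sub>C f j w)"
      unfolding f_def using jvc w wl by (intro sum.cong) (auto simp: linear_scale)
    finally show ?thesis by simp
  qed
  have "\<exists>N C s. 0 < s \<and> s \<le> r1 \<and> 0 \<le> C \<and>
    (\<forall>\<sigma>\<in>ball p s - {p}. \<forall>a. \<forall>j\<in>J.
      cmod (a j) * cmod (\<sigma> - p) ^ N \<le> C * hnorm Y (\<Sum>j\<in>J. a j *\<^sub>C f j \<sigma>))"
  proof (rule Y.independent_lower_bound[OF Jfin r1(1) f_holo])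
    fix \<sigma> a j assume \<sigma>: "\<sigma> \<in> ball p r1 - {p}" and zero: "(\<Sum>j\<in>J. a j *\<^sub>C f j \<sigma>) = 0" and j: "j \<in> J"
    have \<sigma>': "\<sigma> \<in> ball p r1" "\<sigma> \<in> ball p r - {p}"
      using \<sigma> r1r by auto
    have "(\<Sum>j\<in>J. a j *\<^sub>C (j - v j \<sigma>)) = 0"
      using inj[OF \<sigma>'(2), of "\<Sum>j\<in>J. a j *\<^sub>C (j - v j \<sigma>)"] zero sum_f[OF \<sigma>'(1)] jvc[OF _ \<sigma>'(1)]
      by (metis (no_types, lifting) X.carr_scale X.carr_sum)
    then have eq: "(\<Sum>j\<in>J. a j *\<^sub>C j) = (\<Sum>j\<in>J. a j *\<^sub>C v j \<sigma>)"
      by (simp add: complex_vector.scale_right_diff_distrib sum_subtractf)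
    have "(\<Sum>j\<in>J. a j *\<^sub>C j) \<in> Nk"
      using J(1) Nk_sub by (intro complex_vector.subspace_sum complex_vector.subspace_scale) auto
    moreover have "(\<Sum>j\<in>J. a j *\<^sub>C v j \<sigma>) \<in> V"
      using v(1) \<sigma>' V_sub by (intro complex_vector.subspace_sum complex_vector.subspace_scale) auto
    ultimately have "(\<Sum>j\<in>J. a j *\<^sub>C j) = 0"
      using meet eq by metis
    then show "a j = 0"
      using complex_vector.independentD[OF J(2) Jfin order_refl _ j] by blast
  qed
  then obtain N C r2 where r2: "0 < r2" "r2 \<le> r1" "0 \<le> C"
    and low: "\<And>\<sigma> a j. \<sigma> \<in> ball p r2 - {p} \<Longrightarrow> j \<in> J \<Longrightarrow>
      cmod (a j) * cmod (\<sigma> - p) ^ N \<le> C * hnorm Y (\<Sum>j\<in>J. a j *\<^sub>C f j \<sigma>)"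
    by metis
  have p1: "p \<in> ball p r1"
    using r1 by simp
  obtain M where M: "\<And>j. j \<in> J \<Longrightarrow> \<forall>\<^sub>F w in nhds p. hnorm X (j - v j w) \<le> M j"
    using X.holo_into_bounded[OF open_ball jv_holo p1] by metis
  have "\<forall>\<^sub>F w in nhds p. \<forall>j\<in>J. hnorm X (j - v j w) \<le> M j"
    using M by (intro eventually_ball_finite Jfin) auto
  then obtain r3 where r3: "r3 > 0" "\<And>w j. dist w p < r3 \<Longrightarrow> j \<in> J \<Longrightarrow> hnorm X (j - v j w) \<le> M j"
    unfolding eventually_nhds_metric by metis
  define s where "s = min r2 r3"
  define E where "E = C * (1 + L * (2 / c))"
  define F where "F = 2 / c + (\<Sum>j\<in>J. E * max 0 (M j))"
  have s: "0 < s" "s \<le> r"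
  proof -
    have "r1 \<le> r"
      using r1r r1(1) r by (simp add: ball_subset_ball_iff)
    then show "0 < s" "s \<le> r"
      using r2 r3 by (auto simp: s_def)
  qed
  have E: "0 \<le> E"
    using r2 L c by (simp add: E_def)
  have F: "0 \<le> F"
    unfolding F_def using E c by (intro add_nonneg_nonneg sum_nonneg) auto
  have "cmod (\<sigma> - p) ^ N * hnorm X x \<le> F * hnorm Y (T \<sigma> x)"
    if \<sigma>: "\<sigma> \<in> ball p s - {p}" and x: "x \<in> carr X" for \<sigma> x
  proof -
    have \<sigma>1: "\<sigma> \<in> ball p r1" "\<sigma> \<in> ball p r2 - {p}" "dist \<sigma> p < r3" "\<sigma> \<in> ball p r" "\<sigma> \<in> ball p d"
    proof -
      show "\<sigma> \<in> ball p r1" "\<sigma> \<in> ball p r2 - {p}" "dist \<sigma> p < r3"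
        using \<sigma> r2 by (auto simp: s_def dist_commute)
      then show "\<sigma> \<in> ball p r" "\<sigma> \<in> ball p d"
        using r1r r1(2) by blast+
    qed
    have \<sigma>le: "cmod (\<sigma> - p) ^ N \<le> 1"
    proof -
      have "cmod (\<sigma> - p) \<le> 1"
        using \<sigma>1(1) by (auto simp: r1_def dist_norm norm_minus_commute)
      then show ?thesis
        by (simp add: power_le_one)
    qed
    obtain m where m: "m \<in> Nk" "\<And>n. n \<in> Nk \<Longrightarrow> ip X (x - m) n = 0"
      using X.projection_exists[OF Nk_closed x] by metis
    have v0: "x - m \<in> V"
      using m x NkX by (auto simp: V_def)
    obtain a where a: "m = (\<Sum>j\<in>J. a j *\<^sub>C j)"
      using m(1) J(3) complex_vector.span_finite[OF Jfin] by auto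
    \<comment> \<open>The vector \<open>x\<close> is split into \<open>v'\<close> in \<open>V\<close> and a combination of the corrected kernel vectors, whose images
      are invisible to \<open>proj\<close>.\<close>
    define v' where "v' = (x - m) + (\<Sum>j\<in>J. a j *\<^sub>C v j \<sigma>)"
    have v'V: "v' \<in> V"
      unfolding v'_def using v0 v(1) \<sigma>1(1) V_sub
      by (intro complex_vector.subspace_add complex_vector.subspace_sum complex_vector.subspace_scale) auto
    then have v'X: "v' \<in> carr X"
      using VX by blast
    define w where "w = (\<Sum>j\<in>J. a j *\<^sub>C (j - v j \<sigma>))"
    have wc: "w \<in> carr X"
      unfolding w_def using jvc \<sigma>1(1) by (intro X.carr_sum) auto
    have x_eq: "x = v' + w"
      by (simp add: v'_def w_def a complex_vector.scale_right_diff_distrib sum_subtractf)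
    note wl = lin[OF \<sigma>1(4)]
    have Tx: "T \<sigma> x = T \<sigma> v' + T \<sigma> w"
      unfolding x_eq by (rule linear_add[OF wl v'X wc])
    have Tcs: "T \<sigma> x \<in> carr Y" "T \<sigma> v' \<in> carr Y" "T \<sigma> w \<in> carr Y"
      using Tc[OF \<sigma>1(4)] x v'X wc by auto
    have projf: "proj (f j \<sigma>) = 0" if "j \<in> J" for j
    proof -
      have cj: "T \<sigma> j \<in> carr Y" "T \<sigma> (v j \<sigma>) \<in> carr Y" and vjX: "v j \<sigma> \<in> carr X"
        using Tc[OF \<sigma>1(4)] Jc[OF that] v(1)[OF that \<sigma>1(1)] VX by auto
      have "T \<sigma> j = f j \<sigma> + T \<sigma> (v j \<sigma>)"
        unfolding f_def using linear_diff[OF wl Jc[OF that] vjX] by simp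
      moreover have "f j \<sigma> \<in> carr Y"
        using holo_into_carr[OF f_holo[OF that] \<sigma>1(1)] .
      ultimately have "proj (T \<sigma> j) = proj (f j \<sigma>) + proj (T \<sigma> (v j \<sigma>))"
        using proj_add cj by metis
      then show ?thesis
        using v(2)[OF that \<sigma>1(1)] by (simp add: A_def)
    qed
    have proj0: "proj 0 = 0"
      using proj_id complex_vector.subspace_0[OF R_sub] by blast
    have "proj (\<Sum>j\<in>I. a j *\<^sub>C f j \<sigma>) = 0" if "I \<subseteq> J" "finite I" for I
      using that(2,1)
    proof (induction I rule: finite_induct)
      case (insert i I)
      have fc: "f j \<sigma> \<in> carr Y" if "j \<in> J" for j
        using holo_into_carr[OF f_holo[OF that] \<sigma>1(1)] .
      have "(\<Sum>j\<in>I. a j *\<^sub>C f j \<sigma>) \<in> carr Y"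
        using insert fc by (intro Y.carr_sum) auto
      then show ?case
        using insert fc[of i] proj_add[of "a i *\<^sub>C f i \<sigma>" "\<Sum>j\<in>I. a j *\<^sub>C f j \<sigma>"] proj_scale[of "f i \<sigma>"] projf[of i]
        by simp
    qed (simp add: proj0)
    then have "proj (T \<sigma> w) = 0"
      using sum_f[OF \<sigma>1(1), of a] Jfin by (metis order_refl w_def)
    then have "proj (T \<sigma> x) = A \<sigma> v'"
      using proj_add[OF Tcs(2,3)] by (simp add: Tx A_def)
    then have "hnorm X v' \<le> (2 / c) * hnorm Y (proj (T \<sigma> x))"
      using A_below'[OF \<sigma>1(1) v'V] by simp
    also have "\<dots> \<le> (2 / c) * hnorm Y (T \<sigma> x)"
      using proj_norm[OF Tcs(1)] c(1) by (intro mult_left_mono) auto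
    finally have v'_le: "hnorm X v' \<le> (2 / c) * hnorm Y (T \<sigma> x)" .
    have "T \<sigma> w = T \<sigma> x - T \<sigma> v'"
      by (simp add: Tx)
    then have "hnorm Y (T \<sigma> w) \<le> hnorm Y (T \<sigma> x) + hnorm Y (T \<sigma> v')"
      using Y.hnorm_triangle_diff Tcs by metis
    moreover have "hnorm Y (T \<sigma> v') \<le> L * ((2 / c) * hnorm Y (T \<sigma> x))"
      using LT[OF \<sigma>1(5) v'X] mult_left_mono[OF v'_le L(1)] by linarith
    ultimately have "hnorm Y (T \<sigma> w) \<le> hnorm Y (T \<sigma> x) + L * ((2 / c) * hnorm Y (T \<sigma> x))"
      by linarith
    then have "C * hnorm Y (T \<sigma> w) \<le> C * (hnorm Y (T \<sigma> x) + L * ((2 / c) * hnorm Y (T \<sigma> x)))"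
      using r2(3) by (rule mult_left_mono)
    also have "\<dots> = E * hnorm Y (T \<sigma> x)"
      by (simp add: E_def algebra_simps)
    finally have Tw_le: "C * hnorm Y (T \<sigma> w) \<le> E * hnorm Y (T \<sigma> x)" .
    have aj: "cmod (\<sigma> - p) ^ N * cmod (a j) \<le> E * hnorm Y (T \<sigma> x)" if "j \<in> J" for j
      using low[OF \<sigma>1(2) that, of a] sum_f[OF \<sigma>1(1), of a] Tw_le
      by (simp add: w_def mult.commute)
    have TxN: "0 \<le> hnorm Y (T \<sigma> x)"
      using Tcs by simp
    have "hnorm X w \<le> (\<Sum>j\<in>J. hnorm X (a j *\<^sub>C (j - v j \<sigma>)))"
      unfolding w_def using jvc \<sigma>1(1) by (intro X.hnorm_sum Jfin) auto
    also have "\<dots> = (\<Sum>j\<in>J. cmod (a j) * hnorm X (j - v j \<sigma>))"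
      using jvc \<sigma>1(1) by (intro sum.cong) auto
    finally have "cmod (\<sigma> - p) ^ N * hnorm X w
        \<le> cmod (\<sigma> - p) ^ N * (\<Sum>j\<in>J. cmod (a j) * hnorm X (j - v j \<sigma>))"
      by (intro mult_left_mono) auto
    also have "\<dots> = (\<Sum>j\<in>J. (cmod (\<sigma> - p) ^ N * cmod (a j)) * hnorm X (j - v j \<sigma>))"
      by (simp add: sum_distrib_left mult.assoc)
    also have "\<dots> \<le> (\<Sum>j\<in>J. (E * hnorm Y (T \<sigma> x)) * max 0 (M j))"
    proof (rule sum_mono)
      fix j assume j: "j \<in> J"
      have "hnorm X (j - v j \<sigma>) \<le> max 0 (M j)"
        using r3(2)[OF \<sigma>1(3) j] by simp
      moreover have "0 \<le> hnorm X (j - v j \<sigma>)"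
        using jvc[OF j \<sigma>1(1)] by simp
      moreover have "0 \<le> E * hnorm Y (T \<sigma> x)"
        using E TxN by simp
      ultimately show "(cmod (\<sigma> - p) ^ N * cmod (a j)) * hnorm X (j - v j \<sigma>)
          \<le> (E * hnorm Y (T \<sigma> x)) * max 0 (M j)"
        by (intro mult_mono[OF aj[OF j]])
    qed
    finally have w_le: "cmod (\<sigma> - p) ^ N * hnorm X w \<le> (\<Sum>j\<in>J. E * max 0 (M j)) * hnorm Y (T \<sigma> x)"
      by (simp add: sum_distrib_left sum_distrib_right mult_ac)
    have "cmod (\<sigma> - p) ^ N * hnorm X x \<le> cmod (\<sigma> - p) ^ N * (hnorm X v' + hnorm X w)"
      unfolding x_eq by (intro mult_left_mono X.hnorm_triangle v'X wc) auto
    also have "\<dots> \<le> 1 * hnorm X v' + cmod (\<sigma> - p) ^ N * hnorm X w"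
      unfolding distrib_left using \<sigma>le v'X by (intro add_mono mult_right_mono order_refl) auto
    also have "\<dots> \<le> F * hnorm Y (T \<sigma> x)"
      using v'_le w_le by (simp add: F_def distrib_right)
    finally show ?thesis .
  qed
  with s F show ?thesis
    using that by blast
qed

text \<open>
  The lower bound shows that the solution grows at most like a power of \<open>1 / |\<sigma> - p|\<close>; being holomorphic
  away from \<open>p\<close>, it has a pole of finite order.
\<close>

theorem fredholm_solution_meromorphic:
  assumes V: "open V" "p \<in> V" and T: "holo_family V X Y T" and fred: "fredholm_op (carr X) Y (T p)"
    and inj: "\<And>\<sigma> u. \<sigma> \<in> V - {p} \<Longrightarrow> u \<in> carr X \<Longrightarrow> T \<sigma> u = 0 \<Longrightarrow> u = 0"
    and surj: "\<And>\<sigma> y. \<sigma> \<in> V - {p} \<Longrightarrow> y \<in> carr Y \<Longrightarrow> \<exists>u\<in>carr X. T \<sigma> u = y"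
    and g: "holo_into V Y g"
    and x: "\<And>\<sigma>. \<sigma> \<in> V - {p} \<Longrightarrow> x \<sigma> \<in> carr X" "\<And>\<sigma>. \<sigma> \<in> V - {p} \<Longrightarrow> T \<sigma> (x \<sigma>) = g \<sigma>"
  shows "\<exists>a. has_principal_part X x p a"
proof -
  obtain r where r: "r > 0" "ball p r \<subseteq> V"
    using V open_contains_ball by metis
  obtain N C s where s: "0 < s" "s \<le> r" "0 \<le> C"
    and low: "\<And>\<sigma> u. \<sigma> \<in> ball p s - {p} \<Longrightarrow> u \<in> carr X \<Longrightarrow>
      cmod (\<sigma> - p) ^ N * hnorm X u \<le> C * hnorm Y (T \<sigma> u)"
    by (rule fredholm_lower_bound[OF r(1) holo_family_subset[OF T r(2)] fred inj])
      (use r(2) that in auto)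
  have sV: "ball p s \<subseteq> V"
    using s r by force
  have op: "open (ball p s - {p})"
    by blast
  have sub: "ball p s - {p} \<subseteq> V"
    using sV by blast
  have x_holo: "holo_into (ball p s - {p}) X x"
  proof (rule holo_solution[OF op holo_family_subset[OF T sub] holo_into_subset[OF g sub]])
    fix z assume z: "z \<in> ball p s - {p}"
    define e where "e = cmod (z - p) / 2"
    have e: "e > 0"
      using z by (simp add: e_def)
    have "((\<lambda>w. cmod (w - p)) \<longlongrightarrow> cmod (z - p)) (nhds z)"
      by (intro tendsto_intros filterlim_ident)
    then have "\<forall>\<^sub>F w in nhds z. e < cmod (w - p)"
      by (rule order_tendstoD) (use e in \<open>simp add: e_def\<close>)
    with eventually_nhds_in_open[OF op z]
    have "\<forall>\<^sub>F w in nhds z. \<forall>u\<in>carr X. hnorm X u \<le> (C / e ^ N) * hnorm Y (T w u)"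
    proof eventually_elim
      case (elim w)
      show ?case
      proof
        fix u assume u: "u \<in> carr X"
        have "e ^ N * hnorm X u \<le> cmod (w - p) ^ N * hnorm X u"
          using elim e u by (intro mult_right_mono power_mono) auto
        also have "\<dots> \<le> C * hnorm Y (T w u)"
          using low elim u by blast
        finally show "hnorm X u \<le> (C / e ^ N) * hnorm Y (T w u)"
          using e by (simp add: field_simps)
      qed
    qed
    then show "\<exists>K. \<forall>\<^sub>F w in nhds z. \<forall>u\<in>carr X. hnorm X u \<le> K * hnorm Y (T w u)"
      by blast
  qed (use x surj sub in auto)
  obtain M where M: "\<forall>\<^sub>F w in nhds p. hnorm Y (g w) \<le> M"
    using Y.holo_into_bounded[OF V(1) g V(2)] by blast
  then have M': "\<forall>\<^sub>F w in at p. hnorm Y (g w) \<le> M"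
    by (simp add: eventually_at_filter eventually_mono)
  have ps: "p \<in> ball p s"
    using s by simp
  have "\<forall>\<^sub>F w in at p. cmod (w - p) ^ N * hnorm X (x w) \<le> C * M"
    using M' eventually_at_in_open[OF open_ball ps]
  proof eventually_elim
    case (elim w)
    then have w: "w \<in> V - {p}"
      using sV by blast
    have "cmod (w - p) ^ N * hnorm X (x w) \<le> C * hnorm Y (g w)"
      using low[OF elim(2) x(1)[OF w]] x(2)[OF w] by simp
    also have "\<dots> \<le> C * M"
      using elim s by (intro mult_left_mono) auto
    finally show ?case .
  qed
  then show ?thesis
    by (rule X.principal_part_if_bounded[OF open_ball ps x_holo])
qed

end

section \<open>Crossing a regular closed curve\<close>

definition C1_curve :: "(real \<Rightarrow> complex) \<Rightarrow> (real \<Rightarrow> complex) \<Rightarrow> bool" where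
  "C1_curve \<gamma> \<gamma>' \<longleftrightarrow> (\<forall>t. (\<gamma> has_vector_derivative \<gamma>' t) (at t)) \<and> continuous_on UNIV \<gamma>'"

lemma smooth_C1_curve:
  assumes "smooth_on UNIV \<gamma>"
  shows "C1_curve \<gamma> (\<lambda>t. vector_derivative \<gamma> (at t))"
proof -
  have "Ck_on (Suc 0) UNIV \<gamma>"
    using assms unfolding smooth_on_def by blast
  then have 1: "\<gamma> differentiable (at t)" and 2: "continuous_on UNIV (\<lambda>t. frechet_derivative \<gamma> (at t) 1)" for t
    by simp_all
  have "frechet_derivative \<gamma> (at t) 1 = vector_derivative \<gamma> (at t)" for t
    using frechet_derivative_eq_vector_derivative[OF 1[of t]] by simp
  then show ?thesis
    using 1 2 vector_derivative_works by (auto simp: C1_curve_def)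
qed

lemma C1_curve_valid_path: "C1_curve \<gamma> \<gamma>' \<Longrightarrow> valid_path \<gamma>"
  unfolding C1_curve_def valid_path_def
  by (intro C1_differentiable_imp_piecewise)
    (auto simp: C1_differentiable_on_def intro: continuous_on_subset)

lemma C1_curve_shift: "C1_curve \<gamma> \<gamma>' \<Longrightarrow> C1_curve (\<lambda>t. \<gamma> (\<tau> + t)) (\<lambda>t. \<gamma>' (\<tau> + t))"
  unfolding C1_curve_def
proof (intro conjI allI)
  assume C: "(\<forall>t. (\<gamma> has_vector_derivative \<gamma>' t) (at t)) \<and> continuous_on UNIV \<gamma>'"
  show "((\<lambda>t. \<gamma> (\<tau> + t)) has_vector_derivative \<gamma>' (\<tau> + t)) (at t)" for t
  proof -
    have "((\<lambda>t. \<tau> + t) has_vector_derivative 1) (at t)"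
      by (auto intro!: derivative_eq_intros)
    moreover have "(\<gamma> has_vector_derivative \<gamma>' (\<tau> + t)) (at (\<tau> + t))"
      using C by blast
    ultimately show ?thesis
      using vector_diff_chain_at[of "\<lambda>t. \<tau> + t" 1 t \<gamma> "\<gamma>' (\<tau> + t)"] by (simp add: o_def)
  qed
  show "continuous_on UNIV (\<lambda>t. \<gamma>' (\<tau> + t))"
    using C[THEN conjunct2] by (rule continuous_on_compose2) (auto intro!: continuous_intros)
qed

text \<open>
  A boundary curve is reparametrized so that the point under consideration has parameter \<open>1/2\<close>, which keeps a
  neighbourhood of it inside the parameter interval.
\<close>

locale regular_closed_curve =
  fixes \<beta> \<beta>' :: "real \<Rightarrow> complex"
  assumes C1: "C1_curve \<beta> \<beta>'" and closed: "\<beta> 1 = \<beta> 0"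
    and inj: "inj_on \<beta> {0..<1}" and regular: "\<beta>' (1/2) \<noteq> 0"
begin

text \<open>
  In the coordinate \<open>k\<close> the point \<open>a\<close> is the origin, and the tangent \<open>d\<close> of the curve there points along the
  positive real axis.
\<close>

definition a where "a = \<beta> (1/2)"
definition d where "d = \<beta>' (1/2)"
definition k where "k x = (\<beta> x - a) / d"

lemma d_nz: "d \<noteq> 0"
  using regular by (simp add: d_def)

lemma \<beta>_eq: "\<beta> x = a + d * k x"
  using d_nz by (simp add: k_def)

lemma k_half [simp]: "k (1/2) = 0"
  by (simp add: k_def a_def)

lemma \<beta>_continuous: "continuous_on S \<beta>"
  using C1 unfolding C1_curve_def
  by (metis continuous_at_imp_continuous_on has_vector_derivative_continuous)

lemma path: "path \<beta>" and valid: "valid_path \<beta>"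
  using C1_curve_valid_path[OF C1] by (auto simp: valid_path_imp_path)

text \<open>
  The derivative of \<open>k x - x\<close> vanishes at the midpoint, so near it the curve is a graph over its tangent.
\<close>

lemma chart:
  obtains \<delta> where "0 < \<delta>" "\<delta> < 1/2"
    "\<And>x y. \<bar>x - 1/2\<bar> \<le> \<delta> \<Longrightarrow> \<bar>y - 1/2\<bar> \<le> \<delta> \<Longrightarrow> cmod (k x - k y - of_real (x - y)) \<le> \<bar>x - y\<bar> / 2"
proof -
  have "continuous_on UNIV \<beta>'"
    using C1 by (simp add: C1_curve_def)
  then have "(\<beta>' \<longlongrightarrow> \<beta>' (1/2)) (nhds (1/2))"
    by (simp add: continuous_on_eq_continuous_at isCont_def tendsto_at_iff_tendsto_nhds)
  then have "((\<lambda>x. cmod (\<beta>' x / d - 1)) \<longlongrightarrow> cmod (\<beta>' (1/2) / d - 1)) (nhds (1/2))"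
    using d_nz by (intro tendsto_intros) auto
  then have "\<forall>\<^sub>F x in nhds (1/2). cmod (\<beta>' x / d - 1) < 1/2"
    by (rule order_tendstoD) (use d_nz in \<open>simp add: d_def\<close>)
  then obtain e where e: "e > 0" "\<And>x. dist x (1/2) < e \<Longrightarrow> cmod (\<beta>' x / d - 1) < 1/2"
    unfolding eventually_nhds_metric by blast
  define \<delta> where "\<delta> = min (e / 2) (1/4)"
  have "cmod (k x - k y - of_real (x - y)) \<le> \<bar>x - y\<bar> / 2"
    if "\<bar>x - 1/2\<bar> \<le> \<delta>" "\<bar>y - 1/2\<bar> \<le> \<delta>" for x y
  proof -
    let ?q = "\<lambda>x. k x - of_real x"
    have "cmod (?q x - ?q y) \<le> 1/2 * norm (x - y)"
    proof (rule differentiable_bound)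
      fix t assume t: "t \<in> {1/2 - \<delta> .. 1/2 + \<delta>}"
      have "(?q has_vector_derivative (\<beta>' t / d - 1)) (at t)"
      proof -
        have "(\<beta> has_vector_derivative \<beta>' t) (at t)"
          using C1 by (simp add: C1_curve_def)
        then have "((\<lambda>t. \<beta> t - a) has_vector_derivative (\<beta>' t - 0)) (at t)"
          by (intro derivative_intros)
        then have "((\<lambda>t. (\<beta> t - a) / d) has_vector_derivative \<beta>' t / d) (at t)"
          using has_vector_derivative_divide[of "\<lambda>t. \<beta> t - a" "\<beta>' t" "at t" d] by simp
        then show ?thesis
          unfolding k_def
          by (intro has_vector_derivative_diff) (auto intro!: derivative_eq_intros has_vector_derivative_of_real)
      qed
      then show "(?q has_derivative (\<lambda>h. h *\<^sub>R (\<beta>' t / d - 1))) (at t within {1/2 - \<delta> .. 1/2 + \<delta>})"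
        unfolding has_vector_derivative_def by (rule has_derivative_at_withinI)
      show "onorm (\<lambda>h. h *\<^sub>R (\<beta>' t / d - 1)) \<le> 1/2"
      proof (rule onorm_le)
        fix h :: real
        have "dist t (1/2) < e"
          using t e by (auto simp: \<delta>_def dist_real_def abs_if)
        then have "cmod (\<beta>' t / d - 1) \<le> 1/2"
          using e(2)[of t] by simp
        then show "norm (h *\<^sub>R (\<beta>' t / d - 1)) \<le> 1/2 * norm h"
          using mult_left_mono[of "cmod (\<beta>' t / d - 1)" "1/2" "\<bar>h\<bar>"] by simp
      qed
    qed (use that in \<open>auto simp: abs_le_iff\<close>)
    then show ?thesis
      by (simp add: algebra_simps)
  qed
  then show ?thesis
    using that[of \<delta>] e by (auto simp: \<delta>_def)
qed

lemma midpoint_simple: "\<beta> x \<noteq> a" if "x \<in> {0..1}" "x \<noteq> 1/2"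
proof (cases "x = 1")
  case True
  then show ?thesis
    using closed inj_onD[OF inj, of 0 "1/2"] by (auto simp: a_def)
next
  case False
  then show ?thesis
    using that inj_onD[OF inj, of x "1/2"] by (auto simp: a_def)
qed

text \<open>
  Let \<open>z\<close> be the point at distance \<open>s |d|\<close> from \<open>a\<close> on the left normal (\<open>\<epsilon> = 1\<close>) or on the right
  normal (\<open>\<epsilon> = -1\<close>). Close to \<open>a\<close> the curve does not meet the part of the normal beyond \<open>z\<close>, so a
  branch of the logarithm cut along that ray is a primitive of \<open>1 / (\<zeta> - z)\<close> on the arc.
\<close>

lemma near_arc_winding:
  fixes s \<delta> \<epsilon> :: real
  assumes s: "s > 0" and \<delta>: "0 < \<delta>" "\<delta> < 1/2"
    and chart: "\<And>x y. \<bar>x - 1/2\<bar> \<le> \<delta> \<Longrightarrow> \<bar>y - 1/2\<bar> \<le> \<delta> \<Longrightarrow> cmod (k x - k y - of_real (x - y)) \<le> \<bar>x - y\<bar> / 2"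
    and \<epsilon>: "\<epsilon> = 1 \<or> \<epsilon> = - 1"
  shows "winding_number (subpath (1/2 - \<delta>) (1/2 + \<delta>) \<beta>) (a + of_real \<epsilon> * of_real s * \<i> * d) =
    1 / (2 * pi * \<i>) * (Ln (of_real s + of_real \<epsilon> * \<i> * k (1/2 + \<delta>)) - Ln (of_real s + of_real \<epsilon> * \<i> * k (1/2 - \<delta>)))"
proof -
  define z where "z = a + of_real \<epsilon> * of_real s * \<i> * d"
  let ?g = "subpath (1/2 - \<delta>) (1/2 + \<delta>) \<beta>"
  define E where "E = complex_of_real \<epsilon> * \<i> / d"
  define S where "S = {\<zeta>. E * (\<zeta> - z) \<notin> \<real>\<^sub>\<le>\<^sub>0}"
  have E: "E \<noteq> 0"
    using d_nz \<epsilon> by (auto simp: E_def)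
  have ee: "complex_of_real \<epsilon> * complex_of_real \<epsilon> = 1"
    using \<epsilon> by auto
  have val: "E * (\<beta> x - z) = of_real s + of_real \<epsilon> * \<i> * k x" for x
  proof -
    have "\<beta> x - z = d * (k x - of_real \<epsilon> * of_real s * \<i>)"
      by (simp add: \<beta>_eq z_def algebra_simps)
    then have "E * (\<beta> x - z) = of_real \<epsilon> * \<i> * k x - (of_real \<epsilon> * of_real \<epsilon>) * of_real s * (\<i> * \<i>)"
      using d_nz by (simp add: E_def right_diff_distrib mult_ac)
    then show ?thesis
      by (simp add: ee)
  qed
  have img: "path_image ?g = \<beta> ` {1/2 - \<delta> .. 1/2 + \<delta>}"
    using \<delta> by (simp add: path_image_subpath)
  have "\<beta> x \<in> S" if x: "\<bar>x - 1/2\<bar> \<le> \<delta>" for x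
  proof -
    have "of_real s + of_real \<epsilon> * \<i> * k x \<notin> \<real>\<^sub>\<le>\<^sub>0"
    proof
      assume neg: "of_real s + of_real \<epsilon> * \<i> * k x \<in> \<real>\<^sub>\<le>\<^sub>0"
      have "Im (of_real s + of_real \<epsilon> * \<i> * k x) = \<epsilon> * Re (k x)"
        by simp
      then have "Re (k x) = 0"
        using neg \<epsilon> by (auto simp: complex_nonpos_Reals_iff)
      moreover have "\<bar>Re (k x - k (1/2) - of_real (x - 1/2))\<bar> \<le> \<bar>x - 1/2\<bar> / 2"
        by (rule order_trans[OF abs_Re_le_cmod chart[OF x]]) (use \<delta> in simp)
      ultimately have "x = 1/2"
        by (simp add: abs_if split: if_splits)
      then have "k x = k (1/2)"
        by (rule arg_cong)
      then show False
        using neg s by (simp add: complex_nonpos_Reals_iff)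
    qed
    then show ?thesis
      by (simp add: S_def val)
  qed
  then have gS: "path_image ?g \<subseteq> S"
    unfolding img by (auto simp: abs_le_iff)
  have vp: "valid_path ?g"
    using valid \<delta> by (intro valid_path_subpath) auto
  have "((\<lambda>\<zeta>. 1 / (\<zeta> - z)) has_contour_integral
      (Ln (E * (pathfinish ?g - z)) - Ln (E * (pathstart ?g - z)))) ?g"
  proof (rule contour_integral_primitive[OF _ vp gS, where f = "\<lambda>\<zeta>. Ln (E * (\<zeta> - z))"])
    fix \<zeta> assume \<zeta>: "\<zeta> \<in> S"
    then have "\<zeta> - z \<noteq> 0"
      by (auto simp: S_def)
    then show "((\<lambda>\<zeta>. Ln (E * (\<zeta> - z))) has_field_derivative 1 / (\<zeta> - z)) (at \<zeta> within S)"
      using \<zeta> E by (auto intro!: derivative_eq_intros simp: S_def) (simp add: field_simps)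
  qed
  then have "contour_integral ?g (\<lambda>\<zeta>. 1 / (\<zeta> - z)) =
      Ln (of_real s + of_real \<epsilon> * \<i> * k (1/2 + \<delta>)) - Ln (of_real s + of_real \<epsilon> * \<i> * k (1/2 - \<delta>))"
    by (simp add: contour_integral_unique val)
  moreover have "z \<notin> path_image ?g"
    using gS by (auto simp: S_def)
  ultimately show ?thesis
    using winding_number_valid_path[OF vp, of z] by (simp add: z_def)
qed

text \<open>
  Translating a short arc of the curve through \<open>a\<close> by small multiples of \<open>\<i> d\<close> covers a neighbourhood of
  \<open>a\<close>. The translates to the left form a connected set, and so do those to the right; neither set meets the
  arc, which is a graph over its tangent, and the rest of the boundary keeps a positive distance from \<open>a\<close>. The set \<open>F\<close> stands for the other boundary curves.
\<close>

lemma two_sides: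
  assumes F: "closed F" "a \<notin> F"
  obtains U V \<epsilon> \<eta> where "connected U" "connected V"
    "U \<inter> (path_image \<beta> \<union> F) = {}" "V \<inter> (path_image \<beta> \<union> F) = {}" "0 < \<epsilon>" "0 < \<eta>"
    "ball a \<epsilon> \<subseteq> path_image \<beta> \<union> U \<union> V"
    "\<And>s. 0 < s \<Longrightarrow> s < \<eta> \<Longrightarrow> a + of_real s * \<i> * d \<in> U"
    "\<And>s. 0 < s \<Longrightarrow> s < \<eta> \<Longrightarrow> a - of_real s * \<i> * d \<in> V"
proof -
  obtain \<delta> where \<delta>: "0 < \<delta>" "\<delta> < 1/2" and chart:
    "\<And>x y. \<bar>x - 1/2\<bar> \<le> \<delta> \<Longrightarrow> \<bar>y - 1/2\<bar> \<le> \<delta> \<Longrightarrow> cmod (k x - k y - of_real (x - y)) \<le> \<bar>x - y\<bar> / 2"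
    using chart by blast
  define F' where "F' = \<beta> ` ({0..1/2 - \<delta>} \<union> {1/2 + \<delta>..1}) \<union> F"
  have "compact (\<beta> ` ({0..1/2 - \<delta>} \<union> {1/2 + \<delta>..1}))"
    by (intro compact_continuous_image \<beta>_continuous compact_Un) auto
  then have "closed F'"
    unfolding F'_def by (intro closed_Un[OF compact_imp_closed F(1)])
  moreover have "a \<notin> F'"
  proof -
    have "\<beta> x \<noteq> a" if "x \<in> {0..1/2 - \<delta>} \<union> {1/2 + \<delta>..1}" for x
      using that \<delta> by (intro midpoint_simple) auto
    then show ?thesis
      using F unfolding F'_def by (metis Un_iff imageE)
  qed
  ultimately obtain r where r: "r > 0" "ball a r \<subseteq> - F'"
    using open_contains_ball[of "- F'"] by (auto simp: open_Compl)
  \<comment> \<open>Translates by less than \<open>\<eta>\<close> of the arc of parameter radius \<open>\<eta>\<close> stay within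
    \<open>(3/2 + 1) \<eta> |d|\<close> of \<open>a\<close>, away from \<open>F'\<close>.\<close>
  define \<eta> where "\<eta> = min \<delta> (r / (3 * cmod d))"
  have \<eta>: "0 < \<eta>" "\<eta> \<le> \<delta>" "3 * cmod d * \<eta> \<le> r"
    using \<delta> r d_nz by (auto simp: \<eta>_def min_def field_simps)
  define P where "P = (\<lambda>(t, s). \<beta> t + of_real s * \<i> * d)"
  have kt: "cmod (k t) \<le> 3/2 * \<bar>t - 1/2\<bar>" if "\<bar>t - 1/2\<bar> \<le> \<delta>" for t
  proof -
    have "cmod (k t - k (1/2) - of_real (t - 1/2)) \<le> \<bar>t - 1/2\<bar> / 2"
      using chart[OF that, of "1/2"] \<delta> by simp
    then have "cmod (k t) - cmod (of_real (t - 1/2)) \<le> \<bar>t - 1/2\<bar> / 2"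
      using norm_triangle_ineq2[of "k t" "of_real (t - 1/2)"] by (simp del: of_real_diff)
    then show ?thesis
      by (simp del: of_real_diff)
  qed
  have off: "P (t, s) \<notin> path_image \<beta> \<union> F" if t: "\<bar>t - 1/2\<bar> < \<eta>" and s: "\<bar>s\<bar> < \<eta>" "s \<noteq> 0" for t s
  proof -
    have t\<delta>: "\<bar>t - 1/2\<bar> \<le> \<delta>"
      using t \<eta> by simp
    have eq: "P (t, s) - a = d * (k t + of_real s * \<i>)"
      by (simp add: P_def \<beta>_eq algebra_simps)
    have "cmod (k t + of_real s * \<i>) \<le> cmod (k t) + \<bar>s\<bar>"
      using norm_triangle_ineq[of "k t" "of_real s * \<i>"] by (simp add: norm_mult)
    also have "\<dots> < 3 * \<eta>"
    proof -
      have "3/2 * \<bar>t - 1/2\<bar> < 3/2 * \<eta>"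
        using t by simp
      then show ?thesis
        using kt[OF t\<delta>] s(1) \<eta>(1) by linarith
    qed
    finally have "cmod (P (t, s) - a) < cmod d * (3 * \<eta>)"
      unfolding eq norm_mult using d_nz by simp
    then have "P (t, s) \<in> ball a r"
      using \<eta> by (simp add: dist_norm norm_minus_commute mult_ac)
    then have nF: "P (t, s) \<notin> F'"
      using r by blast
    have "P (t, s) \<noteq> \<beta> x" if x: "\<bar>x - 1/2\<bar> \<le> \<delta>" for x
    proof
      assume "P (t, s) = \<beta> x"
      then have "d * k x = d * (k t + of_real s * \<i>)"
        using eq by (metis \<beta>_eq add_diff_cancel_left')
      then have kx: "k x = k t + of_real s * \<i>"
        using d_nz by simp
      have "\<bar>Re (k x - k t - of_real (x - t))\<bar> \<le> \<bar>x - t\<bar> / 2"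
        by (rule order_trans[OF abs_Re_le_cmod chart[OF x t\<delta>]])
      then have "x = t"
        by (simp add: kx abs_if split: if_splits)
      then show False
        using kx s by simp
    qed
    moreover have "x \<in> {0..1/2 - \<delta>} \<union> {1/2 + \<delta>..1} \<or> \<bar>x - 1/2\<bar> \<le> \<delta>" if "x \<in> {0..1}" for x
      using that by (auto simp: abs_le_iff)
    ultimately show ?thesis
      using nF unfolding F'_def path_image_def by blast
  qed
  define U where "U = P ` ({1/2 - \<eta> <..< 1/2 + \<eta>} \<times> {0 <..< \<eta>})"
  define V where "V = P ` ({1/2 - \<eta> <..< 1/2 + \<eta>} \<times> {- \<eta> <..< 0})"
  have contP: "continuous_on S P" for S
    unfolding P_def case_prod_unfold
    by (intro continuous_intros continuous_on_compose2[OF \<beta>_continuous[of UNIV]]) auto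
  have conn: "connected U" "connected V"
    unfolding U_def V_def
    by (intro connected_continuous_image contP connected_Times; simp)+
  have disj: "U \<inter> (path_image \<beta> \<union> F) = {}" "V \<inter> (path_image \<beta> \<union> F) = {}"
  proof -
    have "P (t, s) \<notin> path_image \<beta> \<union> F"
      if "t \<in> {1/2 - \<eta> <..< 1/2 + \<eta>}" "s \<in> {0 <..< \<eta>} \<or> s \<in> {- \<eta> <..< 0}" for t s
      using that by (intro off) (auto simp: abs_less_iff)
    then show "U \<inter> (path_image \<beta> \<union> F) = {}" "V \<inter> (path_image \<beta> \<union> F) = {}"
      unfolding U_def V_def by blast+
  qed
  \<comment> \<open>The real part of \<open>k\<close> takes at least all values up to \<open>\<eta> / 8\<close> in size on the arc of parameter radius
    \<open>\<eta> / 4\<close>.\<close>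
  define \<epsilon> where "\<epsilon> = cmod d * \<eta> / 8"
  have \<epsilon>: "\<epsilon> > 0"
    using \<eta> d_nz by (simp add: \<epsilon>_def)
  have cover: "z \<in> path_image \<beta> \<union> U \<union> V" if z: "z \<in> ball a \<epsilon>" for z
  proof -
    define \<zeta> where "\<zeta> = (z - a) / d"
    have z_eq: "z = a + d * \<zeta>"
      using d_nz by (simp add: \<zeta>_def)
    have "cmod (z - a) < cmod d * \<eta> / 8"
      using z by (simp add: \<epsilon>_def dist_norm norm_minus_commute)
    then have \<zeta>: "cmod \<zeta> < \<eta> / 8"
      using d_nz by (simp add: \<zeta>_def norm_divide field_simps)
    have bd: "\<bar>x - 1/2\<bar> \<le> \<delta>" if "x \<in> {1/2 - \<eta>/4 .. 1/2 + \<eta>/4}" for x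
      using that \<eta> by (auto simp: abs_le_iff)
    have Rek: "\<bar>Re (k x) - (x - 1/2)\<bar> \<le> \<bar>x - 1/2\<bar> / 2" if "x \<in> {1/2 - \<eta>/4 .. 1/2 + \<eta>/4}" for x
    proof -
      have "\<bar>Re (k x - k (1/2) - of_real (x - 1/2))\<bar> \<le> \<bar>x - 1/2\<bar> / 2"
        by (rule order_trans[OF abs_Re_le_cmod chart[OF bd[OF that]]]) (use \<delta> in simp)
      then show ?thesis
        by simp
    qed
    have "\<exists>t\<ge>1/2 - \<eta>/4. t \<le> 1/2 + \<eta>/4 \<and> Re (k t) = Re \<zeta>"
    proof (rule IVT')
      have \<zeta>R: "\<bar>Re \<zeta>\<bar> < \<eta> / 8"
        using \<zeta> abs_Re_le_cmod[of \<zeta>] by linarith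
      show "Re (k (1/2 - \<eta>/4)) \<le> Re \<zeta>"
        using Rek[of "1/2 - \<eta>/4"] \<eta> \<zeta>R by (simp add: abs_if split: if_splits)
      show "Re \<zeta> \<le> Re (k (1/2 + \<eta>/4))"
        using Rek[of "1/2 + \<eta>/4"] \<eta> \<zeta>R by (simp add: abs_if split: if_splits)
      show "continuous_on {1/2 - \<eta>/4 .. 1/2 + \<eta>/4} (\<lambda>x. Re (k x))"
        unfolding k_def using d_nz by (intro continuous_intros \<beta>_continuous ballI)
    qed (use \<eta> in simp)
    then obtain t where t: "t \<in> {1/2 - \<eta>/4 .. 1/2 + \<eta>/4}" "Re (k t) = Re \<zeta>"
      by auto
    define s where "s = Im \<zeta> - Im (k t)"
    have zP: "z = P (t, s)"
    proof -
      have "\<zeta> = k t + of_real s * \<i>"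
        using t by (simp add: complex_eq_iff s_def)
      then show ?thesis
        by (simp add: z_eq P_def \<beta>_eq algebra_simps)
    qed
    have "cmod (k t) \<le> 3/2 * (\<eta>/4)"
      using kt[OF bd[OF t(1)]] t(1) by (simp add: abs_if split: if_splits)
    then have "\<bar>s\<bar> < \<eta>"
      using \<zeta> abs_Im_le_cmod[of \<zeta>] abs_Im_le_cmod[of "k t"] \<eta> by (simp add: s_def)
    moreover have "t \<in> {1/2 - \<eta> <..< 1/2 + \<eta>}"
      using t \<eta> by auto
    moreover have "t \<in> {0..1}"
      using t \<eta> \<delta> by auto
    then have "s = 0 \<Longrightarrow> z \<in> path_image \<beta>"
      by (simp add: zP P_def path_image_def)
    ultimately show ?thesis
      unfolding U_def V_def using zP by (cases "s > 0"; cases "s = 0") auto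
  qed
  have "a + of_real s * \<i> * d \<in> U" "a - of_real s * \<i> * d \<in> V" if "0 < s" "s < \<eta>" for s
  proof -
    have "(1/2, s) \<in> {1/2 - \<eta> <..< 1/2 + \<eta>} \<times> {0 <..< \<eta>}"
      "(1/2, - s) \<in> {1/2 - \<eta> <..< 1/2 + \<eta>} \<times> {- \<eta> <..< 0}"
      using that by auto
    then have "P (1/2, s) \<in> U" "P (1/2, - s) \<in> V"
      unfolding U_def V_def by blast+
    then show "a + of_real s * \<i> * d \<in> U" "a - of_real s * \<i> * d \<in> V"
      by (simp_all add: P_def a_def)
  qed
  then show ?thesis
    using that[of U V \<epsilon> \<eta>] conn disj \<epsilon> \<eta>(1) cover by blast
qed

text \<open>
  Split off a short arc around \<open>a\<close>. The rest of the curve contributes a function that is continuous at \<open>a\<close>. The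
  contributions of the arc from the two sides are given by two branches of the logarithm, which differ by \<open>\<i> \<pi>\<close>
  at one end of the arc and by \<open>- \<i> \<pi>\<close> at the other.
\<close>

lemma winding_number_jump:
  "((\<lambda>s. winding_number \<beta> (a + of_real s * \<i> * d) - winding_number \<beta> (a - of_real s * \<i> * d)) \<longlongrightarrow> 1)
    (at_right 0)"
proof -
  obtain \<delta> where \<delta>: "0 < \<delta>" "\<delta> < 1/2" and chart:
    "\<And>x y. \<bar>x - 1/2\<bar> \<le> \<delta> \<Longrightarrow> \<bar>y - 1/2\<bar> \<le> \<delta> \<Longrightarrow> cmod (k x - k y - of_real (x - y)) \<le> \<bar>x - y\<bar> / 2"
    using chart by blast
  let ?u = "1/2 - \<delta>" and ?v = "1/2 + \<delta>"
  let ?p = "\<lambda>s. a + of_real s * \<i> * d" and ?m = "\<lambda>s. a - of_real s * \<i> * d"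
  let ?wn = "\<lambda>x y z. winding_number (subpath x y \<beta>) z"
  have uv: "?u \<in> {0..1}" "?v \<in> {0..1}"
    using \<delta> by auto
  obtain U V \<epsilon> \<eta> where off: "U \<inter> path_image \<beta> = {}" "V \<inter> path_image \<beta> = {}" "0 < \<eta>"
    "\<And>s. 0 < s \<Longrightarrow> s < \<eta> \<Longrightarrow> ?p s \<in> U" "\<And>s. 0 < s \<Longrightarrow> s < \<eta> \<Longrightarrow> ?m s \<in> V"
    by (rule two_sides[of "{}"]) auto
  have split: "winding_number \<beta> z = ?wn 0 ?u z + ?wn ?u ?v z + ?wn ?v 1 z" if "z \<notin> path_image \<beta>" for z
    using winding_number_subpath_combine[OF path that, of 0 ?u ?v]
      winding_number_subpath_combine[OF path that, of 0 ?v 1] uv by simp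
  have far: "(\<lambda>s. ?wn x y (?p s) - ?wn x y (?m s)) \<midarrow>0\<rightarrow> 0"
    if "x \<in> {0..1}" "y \<in> {0..1}" "a \<notin> path_image (subpath x y \<beta>)" for x y
  proof -
    have c: "isCont (?wn x y) a"
      using that path by (intro continuous_at_winding_number) (auto simp: path_subpath)
    have "isCont (\<lambda>s. ?wn x y (?p s)) 0" "isCont (\<lambda>s. ?wn x y (?m s)) 0"
      by (rule isCont_o2[of _ _ "?wn x y"]; use c in \<open>auto intro!: continuous_intros\<close>)+
    then have "isCont (\<lambda>s. ?wn x y (?p s) - ?wn x y (?m s)) 0"
      by (intro continuous_intros)
    then show ?thesis
      by (simp add: isCont_def)
  qed
  have far': "((\<lambda>s. ?wn x y (?p s) - ?wn x y (?m s)) \<longlongrightarrow> 0) (at_right 0)"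
    if "x \<in> {0..1}" "y \<in> {0..1}" "a \<notin> path_image (subpath x y \<beta>)" for x y
    using far[OF that] filterlim_at_split by blast
  have a1: "a \<notin> path_image (subpath 0 ?u \<beta>)" and a2: "a \<notin> path_image (subpath ?v 1 \<beta>)"
  proof -
    have "\<beta> x \<noteq> a" if "x \<in> {0..1/2 - \<delta>} \<union> {1/2 + \<delta>..1}" for x
      using that \<delta> by (intro midpoint_simple) auto
    then have "a \<notin> \<beta> ` ({0..1/2 - \<delta>} \<union> {1/2 + \<delta>..1})"
      by (metis imageE)
    then show "a \<notin> path_image (subpath 0 ?u \<beta>)" "a \<notin> path_image (subpath ?v 1 \<beta>)"
      using \<delta> by (simp_all add: path_image_subpath image_Un)
  qed
  define A B where "A = \<i> * k ?v" and "B = \<i> * k ?u"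
  have kR: "\<bar>Re (k x) - (x - 1/2)\<bar> \<le> \<bar>x - 1/2\<bar> / 2" if x: "\<bar>x - 1/2\<bar> \<le> \<delta>" for x
  proof -
    have "\<bar>Re (k x - k (1/2) - of_real (x - 1/2))\<bar> \<le> \<bar>x - 1/2\<bar> / 2"
      by (rule order_trans[OF abs_Re_le_cmod chart[OF x]]) (use \<delta> in simp)
    then show ?thesis by simp
  qed
  have "Re (k ?v) > 0" "Re (k ?u) < 0"
    using kR[of ?v] kR[of ?u] \<delta> by (auto simp: abs_if split: if_splits)
  then have AB: "Im A > 0" "Im B < 0"
    by (auto simp: A_def B_def)
  define J where "J s = 1 / (2 * pi * \<i>) * ((Ln (of_real s + A) - Ln (of_real s + B)) -
      (Ln (of_real s + - A) - Ln (of_real s + - B)))" for s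
  have LnC: "isCont (\<lambda>s::real. Ln (of_real s + C)) 0" if "Im C \<noteq> 0" for C
    using that by (intro continuous_intros) (auto simp: complex_nonpos_Reals_iff)
  have "isCont J 0"
    unfolding J_def using AB by (intro continuous_intros LnC) auto
  moreover have "J 0 = 1"
  proof -
    have "A \<noteq> 0" "B \<noteq> 0"
      using AB by auto
    then have "Ln (- A) = Ln A - \<i> * pi" "Ln (- B) = Ln B + \<i> * pi"
      using AB by (auto simp: Ln_minus)
    then show ?thesis
      by (simp add: J_def)
  qed
  ultimately have "J \<midarrow>0\<rightarrow> 1"
    by (simp add: isCont_def)
  then have J: "(J \<longlongrightarrow> 1) (at_right 0)"
    using filterlim_at_split by blast
  have near: "?wn ?u ?v (?p s) - ?wn ?u ?v (?m s) = J s" if "s > 0" for s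
    using near_arc_winding[OF that \<delta> chart, of 1] near_arc_winding[OF that \<delta> chart, of "-1"]
    by (simp add: J_def A_def B_def right_diff_distrib)
  have "((\<lambda>s. (?wn 0 ?u (?p s) - ?wn 0 ?u (?m s)) + J s + (?wn ?v 1 (?p s) - ?wn ?v 1 (?m s)))
      \<longlongrightarrow> 0 + 1 + 0) (at_right 0)"
    by (intro tendsto_add far' J a1 a2) (use uv in auto)
  moreover have "\<forall>\<^sub>F s in at_right 0. (?wn 0 ?u (?p s) - ?wn 0 ?u (?m s)) + J s + (?wn ?v 1 (?p s) - ?wn ?v 1 (?m s))
      = winding_number \<beta> (?p s) - winding_number \<beta> (?m s)"
    using eventually_at_right_real[OF off(3)]
  proof eventually_elim
    case (elim s)
    then have "?p s \<notin> path_image \<beta>" "?m s \<notin> path_image \<beta>"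
      using off by auto
    then show ?case
      using near[of s] elim by (simp add: split)
  qed
  ultimately show ?thesis
    by (simp add: tendsto_cong)
qed

end

section \<open>Winding numbers of an oriented boundary\<close>

lemma shiftpath_periodic:
  assumes "\<And>t. \<gamma> (t + 1) = \<gamma> t"
  shows "shiftpath \<tau> \<gamma> = (\<lambda>t. \<gamma> (\<tau> + t))"
proof
  fix t
  show "shiftpath \<tau> \<gamma> t = \<gamma> (\<tau> + t)"
    using assms[of "\<tau> + t - 1"] by (simp add: shiftpath_def)
qed

lemma smooth_oriented_boundaryD:
  assumes "smooth_oriented_boundary \<Omega> \<Gamma>"
  shows "finite \<Gamma>" and "frontier \<Omega> = (\<Union>\<gamma>\<in>\<Gamma>. path_image \<gamma>)"
    and "\<And>\<gamma> \<delta>. \<gamma> \<in> \<Gamma> \<Longrightarrow> \<delta> \<in> \<Gamma> \<Longrightarrow> \<gamma> \<noteq> \<delta> \<Longrightarrow> path_image \<gamma> \<inter> path_image \<delta> = {}"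
    and "\<And>\<gamma>. \<gamma> \<in> \<Gamma> \<Longrightarrow> smooth_on UNIV \<gamma>" and "\<And>\<gamma> t. \<gamma> \<in> \<Gamma> \<Longrightarrow> \<gamma> (t + 1) = \<gamma> t"
    and "\<And>\<gamma>. \<gamma> \<in> \<Gamma> \<Longrightarrow> inj_on \<gamma> {0..<1}"
    and "\<And>\<gamma> t. \<gamma> \<in> \<Gamma> \<Longrightarrow> vector_derivative \<gamma> (at t) \<noteq> 0"
    and "\<And>\<gamma> t. \<gamma> \<in> \<Gamma> \<Longrightarrow> \<forall>\<^sub>F s in at_right 0.
      \<gamma> t + complex_of_real s * \<i> * vector_derivative \<gamma> (at t) \<in> \<Omega> \<and>
      \<gamma> t - complex_of_real s * \<i> * vector_derivative \<gamma> (at t) \<notin> closure \<Omega>"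
proof -
  note bd = assms[unfolded smooth_oriented_boundary_def]
  note c = bd[THEN conjunct2, THEN conjunct2, THEN conjunct2, THEN bspec]
  show "finite \<Gamma>"
    using bd by (elim conjE)
  show "frontier \<Omega> = (\<Union>\<gamma>\<in>\<Gamma>. path_image \<gamma>)"
    using bd by (elim conjE)
  show "path_image \<gamma> \<inter> path_image \<delta> = {}" if "\<gamma> \<in> \<Gamma>" "\<delta> \<in> \<Gamma>" "\<gamma> \<noteq> \<delta>" for \<gamma> \<delta>
    using bd[THEN conjunct2, THEN conjunct2, THEN conjunct1] that by simp
  show "smooth_on UNIV \<gamma>" if "\<gamma> \<in> \<Gamma>" for \<gamma>
    using c[OF that] by (elim conjE)
  show "inj_on \<gamma> {0..<1}" if "\<gamma> \<in> \<Gamma>" for \<gamma>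
    using c[OF that] by (elim conjE)
  show "\<gamma> (t + 1) = \<gamma> t" if "\<gamma> \<in> \<Gamma>" for \<gamma> t
    using c[OF that, THEN conjunct2, THEN conjunct1] by (rule spec)
  show "vector_derivative \<gamma> (at t) \<noteq> 0" if "\<gamma> \<in> \<Gamma>" for \<gamma> t
    using c[OF that, THEN conjunct2, THEN conjunct2, THEN conjunct2, THEN conjunct1] by (rule spec)
  show "\<forall>\<^sub>F s in at_right 0.
      \<gamma> t + complex_of_real s * \<i> * vector_derivative \<gamma> (at t) \<in> \<Omega> \<and>
      \<gamma> t - complex_of_real s * \<i> * vector_derivative \<gamma> (at t) \<notin> closure \<Omega>" if "\<gamma> \<in> \<Gamma>" for \<gamma> t
    using c[OF that, THEN conjunct2, THEN conjunct2, THEN conjunct2, THEN conjunct2] by (rule spec)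
qed

text \<open>
  Let \<open>m\<close> be the sum of the winding numbers minus the indicator function of \<open>\<Omega>\<close>. It is constant on
  connected sets that avoid the boundary. On crossing a boundary curve from right to left both terms increase by one,
  so \<open>m\<close> has the same value on both sides. Hence \<open>m\<close> is locally constant on the plane, apart from its values on the
  boundary itself, and it vanishes far away.
\<close>

theorem oriented_boundary_winding_number:
  assumes bd: "smooth_oriented_boundary \<Omega> \<Gamma>" and \<Omega>: "open \<Omega>" "bounded \<Omega>" and z: "z \<notin> frontier \<Omega>"
  shows "(\<Sum>\<gamma>\<in>\<Gamma>. winding_number \<gamma> z) = (if z \<in> \<Omega> then 1 else 0)"
proof -
  note D = smooth_oriented_boundaryD[OF bd]
  note fin = D(1) and fr = D(2) and dis = D(3) and curve = D(4-7) and orient = D(8)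
  let ?B = "frontier \<Omega>"
  have C1: "C1_curve \<gamma> (\<lambda>t. vector_derivative \<gamma> (at t))" if "\<gamma> \<in> \<Gamma>" for \<gamma>
    using smooth_C1_curve[OF curve(1)[OF that]] .
  have vp: "valid_path \<gamma>" "path \<gamma>" if "\<gamma> \<in> \<Gamma>" for \<gamma>
    using C1_curve_valid_path[OF C1[OF that]] valid_path_imp_path by auto
  have loop: "pathfinish \<gamma> = pathstart \<gamma>" if "\<gamma> \<in> \<Gamma>" for \<gamma>
    using curve(2)[OF that, of 0] by (simp add: pathfinish_def pathstart_def)
  define m where "m w = (\<Sum>\<gamma>\<in>\<Gamma>. winding_number \<gamma> w) - (if w \<in> \<Omega> then 1 else 0)" for w
  have m_const: "m x = m y" if C: "connected C" "C \<inter> ?B = {}" "x \<in> C" "y \<in> C" for C x y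
  proof -
    have "winding_number \<gamma> x = winding_number \<gamma> y" if "\<gamma> \<in> \<Gamma>" for \<gamma>
    proof -
      have "C \<inter> path_image \<gamma> = {}"
        using C(2) fr that by auto
      then show ?thesis
        using winding_number_constant[OF vp(2)[OF that] loop[OF that] C(1)] C(3,4)
        by (auto simp: constant_on_def)
    qed
    moreover have "x \<in> \<Omega> \<longleftrightarrow> y \<in> \<Omega>"
      using connected_Int_frontier[OF C(1), of \<Omega>] C(2-4) by blast
    ultimately show ?thesis
      by (simp add: m_def)
  qed
  have local: "\<exists>e c. e > 0 \<and> (\<forall>w\<in>ball b e - ?B. m w = c) \<and> (b \<in> ?B \<longrightarrow> (\<forall>r>0. \<exists>w\<in>ball b r. w \<notin> ?B))" for b
  proof (cases "b \<in> ?B")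
    case False
    then obtain e where e: "e > 0" "ball b e \<subseteq> - ?B"
      using open_contains_ball[of "- ?B"] by auto
    have "m w = m b" if "w \<in> ball b e" for w
      using m_const[of "ball b e" w b] e that by auto
    then show ?thesis
      using e False by blast
  next
    case True
    then obtain \<gamma> t0 where \<gamma>: "\<gamma> \<in> \<Gamma>" "t0 \<in> {0..1}" "b = \<gamma> t0"
      unfolding fr path_image_def by blast
    define \<tau> where "\<tau> = (if t0 \<ge> 1/2 then t0 - 1/2 else t0 + 1/2)"
    have \<tau>: "\<tau> \<in> {0..1}" "\<gamma> (\<tau> + 1/2) = b"
      using \<gamma> curve(2)[OF \<gamma>(1), of t0] by (auto simp: \<tau>_def algebra_simps)
    define \<beta> where "\<beta> t = \<gamma> (\<tau> + t)" for t
    define \<beta>' where "\<beta>' t = vector_derivative \<gamma> (at (\<tau> + t))" for t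
    have sh: "\<beta> = shiftpath \<tau> \<gamma>"
      using shiftpath_periodic[of \<gamma> \<tau>] curve(2)[OF \<gamma>(1)] by (simp add: \<beta>_def fun_eq_iff)
    interpret \<beta>: regular_closed_curve \<beta> \<beta>'
    proof
      show "C1_curve \<beta> \<beta>'"
        unfolding \<beta>_def \<beta>'_def by (rule C1_curve_shift[OF C1[OF \<gamma>(1)]])
      show "\<beta> 1 = \<beta> 0"
        using curve(2)[OF \<gamma>(1), of \<tau>] by (simp add: \<beta>_def)
      show "\<beta>' (1/2) \<noteq> 0"
        using curve(4)[OF \<gamma>(1)] by (simp add: \<beta>'_def)
      show "inj_on \<beta> {0..<1}"
      proof (rule inj_onI)
        fix x y assume xy: "x \<in> {0..<1::real}" "y \<in> {0..<1}" and eq: "\<beta> x = \<beta> y"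
        define red where "red x = (if \<tau> + x < 1 then \<tau> + x else \<tau> + x - 1)" for x
        have red: "\<beta> x = \<gamma> (red x)" "red x \<in> {0..<1}" if "x \<in> {0..<1}" for x
          using that \<tau> curve(2)[OF \<gamma>(1), of "\<tau> + x - 1"] by (auto simp: red_def \<beta>_def)
        have "red x = red y"
          using inj_onD[OF curve(3)[OF \<gamma>(1)], of "red x" "red y"] red xy eq by metis
        then show "x = y"
          using xy by (auto simp: red_def split: if_splits)
      qed
    qed
    have a: "\<beta>.a = b"
      using \<tau> by (simp add: \<beta>.a_def \<beta>_def)
    have img: "path_image \<beta> = path_image \<gamma>"
      unfolding sh using path_image_shiftpath[OF \<tau>(1) loop[OF \<gamma>(1)]] .
    define F where "F = (\<Union>\<gamma>'\<in>\<Gamma> - {\<gamma>}. path_image \<gamma>')"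
    have F: "closed F"
      unfolding F_def using fin vp by (intro closed_UN) (auto simp: closed_path_image)
    have bF: "\<beta>.a \<notin> F"
      using dis[OF \<gamma>(1)] \<gamma> unfolding a F_def path_image_def by fastforce
    have B: "?B = path_image \<beta> \<union> F"
      unfolding fr F_def img using \<gamma>(1) by blast
    let ?p = "\<lambda>s. b + complex_of_real s * \<i> * \<beta>.d" and ?m = "\<lambda>s. b - complex_of_real s * \<i> * \<beta>.d"
    obtain U V \<epsilon> \<eta> where UV: "connected U" "connected V" "U \<inter> ?B = {}" "V \<inter> ?B = {}" "0 < \<epsilon>" "0 < \<eta>"
      "ball b \<epsilon> \<subseteq> path_image \<beta> \<union> U \<union> V"
      "\<And>s. 0 < s \<Longrightarrow> s < \<eta> \<Longrightarrow> ?p s \<in> U" "\<And>s. 0 < s \<Longrightarrow> s < \<eta> \<Longrightarrow> ?m s \<in> V"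
      using \<beta>.two_sides[OF F bF] unfolding a B by metis
    have jump: "((\<lambda>s. \<Sum>\<gamma>'\<in>\<Gamma>. winding_number \<gamma>' (?p s) - winding_number \<gamma>' (?m s))
        \<longlongrightarrow> (\<Sum>\<gamma>'\<in>\<Gamma>. if \<gamma>' = \<gamma> then 1 else 0)) (at_right 0)"
    proof (rule tendsto_sum)
      fix \<gamma>' assume \<gamma>': "\<gamma>' \<in> \<Gamma>"
      show "((\<lambda>s. winding_number \<gamma>' (?p s) - winding_number \<gamma>' (?m s)) \<longlongrightarrow> (if \<gamma>' = \<gamma> then 1 else 0)) (at_right 0)"
      proof (cases "\<gamma>' = \<gamma>")
        case True
        have "\<forall>\<^sub>F s in at_right 0. winding_number \<beta> (?p s) - winding_number \<beta> (?m s)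
            = winding_number \<gamma> (?p s) - winding_number \<gamma> (?m s)"
          using eventually_at_right_real[OF UV(6)]
        proof eventually_elim
          case (elim s)
          then have "?p s \<notin> path_image \<gamma>" "?m s \<notin> path_image \<gamma>"
            using UV(3,4) UV(8)[of s] UV(9)[of s] B img by auto
          then show ?case
            unfolding sh using vp[OF \<gamma>(1)] loop[OF \<gamma>(1)] \<tau> by (simp add: winding_number_shiftpath)
        qed
        then show ?thesis
          using \<beta>.winding_number_jump True unfolding a by (simp add: tendsto_cong)
      next
        case False
        have "b \<notin> path_image \<gamma>'"
          using bF \<gamma>' False by (auto simp: F_def a)
        then have c: "isCont (winding_number \<gamma>') b"
          using vp \<gamma>' by (intro continuous_at_winding_number) auto
        have "isCont (\<lambda>s. winding_number \<gamma>' (?p s)) 0" "isCont (\<lambda>s. winding_number \<gamma>' (?m s)) 0"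
          by (rule isCont_o2[of _ _ "winding_number \<gamma>'"]; use c in \<open>auto intro!: continuous_intros\<close>)+
        then have "isCont (\<lambda>s. winding_number \<gamma>' (?p s) - winding_number \<gamma>' (?m s)) 0"
          by (intro continuous_intros)
        then have "(\<lambda>s. winding_number \<gamma>' (?p s) - winding_number \<gamma>' (?m s)) \<midarrow>0\<rightarrow> 0"
          by (simp add: isCont_def)
        then show ?thesis
          using False filterlim_at_split by auto
      qed
    qed
    have "\<forall>\<^sub>F s in at_right 0. (\<Sum>\<gamma>'\<in>\<Gamma>. winding_number \<gamma>' (?p s) - winding_number \<gamma>' (?m s)) - 1 = m (?p s) - m (?m s)"
    proof -
      have "\<beta>.d = vector_derivative \<gamma> (at (\<tau> + 1/2))"
        by (simp add: \<beta>.d_def \<beta>'_def)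
      then have "\<forall>\<^sub>F s in at_right 0. ?p s \<in> \<Omega> \<and> ?m s \<notin> closure \<Omega>"
        using orient[OF \<gamma>(1), of "\<tau> + 1/2"] \<tau> by simp
      then show ?thesis
        by eventually_elim (use closure_subset[of \<Omega>] in \<open>auto simp: m_def sum_subtractf\<close>)
    qed
    moreover have "((\<lambda>s. (\<Sum>\<gamma>'\<in>\<Gamma>. winding_number \<gamma>' (?p s) - winding_number \<gamma>' (?m s)) - 1)
        \<longlongrightarrow> 1 - 1) (at_right 0)"
      using jump \<gamma>(1) fin by (intro tendsto_diff tendsto_const) simp
    ultimately have lim: "((\<lambda>s. m (?p s) - m (?m s)) \<longlongrightarrow> 0) (at_right 0)"
      by (simp add: tendsto_cong)
    define cU cV where "cU = m (?p (\<eta>/2))" and "cV = m (?m (\<eta>/2))"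
    have \<eta>2: "0 < \<eta> / 2" "\<eta> / 2 < \<eta>"
      using UV(6) by auto
    have mU: "m w = cU" if "w \<in> U" for w
      unfolding cU_def using m_const[OF UV(1,3) that UV(8)[OF \<eta>2]] .
    have mV: "m w = cV" if "w \<in> V" for w
      unfolding cV_def using m_const[OF UV(2,4) that UV(9)[OF \<eta>2]] .
    have "\<forall>\<^sub>F s in at_right 0. m (?p s) - m (?m s) = cU - cV"
      using eventually_at_right_real[OF UV(6)]
      by eventually_elim (use UV(8,9) mU mV in auto)
    then have "((\<lambda>s::real. cU - cV) \<longlongrightarrow> 0) (at_right 0)"
      using lim by (simp add: tendsto_cong)
    then have "cU = cV"
      by (simp add: tendsto_const_iff)
    then have "\<forall>w\<in>ball b \<epsilon> - ?B. m w = cU"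
      using UV(7) mU mV B by blast
    moreover have "\<exists>w\<in>ball b r. w \<notin> ?B" if r: "r > 0" for r
    proof -
      have "((\<lambda>s. ?p s) \<longlongrightarrow> b + complex_of_real 0 * \<i> * \<beta>.d) (at_right 0)"
        by (intro tendsto_intros)
      then have "\<forall>\<^sub>F s in at_right 0. dist (?p s) b < r"
        using r by (intro tendstoD) auto
      with eventually_at_right_real[OF UV(6)]
      have "\<forall>\<^sub>F s in at_right 0. ?p s \<in> U \<and> ?p s \<in> ball b r"
        by eventually_elim (use UV(8) in \<open>auto simp: dist_commute\<close>)
      then have "\<exists>s. ?p s \<in> U \<and> ?p s \<in> ball b r"
        using eventually_happens[of _ "at_right (0::real)"] trivial_limit_at_right_real by blast
      then show ?thesis
        using UV(3) by blast
    qed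
    ultimately show ?thesis
      using UV(5) by blast
  qed
  \<comment> \<open>Both \<open>G\<close> and its complement are open; points off the boundary are dense, so the local values of \<open>m\<close> agree on
    overlaps.\<close>
  define G where "G = {b. \<exists>e>0. \<forall>w\<in>ball b e - ?B. m w = 0}"
  have "open G"
    unfolding open_contains_ball
  proof
    fix b assume "b \<in> G"
    then obtain e where e: "e > 0" "\<forall>w\<in>ball b e - ?B. m w = 0"
      by (auto simp: G_def)
    have "b' \<in> G" if b': "b' \<in> ball b e" for b'
    proof -
      obtain e' where "e' > 0" "ball b' e' \<subseteq> ball b e"
        using iffD1[OF open_contains_ball_eq[OF open_ball] b'] by blast
      then show ?thesis
        using e by (auto simp: G_def intro!: exI[of _ e'])
    qed
    then show "\<exists>e>0. ball b e \<subseteq> G"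
      using e by blast
  qed
  moreover have "open (- G)"
    unfolding open_contains_ball
  proof
    fix b assume b: "b \<in> - G"
    obtain e c where e: "e > 0" "\<forall>w\<in>ball b e - ?B. m w = c"
      using local[of b] by blast
    have c: "c \<noteq> 0"
      using b e by (auto simp: G_def)
    have "b' \<notin> G" if b': "b' \<in> ball b e" for b'
    proof
      assume "b' \<in> G"
      then obtain e' where e': "e' > 0" "\<forall>w\<in>ball b' e' - ?B. m w = 0"
        by (auto simp: G_def)
      obtain e'' where e'': "e'' > 0" "ball b' e'' \<subseteq> ball b e"
        using iffD1[OF open_contains_ball_eq[OF open_ball] b'] by blast
      obtain w where w: "w \<in> ball b' (min e' e'')" "w \<notin> ?B"
      proof (cases "b' \<in> ?B")
        case True
        then show ?thesis
          using local[of b'] e' e'' that by (metis min_less_iff_conj)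
      next
        case False
        then show ?thesis
          using that[of b'] e' e'' by simp
      qed
      then have "m w = 0"
        using e' by auto
      moreover have "m w = c"
        using w e'' e by auto
      ultimately show False
        using c by simp
    qed
    then show "\<exists>e>0. ball b e \<subseteq> - G"
      using e by blast
  qed
  ultimately have "G = {} \<or> G = UNIV"
    using clopen[of G] by (simp add: closed_def)
  moreover have "G \<noteq> {}"
  proof -
    have "\<exists>R. \<forall>w. R \<le> cmod w \<longrightarrow> winding_number \<gamma> w = 0" if "\<gamma> \<in> \<Gamma>" for \<gamma>
      using winding_number_zero_at_infinity[OF vp(2)[OF that] loop[OF that]] by blast
    then obtain R where R: "\<And>\<gamma> w. \<gamma> \<in> \<Gamma> \<Longrightarrow> R \<gamma> \<le> cmod w \<Longrightarrow> winding_number \<gamma> w = 0"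
      by metis
    obtain R0 where R0: "\<And>w. w \<in> \<Omega> \<Longrightarrow> cmod w \<le> R0"
      using \<Omega>(2) bounded_iff by metis
    define M where "M = \<bar>R0\<bar> + (\<Sum>\<gamma>\<in>\<Gamma>. \<bar>R \<gamma>\<bar>) + 1"
    have m0: "m w = 0" if w: "M \<le> cmod w" for w
    proof -
      have "R \<gamma> \<le> cmod w" if "\<gamma> \<in> \<Gamma>" for \<gamma>
      proof -
        have "\<bar>R \<gamma>\<bar> \<le> (\<Sum>\<gamma>\<in>\<Gamma>. \<bar>R \<gamma>\<bar>)"
          using fin that by (intro member_le_sum) auto
        then show ?thesis
          using w by (simp add: M_def)
      qed
      moreover have "0 \<le> (\<Sum>\<gamma>\<in>\<Gamma>. \<bar>R \<gamma>\<bar>)"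
        by (intro sum_nonneg) auto
      then have "w \<notin> \<Omega>"
      proof -
        assume "0 \<le> (\<Sum>\<gamma>\<in>\<Gamma>. \<bar>R \<gamma>\<bar>)"
        then have "\<not> cmod w \<le> R0"
          using w unfolding M_def by linarith
        then show ?thesis
          using R0 by blast
      qed
      ultimately show ?thesis
        using R by (simp add: m_def)
    qed
    have "M \<le> cmod w" if "w \<in> ball (of_real (M + 1)) 1" for w
      using that norm_triangle_ineq2[of "of_real (M + 1)" w]
      by (simp add: dist_norm del: of_real_add)
    then have "of_real (M + 1) \<in> G"
      unfolding G_def using m0 by (intro CollectI exI[of _ 1]) auto
    then show ?thesis
      by blast
  qed
  ultimately have "z \<in> G"
    by simp
  then obtain e where "e > 0" "\<forall>w\<in>ball z e - ?B. m w = 0"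
    by (auto simp: G_def)
  then have "m z = 0"
    using z by simp
  then show ?thesis
    by (simp add: m_def)
qed

section \<open>Cauchy's theorem for an oriented boundary\<close>

text \<open>
  From a base point, run to each curve, around it, and back along the same arc: the arcs cancel, so this one closed
  path has the same integrals as all the curves together, and the global form of Cauchy's theorem applies to it.
\<close>

lemma join_closed_paths:
  assumes "finite \<Gamma>" and U: "open U" "connected U" "b \<in> U"
    and "\<And>\<gamma>. \<gamma> \<in> \<Gamma> \<Longrightarrow> valid_path \<gamma> \<and> pathfinish \<gamma> = pathstart \<gamma> \<and> path_image \<gamma> \<subseteq> U"
  shows "\<exists>c. valid_path c \<and> pathstart c = b \<and> pathfinish c = b \<and> path_image c \<subseteq> U \<and>
    (\<forall>f. f holomorphic_on U \<longrightarrow> contour_integral c f = (\<Sum>\<gamma>\<in>\<Gamma>. contour_integral \<gamma> f))"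
  using assms(1,5)
proof (induction \<Gamma> rule: finite_induct)
  case empty
  then show ?case
  proof (intro exI[of _ "linepath b b"] conjI allI impI)
    show "valid_path (linepath b b)"
      by (rule valid_path_linepath)
    show "contour_integral (linepath b b) f = (\<Sum>\<gamma>\<in>{}. contour_integral \<gamma> f)" for f
      unfolding contour_integral_trivial by simp
  qed (unfold pathstart_linepath pathfinish_linepath path_image_linepath, use U in auto)
next
  case (insert \<gamma> \<Gamma>)
  then obtain c where c: "valid_path c" "pathstart c = b" "pathfinish c = b" "path_image c \<subseteq> U"
    "\<And>f. f holomorphic_on U \<Longrightarrow> contour_integral c f = (\<Sum>\<gamma>\<in>\<Gamma>. contour_integral \<gamma> f)"
    by blast
  have \<gamma>: "valid_path \<gamma>" "pathfinish \<gamma> = pathstart \<gamma>" "path_image \<gamma> \<subseteq> U"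
    using insert.prems by auto
  then have "pathstart \<gamma> \<in> U"
    by auto
  then obtain g where g: "polynomial_function g" "path_image g \<subseteq> U" "pathstart g = b" "pathfinish g = pathstart \<gamma>"
    using connected_open_polynomial_connected[OF U(1,2,3)] by blast
  have vg: "valid_path g"
    using g by (simp add: valid_path_polynomial_function)
  define h where "h = g +++ \<gamma> +++ reversepath g"
  have h: "valid_path h" "pathstart h = b" "pathfinish h = b" "path_image h \<subseteq> U"
    using vg g \<gamma> by (auto simp: h_def path_image_join intro!: valid_path_join)
  have int_h: "contour_integral h f = contour_integral \<gamma> f" if f: "f holomorphic_on U" for f
  proof -
    have i: "f contour_integrable_on p" if "valid_path p" "path_image p \<subseteq> U" for p
      using contour_integrable_holomorphic_simple[OF f U(1) that] .
    have "f contour_integrable_on g" "f contour_integrable_on \<gamma>" "f contour_integrable_on reversepath g"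
      "f contour_integrable_on (\<gamma> +++ reversepath g)"
      using vg g \<gamma> by (auto intro!: i valid_path_join simp: path_image_join)
    then show ?thesis
      using vg g \<gamma> by (simp add: h_def contour_integral_reversepath)
  qed
  have "valid_path (h +++ c)" "path_image (h +++ c) \<subseteq> U"
    using h c by (auto simp: path_image_join intro!: valid_path_join)
  moreover have "contour_integral (h +++ c) f = (\<Sum>\<gamma>\<in>insert \<gamma> \<Gamma>. contour_integral \<gamma> f)"
    if f: "f holomorphic_on U" for f
  proof -
    have "f contour_integrable_on h" "f contour_integrable_on c"
      using contour_integrable_holomorphic_simple[OF f U(1)] h c by auto
    then show ?thesis
      using h c int_h[OF f] f insert.hyps by simp
  qed
  ultimately show ?case
    using h c by (intro exI[of _ "h +++ c"]) auto
qed

lemma boundary_curves: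
  assumes "smooth_oriented_boundary \<Omega> \<Gamma>" and "\<gamma> \<in> \<Gamma>"
  shows "valid_path \<gamma>" "pathfinish \<gamma> = pathstart \<gamma>" "path_image \<gamma> \<subseteq> frontier \<Omega>"
proof -
  have g: "smooth_on UNIV \<gamma>" "\<gamma> (0 + 1) = \<gamma> 0" "frontier \<Omega> = (\<Union>\<gamma>\<in>\<Gamma>. path_image \<gamma>)"
    using smooth_oriented_boundaryD(2,4)[OF assms(1)] smooth_oriented_boundaryD(5)[OF assms, of 0] assms(2)
    by simp_all
  show "valid_path \<gamma>"
    using C1_curve_valid_path[OF smooth_C1_curve[OF g(1)]] .
  show "pathfinish \<gamma> = pathstart \<gamma>"
    using g(2) by (simp add: pathfinish_def pathstart_def)
  show "path_image \<gamma> \<subseteq> frontier \<Omega>"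
    using g(3) assms(2) by blast
qed

theorem boundary_integral_cauchy:
  assumes bd: "smooth_oriented_boundary \<Omega> \<Gamma>" and \<Omega>: "open \<Omega>" "bounded \<Omega>"
    and \<Sigma>: "open \<Sigma>" "connected \<Sigma>" "closure \<Omega> \<subseteq> \<Sigma>" and p: "p \<in> \<Omega>" and W: "W holomorphic_on \<Sigma>"
  shows "boundary_integral \<Gamma> (\<lambda>w. W w / (w - p)) = 2 * pi * \<i> * W p"
proof -
  have fin: "finite \<Gamma>"
    using bd by (simp add: smooth_oriented_boundary_def)
  note curves = boundary_curves[OF bd]
  have pfr: "p \<notin> frontier \<Omega>"
    using p \<Omega>(1) by (simp add: frontier_def interior_open)
  have p\<Sigma>: "p \<in> \<Sigma>"
    using p \<Sigma>(3) closure_subset by blast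
  define U where "U = \<Sigma> - {p}"
  have fU: "frontier \<Omega> \<subseteq> U"
    using \<Sigma>(3) pfr by (auto simp: U_def frontier_def)
  have "(\<Sum>\<gamma>\<in>\<Gamma>. winding_number \<gamma> p) = 1"
    using oriented_boundary_winding_number[OF bd \<Omega> pfr] p by simp
  then have "\<Gamma> \<noteq> {}"
    by auto
  then obtain \<gamma>0 where "\<gamma>0 \<in> \<Gamma>"
    by blast
  then have bU: "pathstart \<gamma>0 \<in> U"
    using curves(3) fU by auto
  have U: "open U" "connected U"
    unfolding U_def using \<Sigma> connected_open_delete_finite[of \<Sigma> "{p}"] by auto
  obtain c where c: "valid_path c" "pathfinish c = pathstart c" "path_image c \<subseteq> U"
    "\<And>f. f holomorphic_on U \<Longrightarrow> contour_integral c f = (\<Sum>\<gamma>\<in>\<Gamma>. contour_integral \<gamma> f)"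
  proof -
    have "valid_path \<gamma> \<and> pathfinish \<gamma> = pathstart \<gamma> \<and> path_image \<gamma> \<subseteq> U" if "\<gamma> \<in> \<Gamma>" for \<gamma>
      using curves[OF that] fU by auto
    from join_closed_paths[OF fin U bU this] show ?thesis
      using that by auto
  qed
  have wn: "winding_number c z = (\<Sum>\<gamma>\<in>\<Gamma>. winding_number \<gamma> z)" if "z \<notin> U" for z
  proof -
    have "(\<lambda>w. 1 / (w - z)) holomorphic_on U"
      using that by (intro holomorphic_intros) auto
    moreover have "z \<notin> path_image c" "\<And>\<gamma>. \<gamma> \<in> \<Gamma> \<Longrightarrow> z \<notin> path_image \<gamma>"
      using that c(3) curves(3) fU by blast+
    ultimately show ?thesis
      using c(1,4) curves(1) by (simp add: winding_number_valid_path sum_distrib_left)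
  qed
  have int: "((\<lambda>w. W w / (w - p)) has_contour_integral (2 * pi * \<i> * winding_number c p * W p)) c"
  proof (rule Cauchy_integral_formula_global[OF \<Sigma>(1) W p\<Sigma> c(1) _ c(2)])
    show "path_image c \<subseteq> \<Sigma> - {p}"
      using c(3) by (simp add: U_def)
    show "winding_number c w = 0" if "w \<notin> \<Sigma>" for w
    proof -
      have "w \<notin> closure \<Omega>"
        using that \<Sigma>(3) by blast
      then have "w \<notin> frontier \<Omega>" "w \<notin> \<Omega>"
        using closure_subset by (auto simp: frontier_def)
      then show ?thesis
        using wn[of w] that oriented_boundary_winding_number[OF bd \<Omega>, of w] by (simp add: U_def)
    qed
  qed
  have wn1: "winding_number c p = 1"
    using wn[of p] oriented_boundary_winding_number[OF bd \<Omega> pfr] p by (simp add: U_def)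
  have "(\<lambda>w. W w / (w - p)) holomorphic_on U"
    using holomorphic_on_subset[OF W, of U] by (auto simp: U_def intro!: holomorphic_intros)
  from c(4)[OF this] show ?thesis
    unfolding boundary_integral_def contour_integral_unique[OF int] wn1 by simp
qed

text \<open>
  For \<open>p\<close> in \<open>\<Omega>\<close> this is Cauchy's formula for the function \<open>F w * (w - p)\<close>, which vanishes at \<open>p\<close>.
\<close>

theorem boundary_integral_holomorphic:
  assumes bd: "smooth_oriented_boundary \<Omega> \<Gamma>" and \<Omega>: "open \<Omega>" "bounded \<Omega>"
    and \<Sigma>: "open \<Sigma>" "connected \<Sigma>" "closure \<Omega> \<subseteq> \<Sigma>" and F: "F holomorphic_on \<Sigma>"
  shows "boundary_integral \<Gamma> F = 0"
proof (cases "\<Omega> = {}")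
  case True
  then have "path_image \<gamma> \<subseteq> {}" if "\<gamma> \<in> \<Gamma>" for \<gamma>
    using boundary_curves(3)[OF bd that] by simp
  then have "\<Gamma> = {}"
    using path_image_nonempty by blast
  then show ?thesis
    by (simp add: boundary_integral_def)
next
  case False
  then obtain p where p: "p \<in> \<Omega>"
    by blast
  have "boundary_integral \<Gamma> (\<lambda>w. (F w * (w - p)) / (w - p)) = 0"
    using boundary_integral_cauchy[OF bd \<Omega> \<Sigma> p, of "\<lambda>w. F w * (w - p)"] F
    by (simp add: holomorphic_intros)
  moreover have "contour_integral \<gamma> (\<lambda>w. (F w * (w - p)) / (w - p)) = contour_integral \<gamma> F" if "\<gamma> \<in> \<Gamma>" for \<gamma>
  proof (rule contour_integral_eq)
    fix x assume "x \<in> path_image \<gamma>"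
    then have "x \<noteq> p"
      using boundary_curves(3)[OF bd that] p \<Omega>(1) by (auto simp: frontier_def interior_open)
    then show "F x * (x - p) / (x - p) = F x"
      by simp
  qed
  ultimately show ?thesis
    by (simp add: boundary_integral_def)
qed

section \<open>Conjugate variables and gluing\<close>

lemma open_cnj_image [intro]: "open V \<Longrightarrow> open (cnj ` V)"
proof -
  assume V: "open V"
  have "cnj ` V = cnj -` V"
    by (auto simp: image_iff) (metis complex_cnj_cnj)
  then show ?thesis
    using V by (auto intro!: open_vimage continuous_intros)
qed

lemma cnj_image_cnj_image [simp]: "cnj ` cnj ` V = V"
  by (simp add: image_image)

text \<open>
  The inner product is antilinear in its second argument, and so is the dependence of \<open>g (cnj \<sigma>)\<close> on
  \<open>\<sigma>\<close>; together they give a complex derivative.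
\<close>

lemma (in hilb) holomorphic_ip_cnj:
  assumes V: "open V" and f: "holo_into V X f" and g: "holo_into (cnj ` V) X g"
  shows "(\<lambda>\<sigma>. ip X (f \<sigma>) (g (cnj \<sigma>))) holomorphic_on V"
  unfolding holomorphic_on_open[OF V]
proof
  note fc = holo_into_carr[OF f]
  have gc: "g (cnj w) \<in> carr X" if "w \<in> V" for w
    using holo_into_carr[OF g] that by blast
  have V': "open (cnj ` V)"
    using V by blast
  fix z assume z: "z \<in> V"
  then have z': "cnj z \<in> cnj ` V"
    by blast
  obtain d where d: "hderiv X f d z"
    using f z V by (auto simp: holo_into_open)
  obtain e where e: "hderiv X g e (cnj z)"
    using g z' V' by (auto simp: holo_into_open)
  have dc: "d \<in> carr X" "e \<in> carr X"
    using d e by (auto simp: hderiv_def)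
  have lim_cnj: "filterlim cnj (at (cnj z)) (at z)"
    unfolding filterlim_at
    by (auto intro!: tendsto_intros simp: eventually_at_filter)
  let ?Df = "\<lambda>w. inverse (w - z) *\<^sub>C (f w - f z)"
  let ?Dg = "\<lambda>w. inverse (w - cnj z) *\<^sub>C (g w - g (cnj z))"
  have lim1: "((\<lambda>w. hnorm X (?Df w - d)) \<longlongrightarrow> 0) (at z)"
    using d by (simp add: hderiv_def)
  have lim2: "((\<lambda>w. hnorm X (?Dg (cnj w) - e)) \<longlongrightarrow> 0) (at z)"
    using e lim_cnj unfolding hderiv_def by (auto intro: filterlim_compose)
  have lim3: "((\<lambda>w. hnorm X (g (cnj w) - g (cnj z))) \<longlongrightarrow> 0) (at z)"
    using holo_into_continuous[OF V' g z'] lim_cnj by (rule filterlim_compose)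
  let ?D = "ip X d (g (cnj z)) + ip X (f z) e"
  have "((\<lambda>\<sigma>. ip X (f \<sigma>) (g (cnj \<sigma>))) has_field_derivative ?D) (at z)"
    unfolding has_field_derivative_iff
  proof (rule tendsto_norm_zero_cancel[THEN LIM_zero_cancel], rule tendsto_zero_boundI)
    let ?b = "\<lambda>w. hnorm X (?Df w - d) * (hnorm X (g (cnj w) - g (cnj z)) + hnorm X (g (cnj z)))
        + hnorm X d * hnorm X (g (cnj w) - g (cnj z)) + hnorm X (f z) * hnorm X (?Dg (cnj w) - e)"
    have "(?b \<longlongrightarrow> 0 * (0 + hnorm X (g (cnj z))) + hnorm X d * 0 + hnorm X (f z) * 0) (at z)"
      by (intro tendsto_intros lim1 lim2 lim3)
    then show "(?b \<longlongrightarrow> 0) (at z)"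
      by simp
    show "\<forall>\<^sub>F w in at z. cmod ((ip X (f w) (g (cnj w)) - ip X (f z) (g (cnj z))) / (w - z) - ?D) \<le> ?b w"
      using eventually_at_in_open[OF V z]
    proof eventually_elim
      case (elim w)
      then have w: "w \<in> V" "w - z \<noteq> 0"
        by auto
      note c = fc[OF w(1)] fc[OF z] gc[OF w(1)] gc[OF z] dc
      have Dc: "?Df w - d \<in> carr X" "?Dg (cnj w) - e \<in> carr X" "g (cnj w) - g (cnj z) \<in> carr X"
        using c by auto
      have Df: "ip X (?Df w) (g (cnj w)) = (ip X (f w) (g (cnj w)) - ip X (f z) (g (cnj w))) / (w - z)"
        using c by (simp add: ip_scale_left ip_diff_left divide_inverse)
      have Dg: "ip X (f z) (?Dg (cnj w)) = (ip X (f z) (g (cnj w)) - ip X (f z) (g (cnj z))) / (w - z)"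
        using c by (simp add: ip_scale_right ip_diff_right divide_inverse)
      have "(ip X (f w) (g (cnj w)) - ip X (f z) (g (cnj z))) / (w - z)
          = ip X (?Df w) (g (cnj w)) + ip X (f z) (?Dg (cnj w))"
        unfolding Df Dg by (simp add: add_divide_distrib[symmetric])
      then have "(ip X (f w) (g (cnj w)) - ip X (f z) (g (cnj z))) / (w - z) - ?D
          = ip X (?Df w - d) (g (cnj w)) + ip X d (g (cnj w) - g (cnj z)) + ip X (f z) (?Dg (cnj w) - e)"
        using c by (simp add: ip_diff_left ip_diff_right)
      then have "cmod ((ip X (f w) (g (cnj w)) - ip X (f z) (g (cnj z))) / (w - z) - ?D)
          \<le> cmod (ip X (?Df w - d) (g (cnj w))) + cmod (ip X d (g (cnj w) - g (cnj z)))
            + cmod (ip X (f z) (?Dg (cnj w) - e))"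
        by (simp only:) (intro order_trans[OF norm_triangle_ineq] add_right_mono norm_triangle_ineq)
      also have "\<dots> \<le> ?b w"
      proof (intro add_mono)
        have "hnorm X (g (cnj w)) \<le> hnorm X (g (cnj w) - g (cnj z)) + hnorm X (g (cnj z))"
          using hnorm_reverse[OF c(3,4)] by simp
        then show "cmod (ip X (?Df w - d) (g (cnj w)))
            \<le> hnorm X (?Df w - d) * (hnorm X (g (cnj w) - g (cnj z)) + hnorm X (g (cnj z)))"
          using cauchy_schwarz[OF Dc(1) c(3)] mult_left_mono[of _ _ "hnorm X (?Df w - d)"] Dc(1)
          by (meson hnorm_nonneg order_trans)
      qed (intro cauchy_schwarz c Dc)+
      finally show ?case .
    qed
  qed auto
  then show "\<exists>D. ((\<lambda>\<sigma>. ip X (f \<sigma>) (g (cnj \<sigma>))) has_field_derivative D) (at z)"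
    by blast
qed

text \<open>
  The local extensions agree where two of them are defined, so that their values at the centres form a holomorphic
  function.
\<close>

lemma (in hilb) glue_removable:
  assumes V: "open V"
    and local: "\<And>p. p \<in> V \<Longrightarrow> \<exists>r h. r > 0 \<and> holo_into (ball p r) X h \<and> (\<forall>\<sigma>\<in>ball p r - {p}. f \<sigma> = h \<sigma>)"
  obtains h where "holo_into V X h" "\<And>p. p \<in> V \<Longrightarrow> \<forall>\<^sub>F \<sigma> in at p. f \<sigma> = h \<sigma>"
proof -
  obtain r h where rh: "\<And>p. p \<in> V \<Longrightarrow> r p > 0" "\<And>p. p \<in> V \<Longrightarrow> holo_into (ball p (r p)) X (h p)"
    "\<And>p \<sigma>. p \<in> V \<Longrightarrow> \<sigma> \<in> ball p (r p) - {p} \<Longrightarrow> f \<sigma> = h p \<sigma>"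
    using local by metis
  define H where "H \<sigma> = h \<sigma> \<sigma>" for \<sigma>
  have H: "H \<sigma> = h p \<sigma>" if p: "p \<in> V" and \<sigma>: "\<sigma> \<in> ball p (r p) \<inter> V" for p \<sigma>
  proof (cases "\<sigma> = p")
    case False
    define W where "W = ball p (r p) \<inter> ball \<sigma> (r \<sigma>) - {p}"
    have W: "open W" "\<sigma> \<in> W"
      using \<sigma> False rh(1)[of \<sigma>] by (auto simp: W_def)
    have "h \<sigma> \<sigma> = h p \<sigma>"
    proof (rule holo_eq_at[OF W, where f = "h \<sigma>" and g = "h p"])
      show "holo_into W X (h \<sigma>)" "holo_into W X (h p)"
        using rh(2) p \<sigma> by (auto simp: W_def intro: holo_into_subset)
      show "h \<sigma> w = h p w" if "w \<in> W - {\<sigma>}" for w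
        using rh(3)[of \<sigma> w] rh(3)[of p w] that p \<sigma> by (auto simp: W_def)
    qed
    then show ?thesis
      by (simp add: H_def)
  qed (simp add: H_def)
  have "\<exists>d. hderiv X H d p" if p: "p \<in> V" for p
  proof -
    have "p \<in> ball p (r p)"
      using rh(1)[OF p] by simp
    then obtain d where d: "hderiv X (h p) d p"
      using rh(2)[OF p] unfolding holo_into_open[OF open_ball] by blast
    have "open (ball p (r p) \<inter> V)" "p \<in> ball p (r p) \<inter> V"
      using V rh(1)[OF p] p by auto
    then have "\<forall>\<^sub>F w in nhds p. w \<in> ball p (r p) \<inter> V"
      by (rule eventually_nhds_in_open)
    then have "\<forall>\<^sub>F w in nhds p. H w = h p w"
      by eventually_elim (rule H[OF p])
    then show ?thesis
      using hderiv_cong[OF d] by blast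
  qed
  moreover have "H p \<in> carr X" if p: "p \<in> V" for p
    using holo_into_carr[OF rh(2)[OF p], of p] rh(1)[OF p] by (simp add: H_def)
  ultimately have "holo_into V X H"
    unfolding holo_into_open[OF V] by blast
  moreover have "\<forall>\<^sub>F \<sigma> in at p. f \<sigma> = H \<sigma>" if p: "p \<in> V" for p
  proof -
    have "\<forall>\<^sub>F \<sigma> in at p. \<sigma> \<in> ball p (r p) - {p}"
      using rh(1)[OF p] by (intro eventually_at_in_open) auto
    with eventually_at_in_open[OF V p] show ?thesis
      by eventually_elim (use H[OF p] rh(3)[OF p] in auto)
  qed
  ultimately show ?thesis
    using that by blast
qed

section \<open>Singular kernels of Fredholm families\<close>

locale fredholm_family_on = two_hilb X Y
  for X :: "'e::complex_vector hspace" and Y :: "'f::complex_vector hspace" +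
  fixes \<Sigma> S :: "complex set" and T :: "complex \<Rightarrow> 'e \<Rightarrow> 'f"
  assumes open_\<Sigma>: "open \<Sigma>" and finite_S: "finite S"
    and family: "holo_family \<Sigma> X Y T"
    and fredholm: "\<And>\<sigma>. \<sigma> \<in> \<Sigma> \<Longrightarrow> fredholm_op (carr X) Y (T \<sigma>)"
    and inj: "\<And>\<sigma> u. \<sigma> \<in> \<Sigma> - S \<Longrightarrow> u \<in> carr X \<Longrightarrow> T \<sigma> u = 0 \<Longrightarrow> u = 0"
    and surj: "\<And>\<sigma> v. \<sigma> \<in> \<Sigma> - S \<Longrightarrow> v \<in> carr Y \<Longrightarrow> \<exists>u\<in>carr X. T \<sigma> u = v"
begin

lemma open_diff_S: "open (\<Sigma> - S)"
  using open_\<Sigma> finite_S by (simp add: finite_imp_closed open_Diff)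

text \<open>
  If \<open>a K\<close> is the leading coefficient, multiply \<open>T \<phi> = g\<close> by \<open>(\<sigma> - p)^(K+1)\<close> and let \<open>\<sigma>\<close> tend
  to \<open>p\<close>: then \<open>T p (a K) = 0\<close>.
\<close>

lemma no_pole_where_injective:
  assumes p: "p \<in> \<Sigma> - S" and \<phi>: "has_principal_part X \<phi> p a"
    and g: "holo_into \<Sigma> Y g" "\<forall>\<^sub>F \<sigma> in at p. T \<sigma> (\<phi> \<sigma>) = g \<sigma>"
  shows "a = (\<lambda>_. 0)"
proof (rule ccontr)
  assume nz: "a \<noteq> (\<lambda>_. 0)"
  obtain r h where a: "\<And>k. a k \<in> carr X" and fin: "finite {k. a k \<noteq> 0}" and r: "0 < r"
    and h: "holo_into (ball p r) X h" "\<And>\<sigma>. \<sigma> \<in> ball p r - {p} \<Longrightarrow> \<phi> \<sigma> = h \<sigma> + laurent_tail p a \<sigma>"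
    using \<phi> unfolding has_principal_part_def by blast
  obtain K where K0: "a K \<noteq> 0" and K: "\<And>k. k > K \<Longrightarrow> a k = 0"
    using leading_coefficient[OF fin nz] by metis
  obtain W where W: "holo_into UNIV X W" "W p = a K"
    "\<And>\<sigma>. \<sigma> \<noteq> p \<Longrightarrow> (\<sigma> - p) ^ Suc K *\<^sub>C laurent_tail p a \<sigma> = W \<sigma>"
    by (rule X.laurent_tail_clear_pole[of a K p, OF a K]) (assumption, rule that, assumption)
  have pS: "p \<in> \<Sigma>"
    using p by simp
  have "\<forall>\<^sub>F \<sigma> in at p. \<sigma> \<in> ball p r \<inter> \<Sigma> - {p} \<and> T \<sigma> (\<phi> \<sigma>) = g \<sigma>"
    using g(2) r open_\<Sigma> pS by (intro eventually_conj eventually_at_in_open) auto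
  then obtain s where s: "s > 0"
    "\<And>\<sigma>. \<sigma> \<in> ball p s - {p} \<Longrightarrow> \<sigma> \<in> ball p r \<inter> \<Sigma> - {p} \<and> T \<sigma> (\<phi> \<sigma>) = g \<sigma>"
    unfolding eventually_at by (auto simp: dist_commute)
  have sub: "ball p s \<subseteq> ball p r" "ball p s \<subseteq> \<Sigma>"
    using s pS r by fastforce+
  have ps: "p \<in> ball p s"
    using s by simp
  let ?L = "\<lambda>\<sigma>. (\<sigma> - p) ^ Suc K *\<^sub>C h \<sigma> + W \<sigma>"
  have L: "holo_into (ball p s) X ?L"
    by (intro X.holo_into_add X.holo_into_scale open_ball holo_into_subset[OF h(1) sub(1)]
        holo_into_subset[OF W(1)]) (auto intro!: holomorphic_intros)
  have "T p (?L p) = (p - p) ^ Suc K *\<^sub>C g p"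
  proof (rule Y.holo_eq_at[OF open_ball ps, where f = "\<lambda>\<sigma>. T \<sigma> (?L \<sigma>)" and g = "\<lambda>\<sigma>. (\<sigma> - p) ^ Suc K *\<^sub>C g \<sigma>"])
    show "holo_into (ball p s) Y (\<lambda>\<sigma>. T \<sigma> (?L \<sigma>))"
      by (rule holo_family_apply[OF open_ball holo_family_subset[OF family sub(2)] L])
    show "holo_into (ball p s) Y (\<lambda>\<sigma>. (\<sigma> - p) ^ Suc K *\<^sub>C g \<sigma>)"
      by (intro Y.holo_into_scale open_ball holo_into_subset[OF g(1) sub(2)]) (auto intro!: holomorphic_intros)
    fix w assume w: "w \<in> ball p s - {p}"
    then have wr: "w \<in> ball p r - {p}" "w \<in> \<Sigma>" and Tw: "T w (\<phi> w) = g w"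
      using s(2)[OF w] by auto
    have tc: "laurent_tail p a w \<in> carr X" and hc: "h w \<in> carr X"
      using X.laurent_tail_carr[of a, OF a] holo_into_carr[OF h(1)] wr by auto
    have "?L w = (w - p) ^ Suc K *\<^sub>C (h w + laurent_tail p a w)"
      using W(3)[of w] w by (simp add: scaleC_add_right)
    then have "?L w = (w - p) ^ Suc K *\<^sub>C \<phi> w"
      using h(2)[OF wr(1)] by simp
    moreover have "\<phi> w \<in> carr X"
      using h(2)[OF wr(1)] tc hc by simp
    ultimately show "T w (?L w) = (w - p) ^ Suc K *\<^sub>C g w"
      using Tw linear_scale[OF holo_family_linear[OF family wr(2)], of "\<phi> w"] by simp
  qed
  then have "T p (a K) = 0"
    by (simp add: W(2))
  then show False
    using inj[OF p a] K0 by blast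
qed

text \<open>
  A meromorphic \<open>\<Phi>\<close> with \<open>T \<Phi> = g\<close> has poles only in \<open>S\<close>. Subtracting its singular part \<open>\<phi>\<close>
  leaves a holomorphic \<open>h\<close>, so \<open>T \<phi> = g - T h\<close> off \<open>S\<close>. Since \<open>\<Phi>\<close> may take arbitrary values at
  isolated points, \<open>h\<close> is glued from local extensions of \<open>\<Phi> - \<phi>\<close>.
\<close>

lemma singular_part_decomposition:
  assumes \<Phi>: "mero_into \<Sigma> X \<Phi>" and g: "holo_into \<Sigma> Y g"
    and Tg: "\<And>p. p \<in> \<Sigma> \<Longrightarrow> \<forall>\<^sub>F \<sigma> in at p. T \<sigma> (\<Phi> \<sigma>) = g \<sigma>"
  defines "\<phi> \<equiv> singular_part \<Sigma> X \<Phi>"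
  obtains a h where "\<And>p k. a p k \<in> carr X" "\<And>p. finite {k. a p k \<noteq> 0}"
    "\<phi> = (\<lambda>\<sigma>. \<Sum>p\<in>S. laurent_tail p (a p) \<sigma>)" "holo_into \<Sigma> X h"
    "\<And>\<sigma>. \<sigma> \<in> \<Sigma> - S \<Longrightarrow> T \<sigma> (\<phi> \<sigma>) = g \<sigma> - T \<sigma> (h \<sigma>)"
proof -
  define a where "a p = (if p \<in> \<Sigma> then principal_part X \<Phi> p else (\<lambda>_. 0))" for p
  have pp: "has_principal_part X \<Phi> p (a p)" if "p \<in> \<Sigma>" for p
    using \<Phi> that X.principal_part_eqI unfolding mero_into_def a_def by (metis (full_types))
  have ac: "a p k \<in> carr X" and fin: "finite {k. a p k \<noteq> 0}" for p k
    using pp[of p] by (cases "p \<in> \<Sigma>"; simp add: has_principal_part_def; simp add: a_def)+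
  have off: "a p = (\<lambda>_. 0)" if "p \<notin> S" for p
    using no_pole_where_injective[OF _ pp g Tg, of p] that by (cases "p \<in> \<Sigma>") (auto simp: a_def)
  have tail0: "laurent_tail p (\<lambda>_. 0 :: 'e) \<sigma> = 0" for p \<sigma>
    by (simp add: laurent_tail_def)
  have "singular_part \<Sigma> X \<Phi> \<sigma> = (\<Sum>p\<in>S. laurent_tail p (a p) \<sigma>)" for \<sigma>
  proof -
    have "singular_part \<Sigma> X \<Phi> \<sigma> = (\<Sum>p\<in>poles_in \<Sigma> X \<Phi>. laurent_tail p (a p) \<sigma>)"
      unfolding singular_part_def by (intro sum.cong) (auto simp: poles_in_def a_def)
    also have "\<dots> = (\<Sum>p\<in>S. laurent_tail p (a p) \<sigma>)"
    proof (rule sum.mono_neutral_left[OF finite_S])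
      show "poles_in \<Sigma> X \<Phi> \<subseteq> S"
        using off by (force simp: poles_in_def a_def fun_eq_iff)
      show "\<forall>p\<in>S - poles_in \<Sigma> X \<Phi>. laurent_tail p (a p) \<sigma> = 0"
      proof
        fix p assume "p \<in> S - poles_in \<Sigma> X \<Phi>"
        then have "a p = (\<lambda>_. 0)"
          by (auto simp: poles_in_def a_def fun_eq_iff)
        then show "laurent_tail p (a p) \<sigma> = 0"
          by (simp add: tail0)
      qed
    qed
    finally show ?thesis .
  qed
  then have \<phi>: "\<phi> = (\<lambda>\<sigma>. \<Sum>p\<in>S. laurent_tail p (a p) \<sigma>)"
    by (auto simp: \<phi>_def fun_eq_iff)
  have \<phi>c: "\<phi> \<sigma> \<in> carr X" for \<sigma>
    unfolding \<phi> using ac by (intro X.carr_sum X.laurent_tail_carr)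
  have tails: "holo_into (- R) X (\<lambda>\<sigma>. \<Sum>p\<in>R. laurent_tail p (a p) \<sigma>)" if "finite R" for R
  proof (rule X.holo_into_sum)
    show "open (- R)"
      using that by (simp add: finite_imp_closed open_Compl)
    show "holo_into (- R) X (laurent_tail p (a p))" if "p \<in> R" for p
      using X.holo_laurent_tail[OF ac fin] by (rule holo_into_subset) (use that in auto)
  qed (rule that)
  have "\<exists>r h. r > 0 \<and> holo_into (ball p r) X h \<and> (\<forall>\<sigma>\<in>ball p r - {p}. \<Phi> \<sigma> - \<phi> \<sigma> = h \<sigma>)"
    if p: "p \<in> \<Sigma>" for p
  proof -
    obtain r h where r: "0 < r" and h: "holo_into (ball p r) X h"
      "\<And>\<sigma>. \<sigma> \<in> ball p r - {p} \<Longrightarrow> \<Phi> \<sigma> = h \<sigma> + laurent_tail p (a p) \<sigma>"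
      using pp[OF p] unfolding has_principal_part_def by blast
    have "open (- (S - {p}))" "p \<in> - (S - {p})"
      using finite_imp_closed[of "S - {p}"] finite_S by (auto simp: open_Compl simp del: Compl_Diff_eq)
    then obtain s where s: "s > 0" "ball p s \<subseteq> - (S - {p})"
      using open_contains_ball by metis
    define t where "t = min r s"
    have t: "t > 0" "ball p t \<subseteq> ball p r" "ball p t \<subseteq> - (S - {p})"
      using r s by (auto simp: t_def)
    have "\<phi> \<sigma> = (\<Sum>q\<in>S - {p}. laurent_tail q (a q) \<sigma>) + laurent_tail p (a p) \<sigma>" for \<sigma>
      unfolding \<phi> using finite_S off[of p] by (cases "p \<in> S") (simp_all add: sum.remove[of S p] tail0)
    then have "\<Phi> \<sigma> - \<phi> \<sigma> = h \<sigma> - (\<Sum>q\<in>S - {p}. laurent_tail q (a q) \<sigma>)" if "\<sigma> \<in> ball p t - {p}" for \<sigma>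
      using h(2)[of \<sigma>] that t by auto
    moreover have "holo_into (ball p t) X (\<lambda>\<sigma>. h \<sigma> - (\<Sum>q\<in>S - {p}. laurent_tail q (a q) \<sigma>))"
      using finite_S
      by (intro X.holo_into_diff open_ball holo_into_subset[OF h(1) t(2)] holo_into_subset[OF tails t(3)]) auto
    ultimately show ?thesis
      using t(1) by (intro exI[of _ t] exI[of _ "\<lambda>\<sigma>. h \<sigma> - (\<Sum>q\<in>S - {p}. laurent_tail q (a q) \<sigma>)"]) blast
  qed
  note local = this
  obtain h where h: "holo_into \<Sigma> X h" "\<And>p. p \<in> \<Sigma> \<Longrightarrow> \<forall>\<^sub>F \<sigma> in at p. \<Phi> \<sigma> - \<phi> \<sigma> = h \<sigma>"
    by (rule X.glue_removable[OF open_\<Sigma>, of "\<lambda>\<sigma>. \<Phi> \<sigma> - \<phi> \<sigma>"]) (erule local, (rule that; assumption))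
  have Th: "holo_into \<Sigma> Y (\<lambda>\<sigma>. T \<sigma> (h \<sigma>))"
    by (rule holo_family_apply[OF open_\<Sigma> family h(1)])
  have T\<phi>: "holo_into (\<Sigma> - S) Y (\<lambda>\<sigma>. T \<sigma> (\<phi> \<sigma>))"
  proof (rule holo_family_apply[OF open_diff_S holo_family_subset[OF family]])
    show "holo_into (\<Sigma> - S) X \<phi>"
      using tails[OF finite_S] unfolding \<phi> by (rule holo_into_subset) auto
  qed auto
  have "T \<sigma> (\<phi> \<sigma>) = g \<sigma> - T \<sigma> (h \<sigma>)" if \<sigma>: "\<sigma> \<in> \<Sigma> - S" for \<sigma>
  proof -
    have \<sigma>\<Sigma>: "\<sigma> \<in> \<Sigma>"
      using \<sigma> by simp
    have "\<forall>\<^sub>F w in at \<sigma>. w \<in> \<Sigma> - S \<and> \<Phi> w - \<phi> w = h w \<and> T w (\<Phi> w) = g w"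
      using eventually_at_in_open[OF open_diff_S \<sigma>] h(2)[OF \<sigma>\<Sigma>] Tg[OF \<sigma>\<Sigma>]
      by eventually_elim auto
    then obtain s where s: "s > 0"
      "\<And>w. w \<noteq> \<sigma> \<Longrightarrow> dist w \<sigma> < s \<Longrightarrow> w \<in> \<Sigma> - S \<and> \<Phi> w - \<phi> w = h w \<and> T w (\<Phi> w) = g w"
      unfolding eventually_at by auto
    have sub: "ball \<sigma> s \<subseteq> \<Sigma> - S"
      using s(2) \<sigma> by (force simp: dist_commute)
    have \<sigma>s: "\<sigma> \<in> ball \<sigma> s"
      using s by simp
    show ?thesis
    proof (rule Y.holo_eq_at[OF open_ball \<sigma>s, where f = "\<lambda>\<sigma>. T \<sigma> (\<phi> \<sigma>)" and g = "\<lambda>\<sigma>. g \<sigma> - T \<sigma> (h \<sigma>)"])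
      show "holo_into (ball \<sigma> s) Y (\<lambda>\<sigma>. T \<sigma> (\<phi> \<sigma>))"
        by (rule holo_into_subset[OF T\<phi> sub])
      show "holo_into (ball \<sigma> s) Y (\<lambda>\<sigma>. g \<sigma> - T \<sigma> (h \<sigma>))"
        using sub by (intro holo_into_subset[OF Y.holo_into_diff[OF open_\<Sigma> g Th]]) auto
      fix w assume w: "w \<in> ball \<sigma> s - {\<sigma>}"
      then have w': "w \<in> \<Sigma>" "\<Phi> w = \<phi> w + h w" "T w (\<Phi> w) = g w"
        using s(2)[of w] by (auto simp: dist_commute algebra_simps)
      then have "g w = T w (\<phi> w) + T w (h w)"
        using linear_add[OF holo_family_linear[OF family w'(1)] \<phi>c holo_into_carr[OF h(1) w'(1)], of w] by simp
      then show "T w (\<phi> w) = g w - T w (h w)"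
        by simp
    qed
  qed
  with ac fin \<phi> h(1) show ?thesis
    using that by blast
qed

lemma singular_kernelE:
  assumes "\<phi> \<in> singular_kernel \<Sigma> X Y T"
  obtains a G where "\<And>p k. a p k \<in> carr X" "\<And>p. finite {k. a p k \<noteq> 0}"
    "\<phi> = (\<lambda>\<sigma>. \<Sum>p\<in>S. laurent_tail p (a p) \<sigma>)" "holo_into \<Sigma> Y G"
    "\<And>\<sigma>. \<sigma> \<in> \<Sigma> - S \<Longrightarrow> T \<sigma> (\<phi> \<sigma>) = G \<sigma>"
proof -
  obtain \<Phi> g where \<Phi>: "mero_into \<Sigma> X \<Phi>" "holo_into \<Sigma> Y g"
    "\<And>p. p \<in> \<Sigma> \<Longrightarrow> \<forall>\<^sub>F \<sigma> in at p. T \<sigma> (\<Phi> \<sigma>) = g \<sigma>" and \<phi>: "\<phi> = singular_part \<Sigma> X \<Phi>"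
    using assms unfolding singular_kernel_def by blast
  show ?thesis
  proof (rule singular_part_decomposition[OF \<Phi>(1,2)])
    show "\<forall>\<^sub>F \<sigma> in at p. T \<sigma> (\<Phi> \<sigma>) = g \<sigma>" if "p \<in> \<Sigma>" for p
      using \<Phi>(3)[OF that] .
    fix a h assume ah: "\<And>p k. a p k \<in> carr X" "\<And>p. finite {k. a p k \<noteq> 0}"
      "singular_part \<Sigma> X \<Phi> = (\<lambda>\<sigma>. \<Sum>p\<in>S. laurent_tail p (a p) \<sigma>)" "holo_into \<Sigma> X h"
      "\<And>\<sigma>. \<sigma> \<in> \<Sigma> - S \<Longrightarrow> T \<sigma> (singular_part \<Sigma> X \<Phi> \<sigma>) = g \<sigma> - T \<sigma> (h \<sigma>)"
    have hol: "holo_into \<Sigma> Y (\<lambda>\<sigma>. g \<sigma> - T \<sigma> (h \<sigma>))"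
      by (intro Y.holo_into_diff open_\<Sigma> \<Phi>(2) holo_family_apply[OF open_\<Sigma> family ah(4)])
    show ?thesis
      by (rule that[of a "\<lambda>\<sigma>. g \<sigma> - T \<sigma> (h \<sigma>)", unfolded \<phi>, OF ah(1) ah(2) ah(3) hol ah(5)])
  qed
qed

lemma singular_kernel_carr:
  assumes "\<phi> \<in> singular_kernel \<Sigma> X Y T"
  shows "\<phi> \<sigma> \<in> carr X"
  by (rule singular_kernelE[OF assms]) (auto intro!: X.carr_sum X.laurent_tail_carr)

lemma singular_kernel_holo:
  assumes "\<phi> \<in> singular_kernel \<Sigma> X Y T"
  shows "holo_into (\<Sigma> - S) X \<phi>"
proof (rule singular_kernelE[OF assms])
  fix a G assume a: "\<And>p k. a p k \<in> carr X" "\<And>p. finite {k. a p k \<noteq> 0}"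
    and \<phi>: "\<phi> = (\<lambda>\<sigma>. \<Sum>p\<in>S. laurent_tail p (a p) \<sigma>)"
  show ?thesis
    unfolding \<phi>
    by (intro X.holo_into_sum open_diff_S finite_S holo_into_subset[OF X.holo_laurent_tail[OF a]]) auto
qed

text \<open>
  Elements of the singular kernel arise in this way: the pointwise solutions of \<open>T \<Phi> = g\<close> off \<open>S\<close> are meromorphic on all of
  \<open>\<Sigma>\<close> by the inversion theorem, and \<open>\<phi>\<close> is their singular part.
\<close>

lemma singular_kernel_solution:
  assumes g: "holo_into \<Sigma> Y g"
  obtains \<phi> h where "\<phi> \<in> singular_kernel \<Sigma> X Y T" "holo_into \<Sigma> X h"
    "\<And>\<sigma>. \<sigma> \<in> \<Sigma> - S \<Longrightarrow> T \<sigma> (\<phi> \<sigma>) = g \<sigma> - T \<sigma> (h \<sigma>)"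
proof -
  have "\<exists>u. \<sigma> \<in> \<Sigma> - S \<longrightarrow> u \<in> carr X \<and> T \<sigma> u = g \<sigma>" for \<sigma>
    using surj[of \<sigma> "g \<sigma>"] holo_into_carr[OF g, of \<sigma>] by blast
  then obtain \<Phi> where \<Phi>: "\<And>\<sigma>. \<sigma> \<in> \<Sigma> - S \<Longrightarrow> \<Phi> \<sigma> \<in> carr X" "\<And>\<sigma>. \<sigma> \<in> \<Sigma> - S \<Longrightarrow> T \<sigma> (\<Phi> \<sigma>) = g \<sigma>"
    by metis
  have punct: "\<exists>r>0. ball p r \<subseteq> \<Sigma> \<and> ball p r - {p} \<subseteq> \<Sigma> - S" if p: "p \<in> \<Sigma>" for p
  proof -
    have "open (\<Sigma> - (S - {p}))" "p \<in> \<Sigma> - (S - {p})"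
      using open_\<Sigma> finite_S p by (auto simp: finite_imp_closed open_Diff)
    then obtain r where "r > 0" "ball p r \<subseteq> \<Sigma> - (S - {p})"
      using open_contains_ball by metis
    then show ?thesis
      by blast
  qed
  have mero: "mero_into \<Sigma> X \<Phi>"
    unfolding mero_into_def
  proof
    fix p assume p: "p \<in> \<Sigma>"
    then obtain r where r: "r > 0" "ball p r \<subseteq> \<Sigma>" "ball p r - {p} \<subseteq> \<Sigma> - S"
      using punct by blast
    have pr: "p \<in> ball p r"
      using r by simp
    show "\<exists>a. has_principal_part X \<Phi> p a"
      by (rule fredholm_solution_meromorphic[OF open_ball pr holo_family_subset[OF family r(2)] fredholm[OF p]
            inj surj holo_into_subset[OF g r(2)] \<Phi>]) (use r(3) in auto)
  qed
  have Tg: "\<forall>\<^sub>F \<sigma> in at p. T \<sigma> (\<Phi> \<sigma>) = g \<sigma>" if p: "p \<in> \<Sigma>" for p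
  proof -
    obtain r where r: "r > 0" "ball p r - {p} \<subseteq> \<Sigma> - S"
      using punct[OF p] by blast
    have "\<forall>\<^sub>F \<sigma> in at p. \<sigma> \<in> ball p r - {p}"
      using r by (intro eventually_at_in_open) auto
    then show ?thesis
      by eventually_elim (use r \<Phi>(2) in blast)
  qed
  have "singular_part \<Sigma> X \<Phi> \<in> singular_kernel \<Sigma> X Y T"
    unfolding singular_kernel_def using mero g Tg by blast
  moreover obtain h where "holo_into \<Sigma> X h"
    "\<And>\<sigma>. \<sigma> \<in> \<Sigma> - S \<Longrightarrow> T \<sigma> (singular_part \<Sigma> X \<Phi> \<sigma>) = g \<sigma> - T \<sigma> (h \<sigma>)"
    by (rule singular_part_decomposition[OF mero g Tg]) (assumption, (rule that; assumption))
  ultimately show ?thesis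
    using that by blast
qed

end

section \<open>The pairing of two dual families\<close>

text \<open>
  The properties of the boundary integral that the duality argument needs. They are phrased so as to be invariant under
  complex conjugation of the variable, which would reverse the orientation of a curve.
\<close>

locale residue_functional =
  fixes \<Sigma> S :: "complex set" and I :: "(complex \<Rightarrow> complex) \<Rightarrow> complex"
  assumes I_cong: "\<And>F G. (\<And>\<sigma>. \<sigma> \<in> \<Sigma> - S \<Longrightarrow> F \<sigma> = G \<sigma>) \<Longrightarrow> I F = I G"
    and I_add: "\<And>F G. F holomorphic_on \<Sigma> - S \<Longrightarrow> G holomorphic_on \<Sigma> - S \<Longrightarrow>
      I (\<lambda>\<sigma>. F \<sigma> + G \<sigma>) = I F + I G"
    and I_scale: "\<And>F c. F holomorphic_on \<Sigma> - S \<Longrightarrow> I (\<lambda>\<sigma>. c * F \<sigma>) = c * I F"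
    and I_holomorphic: "\<And>F. F holomorphic_on \<Sigma> \<Longrightarrow> I F = 0"
    and I_pole: "\<And>W p. W holomorphic_on \<Sigma> \<Longrightarrow> p \<in> S \<Longrightarrow> I (\<lambda>\<sigma>. W \<sigma> / (\<sigma> - p)) = 0 \<Longrightarrow> W p = 0"

lemma holomorphic_cnj_cnj:
  assumes "F holomorphic_on cnj ` V" "open V"
  shows "(\<lambda>\<sigma>. cnj (F (cnj \<sigma>))) holomorphic_on V"
  using holomorphic_on_compose_cnj_cnj[OF assms] by (simp add: o_def)

lemma (in residue_functional) conjugate:
  assumes \<Sigma>: "open \<Sigma>" "finite S"
  shows "residue_functional (cnj ` \<Sigma>) (cnj ` S) (\<lambda>F. cnj (I (\<lambda>\<sigma>. cnj (F (cnj \<sigma>)))))"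
proof
  have diff: "cnj ` \<Sigma> - cnj ` S = cnj ` (\<Sigma> - S)"
    by (auto simp: image_iff)
  have op: "open (\<Sigma> - S)"
    using \<Sigma> by (simp add: finite_imp_closed open_Diff)
  note hc = holomorphic_cnj_cnj[OF _ op] holomorphic_cnj_cnj[OF _ \<Sigma>(1)]
  show "cnj (I (\<lambda>\<sigma>. cnj (F (cnj \<sigma>)))) = cnj (I (\<lambda>\<sigma>. cnj (G (cnj \<sigma>))))"
    if "\<And>\<sigma>. \<sigma> \<in> cnj ` \<Sigma> - cnj ` S \<Longrightarrow> F \<sigma> = G \<sigma>" for F G
    using that unfolding diff by (intro arg_cong[of _ _ cnj] I_cong) auto
  show "cnj (I (\<lambda>\<sigma>. cnj (F (cnj \<sigma>) + G (cnj \<sigma>))))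
      = cnj (I (\<lambda>\<sigma>. cnj (F (cnj \<sigma>)))) + cnj (I (\<lambda>\<sigma>. cnj (G (cnj \<sigma>))))"
    if "F holomorphic_on cnj ` \<Sigma> - cnj ` S" "G holomorphic_on cnj ` \<Sigma> - cnj ` S" for F G
    using I_add[OF hc(1) hc(1), of F G] that unfolding diff by simp
  show "cnj (I (\<lambda>\<sigma>. cnj (c * F (cnj \<sigma>)))) = c * cnj (I (\<lambda>\<sigma>. cnj (F (cnj \<sigma>))))"
    if "F holomorphic_on cnj ` \<Sigma> - cnj ` S" for F c
    using I_scale[OF hc(1), of F "cnj c"] that unfolding diff by simp
  show "cnj (I (\<lambda>\<sigma>. cnj (F (cnj \<sigma>)))) = 0" if "F holomorphic_on cnj ` \<Sigma>" for F
    using I_holomorphic[OF hc(2)[OF that]] by simp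
  show "W p = 0" if "W holomorphic_on cnj ` \<Sigma>" "p \<in> cnj ` S"
    "cnj (I (\<lambda>\<sigma>. cnj (W (cnj \<sigma>) / (cnj \<sigma> - p)))) = 0" for W p
    using I_pole[OF hc(2)[OF that(1)], of "cnj p"] that(2,3) by (auto simp: image_iff)
qed

text \<open>
  This setting is symmetric in the two families: exchanging them, conjugating \<open>\<Sigma>\<close> and \<open>S\<close>, and replacing \<open>I\<close>
  by its conjugate gives another instance.
\<close>

locale dual_fredholm_families =
  P: fredholm_family_on X H' \<Sigma> S T + P': fredholm_family_on X' H "cnj ` \<Sigma>" "cnj ` S" T' +
  residue_functional \<Sigma> S I
  for X H :: "'e::complex_vector hspace" and X' H' :: "'f::complex_vector hspace"
    and \<Sigma> S T T' I +
  assumes incl: "bounded_op X H (\<lambda>u. u)" and incl': "bounded_op X' H' (\<lambda>v. v)"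
    and dual: "\<And>\<sigma> u v. \<sigma> \<in> \<Sigma> \<Longrightarrow> u \<in> carr X \<Longrightarrow> v \<in> carr X' \<Longrightarrow>
      ip H' (T \<sigma> u) v = ip H u (T' (cnj \<sigma>) v)"
begin

abbreviation "K \<equiv> singular_kernel \<Sigma> X H' T"
abbreviation "K' \<equiv> singular_kernel (cnj ` \<Sigma>) X' H T'"

definition pairing :: "(complex \<Rightarrow> 'e) \<Rightarrow> (complex \<Rightarrow> 'f) \<Rightarrow> complex" where
  "pairing \<phi> \<psi> = I (\<lambda>\<sigma>. ip H (\<phi> \<sigma>) (T' (cnj \<sigma>) (\<psi> (cnj \<sigma>))))"

sublocale XH: two_hilb X H
  by (simp add: two_hilb_def P.X.hilb_axioms P'.Y.hilb_axioms)

sublocale XH': two_hilb X' H'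
  by (simp add: two_hilb_def P'.X.hilb_axioms P.Y.hilb_axioms)

lemma cnj_mem: "\<sigma> \<in> \<Sigma> - S \<Longrightarrow> cnj \<sigma> \<in> cnj ` \<Sigma> - cnj ` S"
  by (auto simp: image_iff)

lemma cnj_diff: "cnj ` \<Sigma> - cnj ` S = cnj ` (\<Sigma> - S)"
  by (auto simp: image_iff)

lemma holo_incl: "open V \<Longrightarrow> holo_into V X f \<Longrightarrow> holo_into V H f"
  using XH.holo_family_apply[OF _ XH.holo_family_const[OF incl]] .

lemma X_sub: "u \<in> carr X \<Longrightarrow> u \<in> carr H"
  using incl by (simp add: bounded_op_def clinear_between_def)

lemma X'_sub: "v \<in> carr X' \<Longrightarrow> v \<in> carr H'"
  using incl' by (simp add: bounded_op_def clinear_between_def)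

lemma T'_linear: "\<sigma> \<in> \<Sigma> - S \<Longrightarrow> clinear_between (carr X') (carr H) (T' (cnj \<sigma>))"
  using P'.holo_family_linear[OF P'.family] by blast

lemma holomorphic_integrand:
  assumes \<phi>: "\<phi> \<in> K" and \<psi>: "\<psi> \<in> K'"
  shows "(\<lambda>\<sigma>. ip H (\<phi> \<sigma>) (T' (cnj \<sigma>) (\<psi> (cnj \<sigma>)))) holomorphic_on \<Sigma> - S"
proof (rule P'.Y.holomorphic_ip_cnj[where g = "\<lambda>\<tau>. T' \<tau> (\<psi> \<tau>)"])
  show "holo_into (\<Sigma> - S) H \<phi>"
    by (rule holo_incl[OF P.open_diff_S P.singular_kernel_holo[OF \<phi>]])
  have "holo_into (cnj ` \<Sigma> - cnj ` S) H (\<lambda>\<tau>. T' \<tau> (\<psi> \<tau>))"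
    by (rule P'.holo_family_apply[OF P'.open_diff_S holo_family_subset[OF P'.family]
          P'.singular_kernel_holo[OF \<psi>]]) auto
  then show "holo_into (cnj ` (\<Sigma> - S)) H (\<lambda>\<tau>. T' \<tau> (\<psi> \<tau>))"
    by (simp add: cnj_diff)
qed (rule P.open_diff_S)

lemma sesquilinear: "sesquilinear_pairing K K' pairing"
proof -
  note \<phi>c = P.singular_kernel_carr[THEN X_sub] and \<psi>c = P'.singular_kernel_carr
    and hol = holomorphic_integrand
  have Tc: "T' (cnj \<sigma>) (\<psi> (cnj \<sigma>)) \<in> carr H" if "\<psi> \<in> K'" "\<sigma> \<in> \<Sigma> - S" for \<psi> \<sigma>
    using P'.linear_carr[OF T'_linear[OF that(2)] \<psi>c[OF that(1)]] .
  show ?thesis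
    unfolding sesquilinear_pairing_def
  proof (intro conjI ballI allI)
    show "pairing (\<lambda>\<sigma>. \<phi> \<sigma> + \<phi>' \<sigma>) \<psi> = pairing \<phi> \<psi> + pairing \<phi>' \<psi>"
      if "\<phi> \<in> K" "\<phi>' \<in> K" "\<psi> \<in> K'" for \<phi> \<phi>' \<psi>
      unfolding pairing_def using that
      by (subst I_add[OF hol hol, symmetric]) (auto intro!: I_cong simp: P'.Y.ip_add_left \<phi>c Tc)
    show "pairing (\<lambda>\<sigma>. c *\<^sub>C \<phi> \<sigma>) \<psi> = c * pairing \<phi> \<psi>" if "\<phi> \<in> K" "\<psi> \<in> K'" for \<phi> \<psi> c
      unfolding pairing_def using that
      by (subst I_scale[OF hol, symmetric]) (auto intro!: I_cong simp: P'.Y.ip_scale_left \<phi>c Tc)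
    show "pairing \<phi> (\<lambda>\<sigma>. \<psi> \<sigma> + \<psi>' \<sigma>) = pairing \<phi> \<psi> + pairing \<phi> \<psi>'"
      if "\<phi> \<in> K" "\<psi> \<in> K'" "\<psi>' \<in> K'" for \<phi> \<psi> \<psi>'
      unfolding pairing_def using that
      by (subst I_add[OF hol hol, symmetric])
        (auto intro!: I_cong simp: P'.linear_add[OF T'_linear] \<psi>c P'.Y.ip_add_right \<phi>c Tc)
    show "pairing \<phi> (\<lambda>\<sigma>. c *\<^sub>C \<psi> \<sigma>) = cnj c * pairing \<phi> \<psi>" if "\<phi> \<in> K" "\<psi> \<in> K'" for \<phi> \<psi> c
      unfolding pairing_def using that
      by (subst I_scale[OF hol, symmetric])
        (auto intro!: I_cong simp: P'.linear_scale[OF T'_linear] \<psi>c P'.Y.ip_scale_right \<phi>c Tc)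
  qed
qed

text \<open>
  Solve \<open>T' \<Psi> = cnj (q (cnj \<tau>)) u\<close> and let \<open>\<psi>\<close> be the singular part of the solution. Off \<open>S\<close>, the
  function \<open>q (\<phi>, u)\<close> differs from the integrand of the pairing with \<open>\<psi>\<close> by \<open>(T \<phi>, h)\<close>, which is
  holomorphic on \<open>\<Sigma>\<close>.
\<close>

lemma moments_vanish:
  assumes \<phi>: "\<phi> \<in> K" and zero: "\<And>\<psi>. \<psi> \<in> K' \<Longrightarrow> pairing \<phi> \<psi> = 0"
    and q: "q holomorphic_on \<Sigma>" and u: "u \<in> carr H"
  shows "I (\<lambda>\<sigma>. q \<sigma> * ip H (\<phi> \<sigma>) u) = 0"
proof -
  obtain G where G: "holo_into \<Sigma> H' G" "\<And>\<sigma>. \<sigma> \<in> \<Sigma> - S \<Longrightarrow> T \<sigma> (\<phi> \<sigma>) = G \<sigma>"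
    by (rule P.singular_kernelE[OF \<phi>]) (rule that; assumption)
  have q': "(\<lambda>\<tau>. cnj (q (cnj \<tau>))) holomorphic_on cnj ` \<Sigma>"
    using q P.open_\<Sigma> by (intro holomorphic_cnj_cnj) auto
  have "holo_into (cnj ` \<Sigma>) H (\<lambda>\<tau>. cnj (q (cnj \<tau>)) *\<^sub>C u)"
    by (intro P'.Y.holo_into_scale P'.open_\<Sigma> q' P'.Y.holo_into_const u)
  then obtain \<psi> h where \<psi>: "\<psi> \<in> K'" and h: "holo_into (cnj ` \<Sigma>) X' h"
    and T\<psi>: "\<And>\<tau>. \<tau> \<in> cnj ` \<Sigma> - cnj ` S \<Longrightarrow> T' \<tau> (\<psi> \<tau>) = cnj (q (cnj \<tau>)) *\<^sub>C u - T' \<tau> (h \<tau>)"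
    by (rule P'.singular_kernel_solution) (rule that; assumption)
  define F where "F \<sigma> = ip H' (G \<sigma>) (h (cnj \<sigma>))" for \<sigma>
  have h': "holo_into (cnj ` \<Sigma>) H' h"
    using XH'.holo_family_apply[OF P'.open_\<Sigma> XH'.holo_family_const[OF incl'] h] .
  have F: "F holomorphic_on \<Sigma>"
    unfolding F_def by (rule P.Y.holomorphic_ip_cnj[OF P.open_\<Sigma> G(1) h'])
  have split: "q \<sigma> * ip H (\<phi> \<sigma>) u = ip H (\<phi> \<sigma>) (T' (cnj \<sigma>) (\<psi> (cnj \<sigma>))) + F \<sigma>"
    if \<sigma>: "\<sigma> \<in> \<Sigma> - S" for \<sigma>
  proof -
    have c: "\<phi> \<sigma> \<in> carr X" "\<phi> \<sigma> \<in> carr H" "h (cnj \<sigma>) \<in> carr X'"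
      using P.singular_kernel_carr[OF \<phi>] X_sub holo_into_carr[OF h] \<sigma> by auto
    have "T' (cnj \<sigma>) (h (cnj \<sigma>)) \<in> carr H"
      using P'.linear_carr[OF T'_linear[OF \<sigma>] c(3)] .
    then have "ip H (\<phi> \<sigma>) (T' (cnj \<sigma>) (\<psi> (cnj \<sigma>)))
        = q \<sigma> * ip H (\<phi> \<sigma>) u - ip H (\<phi> \<sigma>) (T' (cnj \<sigma>) (h (cnj \<sigma>)))"
      using T\<psi>[OF cnj_mem[OF \<sigma>]] c u by (simp add: P'.Y.ip_diff_right P'.Y.ip_scale_right)
    also have "ip H (\<phi> \<sigma>) (T' (cnj \<sigma>) (h (cnj \<sigma>))) = F \<sigma>"
      using dual[of \<sigma> "\<phi> \<sigma>" "h (cnj \<sigma>)"] G(2)[OF \<sigma>] c \<sigma> by (simp add: F_def)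
    finally show ?thesis
      by simp
  qed
  have "I (\<lambda>\<sigma>. q \<sigma> * ip H (\<phi> \<sigma>) u) = I (\<lambda>\<sigma>. ip H (\<phi> \<sigma>) (T' (cnj \<sigma>) (\<psi> (cnj \<sigma>))) + F \<sigma>)"
    using split by (rule I_cong)
  also have "\<dots> = pairing \<phi> \<psi> + I F"
    unfolding pairing_def
    using holomorphic_on_subset[OF F] by (intro I_add holomorphic_integrand \<phi> \<psi>) auto
  also have "\<dots> = 0"
    using zero[OF \<psi>] I_holomorphic[OF F] by simp
  finally show ?thesis .
qed

text \<open>
  Suppose that the leading coefficient \<open>u\<close> at some \<open>p0\<close> is not zero. The polynomial \<open>q\<close> cancels the poles at all
  other points and all but one order at \<open>p0\<close>, so that \<open>q (\<phi>, u)\<close> has a single simple pole, whose residue is a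
  nonzero multiple of \<open>(u, u)\<close>.
\<close>

lemma nondegenerate_left:
  assumes \<phi>K: "\<phi> \<in> K" and zero: "\<And>\<psi>. \<psi> \<in> K' \<Longrightarrow> pairing \<phi> \<psi> = 0"
  shows "\<phi> = (\<lambda>\<sigma>. 0)"
proof -
  obtain a where a: "\<And>p k. a p k \<in> carr X" "\<And>p. finite {k. a p k \<noteq> 0}"
    and \<phi>: "\<phi> = (\<lambda>\<sigma>. \<Sum>p\<in>S. laurent_tail p (a p) \<sigma>)"
    by (rule P.singular_kernelE[OF \<phi>K]) (rule that; assumption)
  have "a p0 = (\<lambda>_. 0)" if p0: "p0 \<in> S" for p0
  proof (rule ccontr)
    assume "a p0 \<noteq> (\<lambda>_. 0)"
    then obtain k0 where k0: "a p0 k0 \<noteq> 0" and k0': "\<And>k. k > k0 \<Longrightarrow> a p0 k = 0"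
      using leading_coefficient[OF a(2)] by metis
    define u where "u = a p0 k0"
    have u: "u \<in> carr X" "u \<in> carr H" "u \<noteq> 0"
      using a k0 X_sub by (auto simp: u_def)
    obtain M where M: "\<And>p k. k > M p \<Longrightarrow> a p k = 0"
    proof -
      have "\<exists>M. \<forall>k>M. a p k = 0" for p
        using finite_support_bound[OF a(2), of p] by (metis less_imp_le)
      then show ?thesis
        using that by metis
    qed
    have "\<exists>W. holo_into UNIV X W \<and> (\<forall>\<sigma>. \<sigma> \<noteq> p \<longrightarrow> (\<sigma> - p) ^ Suc (M p) *\<^sub>C laurent_tail p (a p) \<sigma> = W \<sigma>)" for p
      by (rule P.X.laurent_tail_clear_pole[of "a p" "M p" p, OF a(1) M]) (assumption, blast)
    then obtain W where W: "\<And>p. holo_into UNIV X (W p)"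
      "\<And>p \<sigma>. \<sigma> \<noteq> p \<Longrightarrow> (\<sigma> - p) ^ Suc (M p) *\<^sub>C laurent_tail p (a p) \<sigma> = W p \<sigma>"
      by metis
    obtain W0 where W0: "holo_into UNIV X W0" "W0 p0 = u"
      "\<And>\<sigma>. \<sigma> \<noteq> p0 \<Longrightarrow> (\<sigma> - p0) ^ Suc k0 *\<^sub>C laurent_tail p0 (a p0) \<sigma> = W0 \<sigma>"
      by (rule P.X.laurent_tail_clear_pole[of "a p0" k0 p0, OF a(1) k0'])
        (assumption, rule that, assumption, simp add: u_def, assumption)
    define pol where "pol R \<sigma> = (\<Prod>p\<in>R. (\<sigma> - p) ^ Suc (M p))" for R and \<sigma> :: complex
    have pol_hol: "pol R holomorphic_on A" for R A
      unfolding pol_def by (intro holomorphic_intros)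
    define R where "R = S - {p0}"
    have R: "finite R"
      using P.finite_S by (simp add: R_def)
    define q where "q \<sigma> = (\<sigma> - p0) ^ k0 * pol R \<sigma>" for \<sigma>
    \<comment> \<open>The holomorphic extension of \<open>(\<sigma> - p0) q (\<phi>, u)\<close>: the first summand comes from the principal part at
      \<open>p0\<close>, the others from the principal parts at the remaining points.\<close>
    define V where "V \<sigma> = pol R \<sigma> * ip H (W0 \<sigma>) u
        + (\<sigma> - p0) ^ Suc k0 * (\<Sum>p\<in>R. pol (R - {p}) \<sigma> * ip H (W p \<sigma>) u)" for \<sigma>
    have ipW: "(\<lambda>\<sigma>. ip H (f \<sigma>) u) holomorphic_on A" if "holo_into UNIV X f" for f A
      using P'.Y.holo_into_ip[OF open_UNIV holo_incl[OF open_UNIV that] u(2)] holomorphic_on_subset by blast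
    have V: "V holomorphic_on \<Sigma>"
      unfolding V_def by (intro holomorphic_intros pol_hol ipW W0 W)
    have "q \<sigma> * ip H (\<phi> \<sigma>) u = V \<sigma> / (\<sigma> - p0)" if \<sigma>: "\<sigma> \<in> \<Sigma> - S" for \<sigma>
    proof -
      have ne: "\<sigma> \<noteq> p" if "p \<in> S" for p
        using \<sigma> that by blast
      have tc: "laurent_tail p (a p) \<sigma> \<in> carr H" for p
        using X_sub[OF P.X.laurent_tail_carr[of "a p", OF a(1)]] .
      have 1: "ip H (W0 \<sigma>) u = (\<sigma> - p0) ^ Suc k0 * ip H (laurent_tail p0 (a p0) \<sigma>) u"
        using W0(3)[OF ne[OF p0]] P'.Y.ip_scale_left[OF tc u(2)] by metis
      have "pol (R - {p}) \<sigma> * ip H (W p \<sigma>) u = pol R \<sigma> * ip H (laurent_tail p (a p) \<sigma>) u"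
        if p: "p \<in> R" for p
      proof -
        have "ip H (W p \<sigma>) u = (\<sigma> - p) ^ Suc (M p) * ip H (laurent_tail p (a p) \<sigma>) u"
          using W(2)[of \<sigma> p] ne[of p] p P'.Y.ip_scale_left[OF tc u(2)] by (metis DiffD1 R_def)
        moreover have "pol R \<sigma> = (\<sigma> - p) ^ Suc (M p) * pol (R - {p}) \<sigma>"
          unfolding pol_def by (rule prod.remove[OF R p])
        ultimately show ?thesis
          by (simp add: mult_ac)
      qed
      then have 2: "(\<Sum>p\<in>R. pol (R - {p}) \<sigma> * ip H (W p \<sigma>) u)
          = pol R \<sigma> * (\<Sum>p\<in>R. ip H (laurent_tail p (a p) \<sigma>) u)"
        by (simp add: sum_distrib_left)
      have 3: "ip H (\<phi> \<sigma>) u = ip H (laurent_tail p0 (a p0) \<sigma>) u + (\<Sum>p\<in>R. ip H (laurent_tail p (a p) \<sigma>) u)"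
        unfolding \<phi> R_def using P.finite_S tc u(2) p0
        by (simp add: P'.Y.ip_sum_left P'.Y.ip_add_left P'.Y.carr_sum sum.remove[of S p0])
      have "V \<sigma> = (\<sigma> - p0) ^ Suc k0 * pol R \<sigma> * ip H (\<phi> \<sigma>) u"
        unfolding V_def 1 2 3 by (simp only: distrib_left mult_ac)
      then show ?thesis
        using ne[OF p0] by (simp add: q_def)
    qed
    then have "I (\<lambda>\<sigma>. V \<sigma> / (\<sigma> - p0)) = I (\<lambda>\<sigma>. q \<sigma> * ip H (\<phi> \<sigma>) u)"
      by (intro I_cong) simp
    also have "\<dots> = 0"
      by (rule moments_vanish[OF \<phi>K zero _ u(2)])
        (auto simp: q_def intro!: holomorphic_intros pol_hol)
    finally have "V p0 = 0"
      by (rule I_pole[OF V p0])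
    then have "pol R p0 * ip H u u = 0"
      by (simp add: V_def W0(2))
    moreover have "pol R p0 \<noteq> 0"
      unfolding pol_def using R by (auto simp: R_def)
    ultimately show False
      using u by (simp add: P'.Y.ip_self)
  qed
  then show ?thesis
    unfolding \<phi> by (simp add: laurent_tail_def fun_eq_iff)
qed

lemma swap: "dual_fredholm_families X' H' X H (cnj ` \<Sigma>) (cnj ` S) T' T (\<lambda>F. cnj (I (\<lambda>\<sigma>. cnj (F (cnj \<sigma>)))))"
proof -
  have "dual_fredholm_families_axioms X' H' X H (cnj ` \<Sigma>) T' T"
  proof
    fix \<tau> v u assume \<tau>: "\<tau> \<in> cnj ` \<Sigma>" and v: "v \<in> carr X'" and u: "u \<in> carr X"
    then obtain \<sigma> where \<sigma>: "\<sigma> \<in> \<Sigma>" "\<tau> = cnj \<sigma>"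
      by blast
    have c: "T' \<tau> v \<in> carr H" "T \<sigma> u \<in> carr H'" "u \<in> carr H" "v \<in> carr H'"
      using P'.linear_carr[OF P'.holo_family_linear[OF P'.family \<tau>] v]
        P.linear_carr[OF P.holo_family_linear[OF P.family \<sigma>(1)] u] X_sub[OF u] X'_sub[OF v] by auto
    have "ip H (T' \<tau> v) u = cnj (ip H u (T' \<tau> v))"
      using c by (intro P'.Y.ip_commute)
    also have "\<dots> = cnj (ip H' (T \<sigma> u) v)"
      using dual[OF \<sigma>(1) u v] \<sigma> by simp
    also have "\<dots> = ip H' v (T \<sigma> u)"
      using c by (intro P.Y.ip_commute[symmetric])
    finally show "ip H (T' \<tau> v) u = ip H' v (T (cnj \<tau>) u)"
      using \<sigma> by simp
  qed (rule incl incl')+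
  then show ?thesis
    using P.fredholm_family_on_axioms P'.fredholm_family_on_axioms conjugate[OF P.open_\<Sigma> P.finite_S]
    by (simp add: dual_fredholm_families_def)
qed

lemma pairing_swap:
  assumes "\<phi> \<in> K" "\<psi> \<in> K'"
  shows "dual_fredholm_families.pairing H' T (\<lambda>F. cnj (I (\<lambda>\<sigma>. cnj (F (cnj \<sigma>))))) \<psi> \<phi> = cnj (pairing \<phi> \<psi>)"
proof -
  interpret sw: dual_fredholm_families X' H' X H "cnj ` \<Sigma>" "cnj ` S" T' T
    "\<lambda>F. cnj (I (\<lambda>\<sigma>. cnj (F (cnj \<sigma>))))"
    by (rule swap)
  have "cnj (ip H' (\<psi> (cnj \<sigma>)) (T \<sigma> (\<phi> \<sigma>))) = ip H (\<phi> \<sigma>) (T' (cnj \<sigma>) (\<psi> (cnj \<sigma>)))"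
    if \<sigma>: "\<sigma> \<in> \<Sigma> - S" for \<sigma>
  proof -
    have c: "\<phi> \<sigma> \<in> carr X" "\<psi> (cnj \<sigma>) \<in> carr X'"
      using P.singular_kernel_carr P'.singular_kernel_carr assms by auto
    have \<sigma>\<Sigma>: "\<sigma> \<in> \<Sigma>"
      using \<sigma> by simp
    have "cnj (ip H' (\<psi> (cnj \<sigma>)) (T \<sigma> (\<phi> \<sigma>))) = ip H' (T \<sigma> (\<phi> \<sigma>)) (\<psi> (cnj \<sigma>))"
      using P.linear_carr[OF P.holo_family_linear[OF P.family \<sigma>\<Sigma>] c(1)] X'_sub[OF c(2)]
      by (intro P.Y.ip_commute[symmetric])
    also have "\<dots> = ip H (\<phi> \<sigma>) (T' (cnj \<sigma>) (\<psi> (cnj \<sigma>)))"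
      by (rule dual[OF \<sigma>\<Sigma> c])
    finally show ?thesis .
  qed
  then show ?thesis
    unfolding sw.pairing_def pairing_def by (intro arg_cong[of _ _ cnj] I_cong) simp
qed

theorem nondegenerate: "nondegenerate_pairing K K' pairing"
  unfolding nondegenerate_pairing_def
proof (intro conjI ballI impI)
  show "\<phi> = (\<lambda>\<sigma>. 0)" if "\<phi> \<in> K" "\<forall>\<psi>\<in>K'. pairing \<phi> \<psi> = 0" for \<phi>
    using nondegenerate_left that by blast
  interpret sw: dual_fredholm_families X' H' X H "cnj ` \<Sigma>" "cnj ` S" T' T
    "\<lambda>F. cnj (I (\<lambda>\<sigma>. cnj (F (cnj \<sigma>))))"
    by (rule swap)
  show "\<psi> = (\<lambda>\<sigma>. 0)" if \<psi>: "\<psi> \<in> K'" and zero: "\<forall>\<phi>\<in>K. pairing \<phi> \<psi> = 0" for \<psi>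
  proof (rule sw.nondegenerate_left[OF \<psi>])
    fix \<phi> assume "\<phi> \<in> singular_kernel (cnj ` cnj ` \<Sigma>) X H' T"
    then have "\<phi> \<in> K"
      by simp
    then show "sw.pairing \<psi> \<phi> = 0"
      using pairing_swap[OF _ \<psi>] zero by simp
  qed
qed

end

section \<open>The boundary integral as a residue functional\<close>

lemma boundary_residue_functional:
  assumes bd: "smooth_oriented_boundary \<Omega> \<Gamma>" and \<Omega>: "open \<Omega>" "bounded \<Omega>"
    and \<Sigma>: "open \<Sigma>" "connected \<Sigma>" "closure \<Omega> \<subseteq> \<Sigma>" and S: "finite S" "S \<subseteq> \<Omega>"
  shows "residue_functional \<Sigma> S (\<lambda>F. 1 / (2 * complex_of_real pi) * boundary_integral \<Gamma> F)"
proof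
  note curves = boundary_curves[OF bd]
  have fr: "frontier \<Omega> \<subseteq> \<Sigma> - S"
    using \<Sigma>(3) S(2) \<Omega>(1) by (auto simp: frontier_def interior_open)
  have img: "path_image \<gamma> \<subseteq> \<Sigma> - S" if "\<gamma> \<in> \<Gamma>" for \<gamma>
    using curves(3)[OF that] fr by blast
  have op: "open (\<Sigma> - S)"
    using \<Sigma>(1) S(1) by (simp add: finite_imp_closed open_Diff)
  have int: "F contour_integrable_on \<gamma>" if "F holomorphic_on \<Sigma> - S" "\<gamma> \<in> \<Gamma>" for F \<gamma>
    using contour_integrable_holomorphic_simple[OF that(1) op curves(1)[OF that(2)] img[OF that(2)]] .
  show "1 / (2 * complex_of_real pi) * boundary_integral \<Gamma> F = 1 / (2 * complex_of_real pi) * boundary_integral \<Gamma> G"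
    if "\<And>\<sigma>. \<sigma> \<in> \<Sigma> - S \<Longrightarrow> F \<sigma> = G \<sigma>" for F G
  proof -
    have "contour_integral \<gamma> F = contour_integral \<gamma> G" if "\<gamma> \<in> \<Gamma>" for \<gamma>
      using img[OF that] \<open>\<And>\<sigma>. \<sigma> \<in> \<Sigma> - S \<Longrightarrow> F \<sigma> = G \<sigma>\<close> by (intro contour_integral_eq) auto
    then show ?thesis
      by (simp add: boundary_integral_def)
  qed
  show "1 / (2 * complex_of_real pi) * boundary_integral \<Gamma> (\<lambda>\<sigma>. F \<sigma> + G \<sigma>)
      = 1 / (2 * complex_of_real pi) * boundary_integral \<Gamma> F + 1 / (2 * complex_of_real pi) * boundary_integral \<Gamma> G"
    if "F holomorphic_on \<Sigma> - S" "G holomorphic_on \<Sigma> - S" for F G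
    using int[OF that(1)] int[OF that(2)]
    by (simp add: boundary_integral_def contour_integral_add sum.distrib add_divide_distrib)
  show "1 / (2 * complex_of_real pi) * boundary_integral \<Gamma> (\<lambda>\<sigma>. c * F \<sigma>)
      = c * (1 / (2 * complex_of_real pi) * boundary_integral \<Gamma> F)"
    if "F holomorphic_on \<Sigma> - S" for F c
    using int[OF that] by (simp add: boundary_integral_def contour_integral_lmul sum_distrib_left)
  show "1 / (2 * complex_of_real pi) * boundary_integral \<Gamma> F = 0" if "F holomorphic_on \<Sigma>" for F
    using boundary_integral_holomorphic[OF bd \<Omega> \<Sigma> that] by simp
  show "W p = 0" if "W holomorphic_on \<Sigma>" "p \<in> S"
    "1 / (2 * complex_of_real pi) * boundary_integral \<Gamma> (\<lambda>\<sigma>. W \<sigma> / (\<sigma> - p)) = 0" for W p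
    using boundary_integral_cauchy[OF bd \<Omega> \<Sigma> _ that(1), of p] that(2,3) S(2) by auto
qed

section \<open>Adjoints of densely defined operators\<close>

text \<open>
  Density of the domain makes the adjoint single valued: the difference \<open>w - w'\<close> is orthogonal to vectors
  arbitrarily close to itself.
\<close>

lemma (in hilb) eq_if_ip_eq_on_dense:
  assumes dense: "\<And>u e. u \<in> carr X \<Longrightarrow> e > 0 \<Longrightarrow> \<exists>v\<in>D. hnorm X (u - v) < e"
    and D: "D \<subseteq> carr X" and w: "w \<in> carr X" "w' \<in> carr X"
    and eq: "\<And>u. u \<in> D \<Longrightarrow> ip X u w = ip X u w'"
  shows "w = w'"
proof (rule ccontr)
  assume "w \<noteq> w'"
  define d where "d = w - w'"
  have d: "d \<in> carr X" "hnorm X d > 0"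
    using w \<open>w \<noteq> w'\<close> hnorm_pos[of d] by (auto simp: d_def)
  obtain v where v: "v \<in> D" "hnorm X (d - v) < hnorm X d"
    using dense[OF d] by blast
  then have vc: "v \<in> carr X"
    using D by blast
  have "ip X v d = 0"
    using eq[OF v(1)] vc w by (simp add: d_def ip_diff_right)
  then have "ip X (d - v) d = complex_of_real ((hnorm X d)\<^sup>2)"
    using d(1) vc by (simp add: ip_diff_left ip_self)
  then have "(hnorm X d)\<^sup>2 \<le> hnorm X (d - v) * hnorm X d"
    using cauchy_schwarz[of "d - v" d] d(1) vc by (simp add: norm_power)
  then have "hnorm X d \<le> hnorm X (d - v)"
    using d(2) by (simp add: power2_eq_square)
  then show False
    using v(2) by simp
qed

locale densely_defined = two_hilb H K
  for H :: "'e::complex_vector hspace" and K :: "'f::complex_vector hspace" +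
  fixes D :: "'e set"
  assumes dom: "D \<subseteq> carr H" and dense: "\<And>u e. u \<in> carr H \<Longrightarrow> e > 0 \<Longrightarrow> \<exists>v\<in>D. hnorm H (u - v) < e"
begin

lemma hilbert_adjoint_eqI:
  assumes "w \<in> carr H" "\<And>u. u \<in> D \<Longrightarrow> ip K (T u) v = ip H u w"
  shows "hilbert_adjoint D H K T v = w"
  unfolding hilbert_adjoint_def
proof (rule the_equality)
  fix w' assume w': "w' \<in> carr H \<and> (\<forall>u\<in>D. ip K (T u) v = ip H u w')"
  then have "ip H u w' = ip H u w" if "u \<in> D" for u
    using assms(2)[OF that] that by simp
  then show "w' = w"
    using X.eq_if_ip_eq_on_dense[OF dense dom] w' assms(1) by blast
qed (use assms in blast)

lemma hilbert_adjoint: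
  assumes "v \<in> adjoint_domain D H K T"
  shows "hilbert_adjoint D H K T v \<in> carr H"
    and "\<And>u. u \<in> D \<Longrightarrow> ip K (T u) v = ip H u (hilbert_adjoint D H K T v)"
proof -
  obtain w where w: "w \<in> carr H" "\<And>u. u \<in> D \<Longrightarrow> ip K (T u) v = ip H u w"
    using assms unfolding adjoint_domain_def by blast
  have eq: "hilbert_adjoint D H K T v = w"
    by (rule hilbert_adjoint_eqI[OF w])
  show "hilbert_adjoint D H K T v \<in> carr H"
    unfolding eq by (rule w)
  show "ip K (T u) v = ip H u (hilbert_adjoint D H K T v)" if "u \<in> D" for u
    unfolding eq by (rule w(2)[OF that])
qed

lemma hilbert_adjoint_injective:
  assumes v: "v \<in> adjoint_domain D H K T" and zero: "hilbert_adjoint D H K T v = 0"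
    and surj: "\<And>y. y \<in> carr K \<Longrightarrow> \<exists>u\<in>D. T u = y"
  shows "v = 0"
proof -
  have vc: "v \<in> carr K"
    using v by (simp add: adjoint_domain_def)
  then obtain u where u: "u \<in> D" "T u = v"
    using surj by blast
  have "ip K v v = 0"
    using hilbert_adjoint(2)[OF v u(1)] zero u dom by auto
  then show ?thesis
    using vc by (simp add: Y.ip_self)
qed

text \<open>
  The functional \<open>y \<mapsto> (g y, w)\<close>, with \<open>g\<close> a bounded inverse of \<open>T\<close>, is represented by a vector \<open>v\<close>;
  inserting \<open>y = T u\<close> shows that the adjoint maps \<open>v\<close> to \<open>w\<close>.
\<close>

lemma hilbert_adjoint_surjective:
  assumes T: "clinear_between D (carr K) T" and D: "csubspace D"
    and g: "clinear_between (carr K) D g" "\<And>u. u \<in> D \<Longrightarrow> g (T u) = u"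
    and bdd: "\<And>y. y \<in> carr K \<Longrightarrow> hnorm H (g y) \<le> C * hnorm K y"
    and w: "w \<in> carr H"
  obtains v where "v \<in> adjoint_domain D H K T" "hilbert_adjoint D H K T v = w"
proof -
  have gc: "g y \<in> carr H" if "y \<in> carr K" for y
    using g(1) that dom by (auto simp: clinear_between_def)
  obtain v where v: "v \<in> carr K" "\<And>y. y \<in> carr K \<Longrightarrow> ip H (g y) w = ip K y v"
  proof (rule Y.riesz[of "\<lambda>y. ip H (g y) w" "C * hnorm H w"])
    show "ip H (g (y + z)) w = ip H (g y) w + ip H (g z) w" if "y \<in> carr K" "z \<in> carr K" for y z
      using g(1) that gc w by (simp add: clinear_between_def X.ip_add_left)
    show "ip H (g (a *\<^sub>C y)) w = a * ip H (g y) w" if "y \<in> carr K" for a y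
      using g(1) that gc w by (simp add: clinear_between_def X.ip_scale_left)
    show "cmod (ip H (g y) w) \<le> C * hnorm H w * hnorm K y" if "y \<in> carr K" for y
    proof -
      have "cmod (ip H (g y) w) \<le> hnorm H (g y) * hnorm H w"
        using X.cauchy_schwarz gc that w by blast
      also have "\<dots> \<le> (C * hnorm K y) * hnorm H w"
        using bdd[OF that] w by (intro mult_right_mono) auto
      finally show ?thesis
        by (simp add: mult_ac)
    qed
  qed blast
  have eq: "ip K (T u) v = ip H u w" if "u \<in> D" for u
    using v(2)[of "T u"] g(2)[OF that] T that by (simp add: clinear_between_def)
  have "v \<in> adjoint_domain D H K T"
    unfolding adjoint_domain_def using v(1) w eq by blast
  then show ?thesis
    using that hilbert_adjoint_eqI[OF w eq] by blast
qed

end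

theorem theorem5p3:
  fixes A :: "('y::{t2_space, second_countable_topology} set \<times> ('y \<Rightarrow> 'b::real_normed_vector)) set"
    and \<Sigma> \<Omega> :: "complex set"
    and H1 :: "('y, 'e::complex_vector, 'h1::complex_hilbert) hbundle"
    and H2 :: "('y, 'f::complex_vector, 'h2::complex_hilbert) hbundle"
    and D :: "('y, 'e, 'd::complex_hilbert) hbundle"
    and Ds :: "('y, 'f, 'ds::complex_hilbert) hbundle"
    and P :: "'y \<Rightarrow> complex \<Rightarrow> 'e \<Rightarrow> 'f"
    and y :: 'y
    and \<Gamma> :: "(real \<Rightarrow> complex) set"
  defines "Ps \<equiv> adjoint_family D H1 H2 P"
  defines "K \<equiv> singular_kernel \<Sigma> (fibre D y) (fibre H2 y) (P y)"
    and "Ks \<equiv> singular_kernel (cnj ` \<Sigma>) (fibre Ds y) (fibre H1 y) (Ps y)"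
  assumes "fredholm_setting A \<Sigma> H1 H2 D Ds P"
    and "open \<Omega>" and "compact (closure \<Omega>)" and "closure \<Omega> \<subseteq> \<Sigma>"
    and "smooth_oriented_boundary \<Omega> \<Gamma>"
    and "sing_b \<Sigma> (fibre D y) (fibre H2 y) (P y) \<subseteq> \<Omega>"
  shows "sesquilinear_pairing K Ks (flat_pairing \<Gamma> (fibre H1 y) (Ps y)) \<and>
         nondegenerate_pairing K Ks (flat_pairing \<Gamma> (fibre H1 y) (Ps y))"
proof -
  let ?D = "fibre D y" and ?H1 = "fibre H1 y" and ?H2 = "fibre H2 y" and ?Ds = "fibre Ds y"
  let ?S = "sing_b \<Sigma> ?D ?H2 (P y)"
  note setting = assms(4)[unfolded fredholm_setting_def]
  have \<Sigma>: "open \<Sigma>" "connected \<Sigma>"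
    using setting by - (elim conjE, assumption)+
  have bundles: "smooth_hilbert_bundle A H1" "smooth_hilbert_bundle A H2"
    "smooth_hilbert_bundle A D" "smooth_hilbert_bundle A Ds"
    using setting by - (elim conjE, assumption)+
  have emb: "embedded_bundle D H1" "embedded_bundle Ds H2" and dense: "fibrewise_dense D H1"
    using setting by - (elim conjE, assumption)+
  have fam: "fredholm_family A \<Sigma> D H1 H2 P" and fam': "fredholm_family A (cnj ` \<Sigma>) Ds H2 H1 Ps"
    using setting unfolding Ps_def by - (elim conjE, assumption)+
  have dom: "adjoint_domain (carr ?D) ?H1 ?H2 (P y \<sigma>) = carr ?Ds" if "\<sigma> \<in> \<Sigma>" for \<sigma>
    using setting that by (elim conjE) simp
  have fin: "finite ?S"
    using setting by (elim conjE) simp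
  have hilb: "hilb ?D" "hilb ?H1" "hilb ?H2" "hilb ?Ds"
    using bundles[unfolded smooth_hilbert_bundle_def, THEN conjunct1, THEN spec, of y]
    by (simp_all only: hilb_def)
  note emb_y = emb[unfolded embedded_bundle_def, THEN conjunct1, THEN spec, of y]
  interpret H1H2: densely_defined ?H1 ?H2 "carr ?D"
  proof (intro densely_defined.intro two_hilb.intro hilb densely_defined_axioms.intro)
    show "carr ?D \<subseteq> carr ?H1"
      using emb_y(1) by (rule conjunct1)
    show "\<exists>v\<in>carr ?D. hnorm ?H1 (u - v) < e" if "u \<in> carr ?H1" "e > 0" for u e
      using dense[unfolded fibrewise_dense_def, THEN spec, of y] that by blast
  qed
  have incl: "bounded_op ?D ?H1 (\<lambda>u. u)" and incl': "bounded_op ?Ds ?H2 (\<lambda>v. v)"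
    unfolding bounded_op_def clinear_between_def
    using emb_y[THEN conjunct1] emb_y[THEN conjunct2] by (simp_all add: subset_iff)
  note fam_y = fam[unfolded fredholm_family_def, THEN conjunct2, THEN conjunct2]
    fam'[unfolded fredholm_family_def, THEN conjunct2, THEN conjunct2]
  have holo: "holo_family \<Sigma> ?D ?H2 (P y)" "holo_family (cnj ` \<Sigma>) ?Ds ?H1 (Ps y)"
    using fam_y[THEN conjunct2, THEN conjunct1, THEN spec, of y] by simp_all
  have fred: "fredholm_op (carr ?D) ?H2 (P y \<sigma>)" if "\<sigma> \<in> \<Sigma>" for \<sigma>
    using fam_y(1)[THEN conjunct1, THEN spec, of y] that by simp
  have fred': "fredholm_op (carr ?Ds) ?H1 (Ps y \<tau>)" if "\<tau> \<in> cnj ` \<Sigma>" for \<tau>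
    using fam_y(2)[THEN conjunct1, THEN spec, of y] that by (rule bspec)
  interpret DH2: two_hilb ?D ?H2
    by (intro two_hilb.intro hilb)
  have inverse: "\<exists>g. bounded_op ?H2 ?D g \<and> (\<forall>u\<in>carr ?D. g (P y \<sigma> u) = u) \<and> (\<forall>v\<in>carr ?H2. P y \<sigma> (g v) = v)"
    if "\<sigma> \<in> \<Sigma> - ?S" for \<sigma>
    using that unfolding sing_b_def invertible_op_def by blast
  have surj: "\<exists>u\<in>carr ?D. P y \<sigma> u = v" if "\<sigma> \<in> \<Sigma> - ?S" "v \<in> carr ?H2" for \<sigma> v
    using inverse[OF that(1)] that(2) unfolding bounded_op_def clinear_between_def by blast
  have Ps_eq: "Ps y (cnj \<sigma>) = hilbert_adjoint (carr ?D) ?H1 ?H2 (P y \<sigma>)" for \<sigma>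
    by (simp add: Ps_def adjoint_family_def fun_eq_iff)
  have P: "fredholm_family_on ?D ?H2 \<Sigma> ?S (P y)"
  proof (unfold_locales)
    show "u = 0" if u: "\<sigma> \<in> \<Sigma> - ?S" "u \<in> carr ?D" "P y \<sigma> u = 0" for \<sigma> u
    proof -
      obtain g where g: "bounded_op ?H2 ?D g" "\<forall>u\<in>carr ?D. g (P y \<sigma> u) = u"
        using inverse[OF u(1)] by blast
      interpret inv: two_hilb ?H2 ?D
        by (intro two_hilb.intro hilb)
      show ?thesis
        using g(2) u inv.linear_zero[OF inv.bounded_op_linear[OF g(1)]] by metis
    qed
  qed (use \<Sigma> fin holo fred surj in auto)
  have P': "fredholm_family_on ?Ds ?H1 (cnj ` \<Sigma>) (cnj ` ?S) (Ps y)"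
  proof (intro fredholm_family_on.intro two_hilb.intro hilb fredholm_family_on_axioms.intro)
    fix \<tau> assume "\<tau> \<in> cnj ` \<Sigma> - cnj ` ?S"
    then obtain \<sigma> where \<sigma>: "\<sigma> \<in> \<Sigma> - ?S" "\<tau> = cnj \<sigma>"
      by blast
    then have \<sigma>\<Sigma>: "\<sigma> \<in> \<Sigma>"
      by blast
    show "v = 0" if "v \<in> carr ?Ds" "Ps y \<tau> v = 0" for v
      using H1H2.hilbert_adjoint_injective[of v "P y \<sigma>", OF _ _ surj[OF \<sigma>(1)]] that
      unfolding \<sigma>(2) Ps_eq dom[OF \<sigma>\<Sigma>] by blast
    show "\<exists>v\<in>carr ?Ds. Ps y \<tau> v = w" if w: "w \<in> carr ?H1" for w
    proof -
      obtain g where g: "bounded_op ?H2 ?D g" "\<And>u. u \<in> carr ?D \<Longrightarrow> g (P y \<sigma> u) = u"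
        using inverse[OF \<sigma>(1)] by blast
      interpret inv: two_hilb ?H2 ?D
        by (intro two_hilb.intro hilb)
      interpret DH1: two_hilb ?D ?H1
        by (intro two_hilb.intro hilb)
      obtain B where B: "B \<ge> 0" "\<And>v. v \<in> carr ?H2 \<Longrightarrow> hnorm ?D (g v) \<le> B * hnorm ?H2 v"
        using inv.bounded_opE[OF g(1)] by blast
      obtain C where C: "C \<ge> 0" "\<And>u. u \<in> carr ?D \<Longrightarrow> hnorm ?H1 u \<le> C * hnorm ?D u"
        using DH1.bounded_opE[OF incl] by blast
      note glin = inv.bounded_op_linear[OF g(1)]
      have "hnorm ?H1 (g v) \<le> (C * B) * hnorm ?H2 v" if "v \<in> carr ?H2" for v
        using C(2)[OF inv.linear_carr[OF glin that]] mult_left_mono[OF B(2)[OF that] C(1)] by simp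
      then obtain v where "v \<in> adjoint_domain (carr ?D) ?H1 ?H2 (P y \<sigma>)"
        "hilbert_adjoint (carr ?D) ?H1 ?H2 (P y \<sigma>) v = w"
        using H1H2.hilbert_adjoint_surjective[OF DH2.holo_family_linear[OF holo(1) \<sigma>\<Sigma>] DH2.X.subspace
            glin g(2) _ w] by blast
      then show ?thesis
        unfolding \<sigma>(2) Ps_eq dom[OF \<sigma>\<Sigma>] by blast
    qed
  qed (use \<Sigma> fin holo fred' in auto)
  have dual: "ip ?H2 (P y \<sigma> u) v = ip ?H1 u (Ps y (cnj \<sigma>) v)"
    if "\<sigma> \<in> \<Sigma>" "u \<in> carr ?D" "v \<in> carr ?Ds" for \<sigma> u v
    using H1H2.hilbert_adjoint(2)[of v "P y \<sigma>" u] that unfolding Ps_eq dom[OF that(1)] by blast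
  have residue: "residue_functional \<Sigma> ?S (\<lambda>F. 1 / (2 * complex_of_real pi) * boundary_integral \<Gamma> F)"
    using assms(5-9) bounded_subset[OF compact_imp_bounded[OF assms(6)] closure_subset] \<Sigma> fin
    by (intro boundary_residue_functional) auto
  interpret dual_fredholm_families ?D ?H1 ?Ds ?H2 \<Sigma> ?S "P y" "Ps y"
    "\<lambda>F. 1 / (2 * complex_of_real pi) * boundary_integral \<Gamma> F"
    by (intro dual_fredholm_families.intro dual_fredholm_families_axioms.intro P P' residue incl incl' dual)
  have "flat_pairing \<Gamma> ?H1 (Ps y) = pairing"
    by (intro ext) (simp only: flat_pairing_def pairing_def)
  then show ?thesis
    unfolding K_def Ks_def using sesquilinear nondegenerate by simp
qed

end
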